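(* Let $\alpha_0,\alpha_1>0$ and $\gamma>1$, and let $G:\mathbb R^d\times\mathbb R^d\to\mathbb R$ be a function which is $\mathbb Z^d$-periodic in $x$, convex in $p$, and satisfies (G1) $\alpha_0|p|^\gamma-1/\alpha_0\le G(x,p)\le\alpha_1(|p|^\gamma+1)$ for all $x,p\in\mathbb R^d$; (G2) $|G(x,p)-G(x,q)|\le\alpha_1(|p|+|q|+1)^{\gamma-1}|p-q|$ for all $x,p,q\in\mathbb R^d$; (G3) $|G(x,p)-G(y,p)|\le\alpha_1(|p|^\gamma+1)|x-y|$ for all $x,y,p\in\mathbb R^d$. Let $c\in\mathbb R$ be the critical constant associated with $G$, i.e. the unique real number for which the equation $-\mathcal Iu+G(x,Du)=c$ in $\mathbb T^d$ admits solutions. Then the Hamiltonian $H(x,p):=G(x,p)-c$ satisfies: (EX) the equation $\lambda u-\mathcal Iu+H(x,Du)=0$ in $\mathbb T^d$ admits solutions for every $\lambda\in[0,1)$; (LB) there exists a constant $\kappa>0$ such that any continuous solution $u$ of $\lambda u-\mathcal Iu+H(x,Du)=0$ in $\mathbb T^d$ with $\lambda\in[0,1)$ satisfies $|Du(x)|\le\kappa$ for a.e. $x\in\mathbb T^d$.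
   Context: $\mathbb T^d=\mathbb R^d/\mathbb Z^d$; functions on $\mathbb T^d$ are identified with $\mathbb Z^d$-periodic functions on $\mathbb R^d$. $B_R$ is the open ball of radius $R$ centered at $0$, $B=B_1$, $\mathbf 1_B$ its characteristic function. Standing assumptions: $\nu$ is a positive Borel measure on $\mathbb R^d$ and $j:\mathbb T^d\times\mathbb R^d\to\mathbb R^d$ is Borel measurable, with: (N) $\int_{\mathbb R^d}1\wedge|z|^2\,\nu(dz)\le C_\nu$ for some $C_\nu>0$; (J1) there is $C_j>0$ with $|j(x,z)|\le C_j|z|$ and $|j(x,z)-j(y,z)|\le C_j|x-y||z|$ for all $x,y\in\mathbb T^d$, $z\in\mathbb R^d$; (J2) for every $R>0$ there is $C_R>0$ with $\int_{\mathbb R^d\setminus B_R}|j(x,z)-j(y,z)|\,\nu(dz)\le C_R|x-y|$ for all $x,y\in\mathbb T^d$. For $\varphi\in C^2(\mathbb T^d)$, $\mathcal I\varphi(x)=\int_{\mathbb R^d}\big(\varphi(x+j(x,z))-\varphi(x)-\mathbf 1_B(z)\langle j(x,z),D\varphi(x)\rangle\big)\nu(dz)$. Solutions are continuous viscosity solutions: $u\in C(\mathbb T^d)$ is a subsolution (resp. supersolution) of $\lambda u-\mathcal Iu+F(x,Du)=a$ in $\mathbb T^d$ if, whenever $\varphi\in C^2(\mathbb T^d)$ and $u-\varphi$ attains its maximum (resp. minimum) over $\mathbb T^d$ at $\hat x$, one has $\lambda u(\hat x)-\mathcal I\varphi(\hat x)+F(\hat x,D\varphi(\hat x))\le a$ (resp.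 $\ge a$). A solution is both. For $G$ as in the statement there is exactly one $c\in\mathbb R$ for which $-\mathcal Iu+G(x,Du)=c$ has a solution. *)

theory Defs
  imports "HOL-Analysis.Analysis"
begin

text \<open>Functions on the torus $\mathbf T^d = \mathbf R^d / \mathbf Z^d$ are represented by
  $\mathbf Z^d$-periodic functions on $\mathbf R^d$. The codomain is arbitrary, so that the
  predicate also applies to curried functions such as \<open>\<lambda>x z. j x z\<close>, where it
  means periodicity in the first argument.\<close>

definition Zd_periodic :: "(real ^ 'd \<Rightarrow> 'b) \<Rightarrow> bool" where
  "Zd_periodic f \<longleftrightarrow> (\<forall>x k. (\<forall>i. k $ i \<in> \<int>) \<longrightarrow> f (x + k) = f x)"

text \<open>The gradient; meaningful only where the function is differentiable.\<close>

definition grad :: "('a::real_inner \<Rightarrow> real) \<Rightarrow> 'a \<Rightarrow> 'a" where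
  "grad f x = (THE D. GDERIV f x :> D)"

text \<open>Here \<open>g\<close> is the gradient and \<open>h\<close> the Hessian, as a continuous map into the
  bounded linear operators.\<close>

definition C2_torus :: "(real ^ 'd \<Rightarrow> real) \<Rightarrow> bool" where
  "C2_torus \<phi> \<longleftrightarrow> Zd_periodic \<phi> \<and>
     (\<exists>g (h :: real ^ 'd \<Rightarrow> (real ^ 'd) \<Rightarrow>\<^sub>L (real ^ 'd)).
        (\<forall>x. GDERIV \<phi> x :> g x) \<and>
        (\<forall>x. (g has_derivative blinfun_apply (h x)) (at x)) \<and>
        continuous_on UNIV h)"

definition nonlocal_op ::
  "(real ^ 'd) measure \<Rightarrow> (real ^ 'd \<Rightarrow> real ^ 'd \<Rightarrow> real ^ 'd) \<Rightarrow>
     (real ^ 'd \<Rightarrow> real) \<Rightarrow> real ^ 'd \<Rightarrow> real" where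
  "nonlocal_op \<nu> j \<phi> x =
     (LINT z|\<nu>. \<phi> (x + j x z) - \<phi> x - indicator (ball 0 1) z * (j x z \<bullet> grad \<phi> x))"

text \<open>Viscosity sub- and supersolutions and solutions of
  $\lambda u - \mathcal I u + F(x, Du) = a$. Since \<open>u\<close> and the test functions are
  periodic, extrema over the torus are extrema over the whole space.\<close>

definition visc_subsolution ::
  "(real ^ 'd) measure \<Rightarrow> (real ^ 'd \<Rightarrow> real ^ 'd \<Rightarrow> real ^ 'd) \<Rightarrow> real \<Rightarrow>
     (real ^ 'd \<Rightarrow> real ^ 'd \<Rightarrow> real) \<Rightarrow> real \<Rightarrow> (real ^ 'd \<Rightarrow> real) \<Rightarrow> bool" where
  "visc_subsolution \<nu> j lam F a u \<longleftrightarrow> Zd_periodic u \<and> continuous_on UNIV u \<and>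
     (\<forall>\<phi> xh. C2_torus \<phi> \<and> (\<forall>x. u x - \<phi> x \<le> u xh - \<phi> xh) \<longrightarrow>
        lam * u xh - nonlocal_op \<nu> j \<phi> xh + F xh (grad \<phi> xh) \<le> a)"

definition visc_supersolution ::
  "(real ^ 'd) measure \<Rightarrow> (real ^ 'd \<Rightarrow> real ^ 'd \<Rightarrow> real ^ 'd) \<Rightarrow> real \<Rightarrow>
     (real ^ 'd \<Rightarrow> real ^ 'd \<Rightarrow> real) \<Rightarrow> real \<Rightarrow> (real ^ 'd \<Rightarrow> real) \<Rightarrow> bool" where
  "visc_supersolution \<nu> j lam F a u \<longleftrightarrow> Zd_periodic u \<and> continuous_on UNIV u \<and>
     (\<forall>\<phi> xh. C2_torus \<phi> \<and> (\<forall>x. u x - \<phi> x \<ge> u xh - \<phi> xh) \<longrightarrow>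
        lam * u xh - nonlocal_op \<nu> j \<phi> xh + F xh (grad \<phi> xh) \<ge> a)"

definition visc_solution ::
  "(real ^ 'd) measure \<Rightarrow> (real ^ 'd \<Rightarrow> real ^ 'd \<Rightarrow> real ^ 'd) \<Rightarrow> real \<Rightarrow>
     (real ^ 'd \<Rightarrow> real ^ 'd \<Rightarrow> real) \<Rightarrow> real \<Rightarrow> (real ^ 'd \<Rightarrow> real) \<Rightarrow> bool" where
  "visc_solution \<nu> j lam F a u \<longleftrightarrow>
     visc_subsolution \<nu> j lam F a u \<and> visc_supersolution \<nu> j lam F a u"

definition is_critical_constant ::
  "(real ^ 'd) measure \<Rightarrow> (real ^ 'd \<Rightarrow> real ^ 'd \<Rightarrow> real ^ 'd) \<Rightarrow>
     (real ^ 'd \<Rightarrow> real ^ 'd \<Rightarrow> real) \<Rightarrow> real \<Rightarrow> bool" where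
  "is_critical_constant \<nu> j G c \<longleftrightarrow>
     (\<exists>u. visc_solution \<nu> j 0 G c u) \<and>
     (\<forall>c'. (\<exists>u. visc_solution \<nu> j 0 G c' u) \<longrightarrow> c' = c)"

text \<open>The bound $|Du| \le \kappa$ almost everywhere. For a function that is merely
  continuous, a bound on the pointwise derivative almost everywhere carries little
  information (Cantor function); \<open>Du\<close> is the weak gradient, so the bound includes that
  \<open>u\<close> is Lipschitz continuous, and for such \<open>u\<close> the weak gradient is the pointwise
  one almost everywhere. Differentiability is required explicitly because \<open>grad\<close> is
  a total function.\<close>

definition grad_bounded_ae :: "real \<Rightarrow> (real ^ 'd \<Rightarrow> real) \<Rightarrow> bool" where
  "grad_bounded_ae \<kappa> u \<longleftrightarrow>
     (\<exists>L. L-lipschitz_on UNIV u) \<and>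
     (AE x in lebesgue. u differentiable (at x) \<and> norm (grad u x) \<le> \<kappa>)"

end

theory Submission
  imports Defs
begin

text \<open>
  For \<open>lam > 0\<close> a solution comes from Perron's method, with no barriers needed beyond constants.
  Since test functions are global, the bump construction requires no localization; comparison
  of semicontinuous sub- and supersolutions follows by doubling the variables in
  \<open>\<mu> u(x) - v(y) - n |x - y|\<^sup>2 / 2\<close> with \<open>\<mu> < 1\<close> fixed, where convexity and superlinear
  growth produce a gain \<open>(1 - \<mu>) |p|\<^sup>\<gamma>\<close> that beats the \<open>x\<close>-dependence of \<open>G\<close>.

  The Lipschitz bound is a weak Bernstein argument for the logarithm of \<open>u + const\<close>, normalized to size
  \<open>M\<close>, an upper bound of 1 and the oscillation. It yields the Lipschitz constant \<open>\<Lambda> M\<close> with \<open>\<Lambda>\<close>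
  depending only on the data, and this linear dependence together with \<open>\<gamma> > 1\<close> bounds the
  oscillation itself. Rademacher's theorem then gives the bound on the gradient almost everywhere.

  In both arguments the viscosity inequality is used with the solution itself inside the
  integral, at points where it is touched by a paraboloid (\<open>usc_subsolution_pointwise\<close>).
\<close>

section \<open>Lebesgue density and Rademacher's theorem\<close>

text \<open>The obstacle is a circle: the nonlocal terms are controlled only through the size of the
  solution, while testing with constants bounds \<open>lam * u\<close> alone and says nothing about
  \<open>u\<close> as \<open>lam\<close> tends to 0. Homogeneity breaks it. With oscillation M >= 1
  the integrals are at most linear in M, whereas a slope of size M costs M^\<gamma> in the
  Hamiltonian. The logarithm, and likewise the factor \<mu> in comparison, makes the two slopes at a
  maximum of the doubled function parallel with ratio t > 1. What is then compared is G(x, t p) with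
  t G(x, p), and these are separated by a multiple of (t - 1) |p|^\<gamma> up to lower order. A
  plain difference u(x) - u(y) would give equal slopes and no gain. Existence for
  \<open>lam = 0\<close> is the one case that Perron's method does not supply; it is part of the
  definition of the critical constant. Rademacher's theorem is assembled from approximate slopes
  with a fixed tolerance instead of derivatives: the sets where a given slope works at a given scale
  are closed, so measurability costs nothing, and the tolerance is sent to 0 only at the very
  end.\<close>

lemma lebesgue_density:
  fixes S :: "'a::euclidean_space set"
  assumes S: "S \<in> sets borel" and e: "0 < e"
  shows "AE x in lborel. x \<in> S \<longrightarrow> (\<exists>d>0. \<forall>r. 0 < r \<and> r < d \<longrightarrow>
    emeasure lborel (ball x r - S) \<le> ennreal e * emeasure lborel (ball x r))"
proof -
  \<comment> \<open>\<open>A\<close> collects the points of \<open>S\<close> with arbitrarily small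
    bad radii. A bounded piece D of it sits in an open T with T - D small, and Vitali covers D up to
    a null set by disjoint bad balls inside T. Each loses more than the fraction \<open>e\<close> of
    its volume to the complement of \<open>S\<close>, hence to T - D, so e |D| <= |T - D|.\<close>
  define bad where "bad x r \<longleftrightarrow> 0 < r \<and>
     ennreal e * emeasure lborel (ball x r) < emeasure lborel (ball x r - S)" for x r
  define U where "U k = {x. \<exists>r. bad x r \<and> r < 1 / real (Suc k)}" for k
  define A where "A = S \<inter> (\<Inter>k. U k)"
  have ball_vol: "emeasure lborel (ball x r) = emeasure lborel (ball y r)" for x y :: 'a and r :: real
    by (cases "r \<ge> 0") (simp_all add: emeasure_ball ball_empty)
  \<comment> \<open>Badness is a strict inequality, so by continuity of measure a slightly smaller
    concentric ball already satisfies it. That smaller ball lies in every ball of the original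
    radius with a nearby centre.\<close>
  have openU: "open (U k)" for k
  proof (subst open_contains_ball, intro ballI)
    fix x assume "x \<in> U k"
    then obtain r where r: "0 < r" "r < 1 / real (Suc k)"
      and b: "ennreal e * emeasure lborel (ball x r) < emeasure lborel (ball x r - S)"
      by (auto simp: U_def bad_def)
    define B where "B n = ball x (r - r / real (Suc n)) - S" for n
    have inc: "incseq B"
    proof (rule incseq_SucI)
      fix n
      have "r / real (Suc (Suc n)) \<le> r / real (Suc n)"
        using r by (intro divide_left_mono) auto
      then show "B n \<subseteq> B (Suc n)"
        unfolding B_def by (intro Diff_mono subset_ball) auto
    qed
    have UB: "(\<Union>n. B n) = ball x r - S"
    proof (intro equalityI subsetI)
      fix y assume "y \<in> (\<Union>n. B n)"
      then obtain n where n: "dist x y < r - r / real (Suc n)" "y \<notin> S" by (auto simp: B_def)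
      have "r / real (Suc n) \<ge> 0" using r by simp
      with n show "y \<in> ball x r - S" by auto
    next
      fix y assume y: "y \<in> ball x r - S"
      then have "(r - dist x y) / r > 0" using r by auto
      then obtain n where n: "inverse (real (Suc n)) < (r - dist x y) / r" using reals_Archimedean by blast
      have "r / real (Suc n) = r * inverse (real (Suc n))" by (simp add: divide_inverse)
      also have "\<dots> < r * ((r - dist x y) / r)" using n r by (intro mult_strict_left_mono) auto
      also have "\<dots> = r - dist x y" using r by simp
      finally have "dist x y < r - r / real (Suc n)" by simp
      with y show "y \<in> (\<Union>n. B n)" by (auto simp: B_def)
    qed
    have "(\<lambda>n. emeasure lborel (B n)) \<longlonglongrightarrow> emeasure lborel (\<Union>n. B n)"
    proof (rule Lim_emeasure_incseq)
      show "range B \<subseteq> sets lborel" using S by (auto simp: B_def)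
    qed (rule inc)
    then have "eventually (\<lambda>n. ennreal e * emeasure lborel (ball x r) < emeasure lborel (B n)) sequentially"
      using b by (intro order_tendstoD(1)[where a="ennreal e * emeasure lborel (ball x r)"]) (auto simp: UB)
    then obtain n where n: "ennreal e * emeasure lborel (ball x r) < emeasure lborel (B n)"
      by (auto simp: eventually_sequentially)
    have rn: "r / real (Suc n) > 0" using r by simp
    show "\<exists>d>0. ball x d \<subseteq> U k"
    proof (intro exI conjI subsetI)
      fix x' assume x': "x' \<in> ball x (r / real (Suc n))"
      have "B n \<subseteq> ball x' r - S"
      proof
        fix y assume "y \<in> B n"
        moreover have "dist x' y \<le> dist x x' + dist x y" by (metis dist_commute dist_triangle)
        ultimately show "y \<in> ball x' r - S" using x' by (auto simp: B_def)
      qed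
      then have "emeasure lborel (B n) \<le> emeasure lborel (ball x' r - S)"
        using S by (intro emeasure_mono) auto
      with n r ball_vol[of x r x'] show "x' \<in> U k"
        by (auto simp: U_def bad_def intro!: exI[of _ r])
    qed (use rn in auto)
  qed
  have A_borel: "A \<in> sets borel" using S openU by (auto simp: A_def)
  have null: "A \<inter> ball 0 (real n) \<in> null_sets lborel" for n
  proof -
    define D where "D = A \<inter> ball 0 (real n)"
    have D: "D \<in> sets borel" using A_borel by (simp add: D_def)
    have fin: "emeasure lborel D < \<infinity>"
    proof -
      have "emeasure lborel D \<le> emeasure lborel (ball (0::'a) (real n))"
        by (rule emeasure_mono) (auto simp: D_def)
      then show ?thesis using emeasure_lborel_ball_finite[of "0::'a" "real n"] by (simp add: top.not_eq_extremum)
    qed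
    have small: "ennreal e * emeasure lborel D \<le> ennreal \<eta>" if \<eta>: "\<eta> > 0" for \<eta>
    proof -
      obtain T where T: "open T" "D \<subseteq> T" "emeasure lebesgue (T - D) < ennreal \<eta>"
        by (rule sets_lebesgue_outer_open[of D \<eta>]) (use D \<eta> in auto)
      define K where "K = {(x, r). bad x r \<and> ball x r \<subseteq> T}"
      obtain C where C: "countable C" "C \<subseteq> K"
        "pairwise (\<lambda>i j. disjnt (ball (fst i) (snd i)) (ball (fst j) (snd j))) C"
        "negligible (D - (\<Union>i\<in>C. ball (fst i) (snd i)))"
      proof (rule Vitali_covering_theorem_balls[of D K fst snd])
        fix x and d :: real assume x: "x \<in> D" and d: "0 < d"
        obtain s where s: "s > 0" "ball x s \<subseteq> T" using T x open_contains_ball by blast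
        have "0 < min s d" using s d by simp
        then obtain k where k: "inverse (real (Suc k)) < min s d" using reals_Archimedean by blast
        have "x \<in> U k" using x by (auto simp: D_def A_def)
        then obtain r where r: "bad x r" "r < 1 / real (Suc k)" by (auto simp: U_def)
        have "r < s" "r < d" using r(2) k unfolding inverse_eq_divide by linarith+
        then have "ball x r \<subseteq> T" using s by (meson less_imp_le order_trans subset_ball)
        with r \<open>r < d\<close> show "\<exists>i. i \<in> K \<and> x \<in> ball (fst i) (snd i) \<and> snd i < d"
          by (intro exI[of _ "(x, r)"]) (auto simp: K_def bad_def)
      qed (use that in blast)
      define b where "b = (\<lambda>i::'a \<times> real. ball (fst i) (snd i))"
      have disj: "disjoint_family_on b C"
        using C(3) by (auto simp: disjoint_family_on_def pairwise_def disjnt_def b_def)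
      have Cb: "ennreal e * emeasure lborel (b i) \<le> emeasure lborel (b i - S)" "b i \<subseteq> T" if "i \<in> C" for i
        using subsetD[OF C(2) that] by (auto simp: K_def bad_def b_def)
      have "emeasure lborel D \<le> emeasure lborel (\<Union>i\<in>C. b i)"
      proof -
        have UC: "(\<Union>i\<in>C. b i) \<in> sets borel" unfolding b_def by (intro borel_open open_UN) auto
        have "D - (\<Union>i\<in>C. b i) \<in> null_sets lborel"
          using C(4) UC D by (auto simp: negligible_iff_null_sets b_def null_sets_completion_iff)
        then have "emeasure lborel (D - (\<Union>i\<in>C. b i)) = 0" by auto
        have "emeasure lborel D \<le> emeasure lborel ((D - (\<Union>i\<in>C. b i)) \<union> (\<Union>i\<in>C. b i))"
          using D UC by (intro emeasure_mono) auto
        also have "\<dots> \<le> emeasure lborel (D - (\<Union>i\<in>C. b i)) + emeasure lborel (\<Union>i\<in>C. b i)"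
          using D UC by (intro emeasure_subadditive) auto
        also have "\<dots> = emeasure lborel (\<Union>i\<in>C. b i)"
          using \<open>emeasure lborel (D - (\<Union>i\<in>C. b i)) = 0\<close> by simp
        finally show ?thesis .
      qed
      then have "ennreal e * emeasure lborel D \<le> ennreal e * emeasure lborel (\<Union>i\<in>C. b i)"
        by (rule mult_left_mono) simp
      also have "\<dots> = ennreal e * (\<integral>\<^sup>+ i. emeasure lborel (b i) \<partial>count_space C)"
        by (subst emeasure_UN_countable) (use C disj in \<open>auto simp: b_def\<close>)
      also have "\<dots> = (\<integral>\<^sup>+ i. ennreal e * emeasure lborel (b i) \<partial>count_space C)"
        by (simp add: nn_integral_cmult)
      also have "\<dots> \<le> (\<integral>\<^sup>+ i. emeasure lborel (b i - S) \<partial>count_space C)"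
        by (intro nn_integral_mono) (use Cb in auto)
      also have "\<dots> = emeasure lborel (\<Union>i\<in>C. b i - S)"
      proof (rule emeasure_UN_countable[symmetric])
        show "disjoint_family_on (\<lambda>i. b i - S) C" using disj unfolding disjoint_family_on_def by blast
      qed (use C S in \<open>auto simp: b_def\<close>)
      also have "\<dots> \<le> emeasure lborel (T - D)"
      proof (rule emeasure_mono)
        show "(\<Union>i\<in>C. b i - S) \<subseteq> T - D" using Cb(2) by (fastforce simp: D_def A_def)
      qed (use T D in auto)
      also have "\<dots> = emeasure lebesgue (T - D)" using T D by simp
      also have "\<dots> \<le> ennreal \<eta>" using T by simp
      finally show ?thesis .
    qed
    have "emeasure lborel D = 0"
    proof (rule ccontr)
      assume "emeasure lborel D \<noteq> 0"
      then have pos: "measure lborel D > 0" using fin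
        by (simp add: emeasure_eq_ennreal_measure top.not_eq_extremum zero_less_measure_iff)
      then have "ennreal e * emeasure lborel D \<le> ennreal (e * measure lborel D / 2)"
        using e by (intro small) auto
      then have "ennreal (e * measure lborel D) \<le> ennreal (e * measure lborel D / 2)"
        using fin e by (simp add: emeasure_eq_ennreal_measure top.not_eq_extremum ennreal_mult)
      then have "e * measure lborel D \<le> e * measure lborel D / 2"
        using e pos by (subst (asm) ennreal_le_iff) auto
      moreover have "e * measure lborel D > 0" using e pos by simp
      ultimately show False by linarith
    qed
    with D show ?thesis by (auto simp: D_def null_sets_def)
  qed
  have "A = (\<Union>n. A \<inter> ball 0 (real n))"
    by (auto simp: mem_ball dist_norm reals_Archimedean2)
  with null have "A \<in> null_sets lborel" by (metis null_sets_UN)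
  then show ?thesis
  proof (rule AE_I')
    show "{x \<in> space lborel. \<not> (x \<in> S \<longrightarrow> (\<exists>d>0. \<forall>r. 0 < r \<and> r < d \<longrightarrow>
      emeasure lborel (ball x r - S) \<le> ennreal e * emeasure lborel (ball x r)))} \<subseteq> A"
    proof
      fix x assume "x \<in> {x \<in> space lborel. \<not> (x \<in> S \<longrightarrow> (\<exists>d>0. \<forall>r. 0 < r \<and> r < d \<longrightarrow>
        emeasure lborel (ball x r - S) \<le> ennreal e * emeasure lborel (ball x r)))}"
      then have x: "x \<in> S" "\<not> (\<exists>d>0. \<forall>r. 0 < r \<and> r < d \<longrightarrow>
         emeasure lborel (ball x r - S) \<le> ennreal e * emeasure lborel (ball x r))" by auto
      have "x \<in> U k" for k
      proof -
        have "1 / real (Suc k) > 0" by simp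
        with x(2) have "\<exists>r. 0 < r \<and> r < 1 / real (Suc k) \<and>
            \<not> emeasure lborel (ball x r - S) \<le> ennreal e * emeasure lborel (ball x r)" by blast
        then show ?thesis unfolding U_def bad_def not_le by blast
      qed
      with x show "x \<in> A" by (auto simp: A_def)
    qed
  qed
qed

section \<open>Approximate slopes in one dimension, through Stieltjes measures\<close>

definition add_measure :: "'a measure \<Rightarrow> 'a measure \<Rightarrow> 'a measure" where
  "add_measure M N = measure_of (space M) (sets M) (\<lambda>A. emeasure M A + emeasure N A)"

lemma emeasure_add_measure:
  assumes "sets N = sets M" "A \<in> sets M"
  shows "emeasure (add_measure M N) A = emeasure M A + emeasure N A"
proof (rule emeasure_measure_of[OF add_measure_def])
  show "countably_additive (sets (add_measure M N)) (\<lambda>A. emeasure M A + emeasure N A)"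
    using assms by (auto simp: countably_additive_def add_measure_def suminf_add[symmetric] suminf_emeasure)
qed (use assms in \<open>auto simp: positive_def add_measure_def sets.space_closed\<close>)

lemma sets_add_measure: "sets (add_measure M N) = sets M"
  by (simp add: add_measure_def)

lemma mono_lipschitz_continuous:
  fixes F :: "real \<Rightarrow> real"
  assumes mono: "\<And>x y. x \<le> y \<Longrightarrow> F x \<le> F y" and lip: "\<And>x y. x \<le> y \<Longrightarrow> F y - F x \<le> y - x"
  shows "continuous_on UNIV F"
proof (rule lipschitz_on_continuous_on)
  show "1-lipschitz_on UNIV F"
  proof (rule lipschitz_onI)
    fix x y :: real
    show "dist (F x) (F y) \<le> 1 * dist x y"
      using mono[of x y] mono[of y x] lip[of x y] lip[of y x] by (cases "x \<le> y") (auto simp: dist_real_def)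
  qed simp
qed

text \<open>The complementary function x - F x is also nondecreasing. The Stieltjes measures of the
  two functions add up to Lebesgue measure, by uniqueness on boxes, so each of them is dominated by
  it.\<close>

lemma interval_measure_le_lborel:
  fixes F :: "real \<Rightarrow> real"
  assumes mono: "\<And>x y. x \<le> y \<Longrightarrow> F x \<le> F y" and lip: "\<And>x y. x \<le> y \<Longrightarrow> F y - F x \<le> y - x"
    and A: "A \<in> sets borel"
  shows "emeasure (interval_measure F) A \<le> emeasure lborel A"
proof -
  have contF: "continuous_on UNIV F" by (rule mono_lipschitz_continuous[OF mono lip])
  define G where "G x = x - F x" for x
  have monoG: "G x \<le> G y" if "x \<le> y" for x y using lip[OF that] by (simp add: G_def)
  have contG: "continuous_on UNIV G" unfolding G_def by (intro continuous_intros contF)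
  define M where "M = add_measure (interval_measure F) (interval_measure G)"
  have sM: "sets M = sets borel" by (simp add: M_def sets_add_measure)
  have M: "emeasure M B = emeasure (interval_measure F) B + emeasure (interval_measure G) B" if "B \<in> sets borel" for B
    unfolding M_def by (rule emeasure_add_measure) (use that in auto)
  have Icc: "emeasure M {a..b} = b - a" if "a \<le> b" for a b
    using that mono monoG contF contG
    by (subst M) (auto simp: emeasure_interval_measure_Icc ennreal_plus[symmetric] G_def simp del: ennreal_plus)
  have "lborel = M"
  proof (rule lborel_eqI)
    fix l u :: real
    assume "\<And>b. b \<in> Basis \<Longrightarrow> l \<bullet> b \<le> u \<bullet> b"
    then have lu: "l \<le> u" by simp
    have point: "emeasure M {a} = 0" for a using Icc[of a a] by simp
    have fin: "emeasure M {l..u} = ennreal (u - l)" using Icc lu by simp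
    have "emeasure M {l..u} = emeasure M (box l u) + emeasure M ({l..u} - box l u)"
      by (subst plus_emeasure) (auto simp: sM box_real intro!: arg_cong[where f="emeasure M"])
    moreover have "emeasure M ({l..u} - box l u) \<le> emeasure M ({l} \<union> {u})"
      by (rule emeasure_mono) (auto simp: sM box_real)
    moreover have "\<dots> \<le> emeasure M {l} + emeasure M {u}"
      by (rule emeasure_subadditive) (auto simp: sM)
    ultimately show "emeasure M (box l u) = (\<Prod>b\<in>Basis. (u - l) \<bullet> b)"
      using point fin by simp
  qed (use sM in simp)
  then have "emeasure lborel A = emeasure M A" by simp
  also have "\<dots> \<ge> emeasure (interval_measure F) A" using M[OF A] by simp
  finally show ?thesis .
qed

text \<open>The Stieltjes measure of \<open>F\<close> has a density \<open>g\<close> with values in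
  [0, 1]. Almost every x is a density point of a level set on which \<open>g\<close> is nearly
  constant, and that constant serves as slope: the level set fills most of a short interval at x,
  and the rest contributes at most its length.\<close>

lemma mono_lipschitz_approx_slope:
  fixes F :: "real \<Rightarrow> real"
  assumes mono: "\<And>x y. x \<le> y \<Longrightarrow> F x \<le> F y" and lip: "\<And>x y. x \<le> y \<Longrightarrow> F y - F x \<le> y - x"
    and e: "0 < e"
  shows "AE x in lborel. \<exists>q. \<exists>d>0. \<forall>h. \<bar>h\<bar> < d \<longrightarrow> \<bar>F (x + h) - F x - q * h\<bar> \<le> e * \<bar>h\<bar>"
proof -
  define N where "N = interval_measure F"
  have contF: "continuous_on UNIV F" by (rule mono_lipschitz_continuous[OF mono lip])
  have sN: "sets N = sets borel" by (simp add: N_def)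
  have le: "emeasure N A \<le> emeasure lborel A" if "A \<in> sets borel" for A
    using interval_measure_le_lborel[of F A] mono lip that by (auto simp: N_def)
  have NI: "emeasure N {a..b} = ennreal (F b - F a)" if "a \<le> b" for a b
    using that mono contF by (simp add: N_def emeasure_interval_measure_Icc)
  have "absolutely_continuous lborel N"
    using le sN by (fastforce simp: absolutely_continuous_def null_sets_def)
  then obtain g where g[measurable]: "g \<in> borel_measurable lborel" and dens: "density lborel g = N"
    using sigma_finite_measure.Radon_Nikodym[OF sigma_finite_lborel, of N] sN by auto
  have N_eq: "emeasure N A = (\<integral>\<^sup>+x\<in>A. g x \<partial>lborel)" if "A \<in> sets borel" for A
    using that by (subst dens[symmetric]) (simp add: emeasure_density)
  have gle: "AE x in lborel. g x \<le> 1"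
  proof -
    define B where "B n = {x. g x > 1 + ennreal (1 / real (Suc n))} \<inter> {-real n..real n}" for n :: nat
    have Bm: "B n \<in> sets borel" for n unfolding B_def by measurable
    have "B n \<in> null_sets lborel" for n
    proof -
      have fin: "emeasure lborel (B n) < \<infinity>"
      proof -
        have "emeasure lborel (B n) \<le> emeasure lborel {-real n..real n}" by (rule emeasure_mono) (auto simp: B_def)
        then show ?thesis by (simp add: le_less_trans)
      qed
      have "(1 + ennreal (1 / real (Suc n))) * emeasure lborel (B n) = (\<integral>\<^sup>+x\<in>B n. (1 + ennreal (1 / real (Suc n))) \<partial>lborel)"
        using Bm by (simp add: nn_integral_cmult_indicator)
      also have "\<dots> \<le> (\<integral>\<^sup>+x\<in>B n. g x \<partial>lborel)"
        by (intro nn_integral_mono) (auto simp: B_def indicator_def)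
      also have "\<dots> \<le> emeasure lborel (B n)" using N_eq le Bm by metis
      finally have l: "(1 + ennreal (1 / real (Suc n))) * emeasure lborel (B n) \<le> emeasure lborel (B n)" .
      obtain m where m: "emeasure lborel (B n) = ennreal m" "m \<ge> 0"
        using fin by (cases "emeasure lborel (B n)") auto
      have "1 + ennreal (1 / real (Suc n)) = ennreal (1 + 1 / real (Suc n))"
        by (subst ennreal_plus) auto
      then have "ennreal ((1 + 1 / real (Suc n)) * m) \<le> ennreal m"
        using l m by (simp only: ennreal_mult[symmetric]) (simp add: ennreal_mult)
      then have "(1 + 1 / real (Suc n)) * m \<le> m" using m by (simp add: ennreal_le_iff)
      then have "m * (1 / real (Suc n)) \<le> 0" by (simp add: algebra_simps)
      moreover have "1 / real (Suc n) > 0" by simp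
      ultimately have "m \<le> 0" by (metis mult_pos_pos not_le)
      then have "m = 0" using m by simp
      with m Bm show ?thesis by auto
    qed
    then have "(\<Union>n. B n) \<in> null_sets lborel" by (rule null_sets_UN)
    moreover have "{x \<in> space lborel. \<not> g x \<le> 1} \<subseteq> (\<Union>n. B n)"
    proof
      fix x assume "x \<in> {x \<in> space lborel. \<not> g x \<le> 1}"
      then have x: "g x > 1" by auto
      have lim: "(\<lambda>n. 1 + ennreal (1 / real (Suc n))) \<longlonglongrightarrow> 1 + ennreal 0"
        by (intro tendsto_add tendsto_const tendsto_ennrealI LIMSEQ_Suc lim_1_over_n)
      have "eventually (\<lambda>n. 1 + ennreal (1 / real (Suc n)) < g x) sequentially"
        by (rule order_tendstoD(2)[OF lim]) (use x in simp)
      then obtain n0 where n0: "\<And>n. n \<ge> n0 \<Longrightarrow> 1 + ennreal (1 / real (Suc n)) < g x"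
        by (auto simp: eventually_sequentially)
      obtain n1 :: nat where n1: "\<bar>x\<bar> \<le> real n1" using real_arch_simple by blast
      have "x \<in> B (max n0 n1)" using n0[of "max n0 n1"] n1 by (auto simp: B_def)
      then show "x \<in> (\<Union>n. B n)" by blast
    qed
    ultimately show ?thesis by (rule AE_I')
  qed
  \<comment> \<open>On the level set the density is off by at most e/8; its complement will cost e/4
    on either side. The sum stays below e.\<close>
  define e' where "e' = e / 8"
  have e': "e' > 0" using e by (simp add: e'_def)
  define E where "E k = {x. ennreal (real k * e') \<le> g x \<and> g x \<le> ennreal ((real k + 1) * e')}" for k :: nat
  have E: "E k \<in> sets borel" for k unfolding E_def by measurable
  have "AE x in lborel. \<forall>k. x \<in> E k \<longrightarrow> (\<exists>d>0. \<forall>r. 0 < r \<and> r < d \<longrightarrow>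
    emeasure lborel (ball x r - E k) \<le> ennreal (e / 16) * emeasure lborel (ball x r))"
    unfolding AE_all_countable using lebesgue_density[OF E, of "e/16"] e by simp
  with gle show ?thesis
  proof eventually_elim
    fix x
    assume g1: "g x \<le> 1" and dn: "\<forall>k. x \<in> E k \<longrightarrow> (\<exists>d>0. \<forall>r. 0 < r \<and> r < d \<longrightarrow>
    emeasure lborel (ball x r - E k) \<le> ennreal (e / 16) * emeasure lborel (ball x r))"
    define s where "s = enn2real (g x)"
    have s: "g x = ennreal s" "0 \<le> s" "s \<le> 1"
      using g1 by (auto simp: s_def enn2real_leI top.extremum_unique less_top[symmetric])
         (metis ennreal_enn2real_if ennreal_one_neq_top top.extremum_uniqueI)
    define k where "k = nat \<lfloor>s / e'\<rfloor>"
    have fl: "real k = of_int \<lfloor>s / e'\<rfloor>" using s e' by (simp add: k_def)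
    have k: "real k * e' \<le> s" "s \<le> (real k + 1) * e'"
      unfolding fl using e' by (metis floor_divide_lower, metis floor_divide_upper less_imp_le)
    have xk: "x \<in> E k" using k s e' by (auto simp: E_def)
    with dn obtain d where d: "d > 0" and dr: "\<And>r. 0 < r \<Longrightarrow> r < d \<Longrightarrow>
      emeasure lborel (ball x r - E k) \<le> ennreal (e / 16) * emeasure lborel (ball x r)" by blast
    define q where "q = real k * e'"
    have q01: "0 \<le> q" "q \<le> 1" using k s e' by (auto simp: q_def)
    \<comment> \<open>The factor 2 puts the closed interval inside the open ball when x is one of
      its endpoints. The ball has length 4 (b - a), so density e/16 leaves at most e/4 (b - a)
      outside the level set.\<close>
    have main: "\<bar>F b - F a - q * (b - a)\<bar> \<le> e * (b - a)"
      if ab: "a < b" and sub: "{a..b} \<subseteq> ball x (2 * (b - a))" and small: "2 * (b - a) < d" for a b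
    proof -
      have out: "emeasure lborel ({a..b} - E k) \<le> ennreal (e / 4 * (b - a))"
      proof -
        have "emeasure lborel ({a..b} - E k) \<le> emeasure lborel (ball x (2 * (b - a)) - E k)"
          using sub E by (intro emeasure_mono) auto
        also have "\<dots> \<le> ennreal (e / 16) * emeasure lborel (ball x (2 * (b - a)))"
          using dr ab small by simp
        also have "emeasure lborel (ball x (2 * (b - a))) = ennreal (4 * (b - a))"
          using ab by (simp add: ball_eq_greaterThanLessThan algebra_simps)
        also have "ennreal (e / 16) * ennreal (4 * (b - a)) = ennreal (e / 4 * (b - a))"
          using ab e by (simp add: ennreal_mult[symmetric])
        finally show ?thesis .
      qed
      have split: "emeasure M {a..b} = emeasure M ({a..b} \<inter> E k) + emeasure M ({a..b} - E k)"
        if "sets M = sets borel" for M :: "real measure"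
        using that E by (subst plus_emeasure) (auto intro!: arg_cong[where f="emeasure M"])
      have Eab: "{a..b} \<inter> E k \<in> sets borel" using E by auto
      obtain l1 where l1: "emeasure lborel ({a..b} \<inter> E k) = ennreal l1" "l1 \<ge> 0"
      proof -
        have "emeasure lborel ({a..b} \<inter> E k) \<le> emeasure lborel {a..b}" by (rule emeasure_mono) auto
        then have "emeasure lborel ({a..b} \<inter> E k) < \<infinity>" using ab by (simp add: le_less_trans)
        then show ?thesis using that by (cases "emeasure lborel ({a..b} \<inter> E k)") auto
      qed
      obtain l2 where l2: "emeasure lborel ({a..b} - E k) = ennreal l2" "l2 \<ge> 0" "l2 \<le> e / 4 * (b - a)"
      proof -
        have "emeasure lborel ({a..b} - E k) < \<infinity>" using out by (simp add: le_less_trans)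
        then obtain l where "emeasure lborel ({a..b} - E k) = ennreal l" "l \<ge> 0"
          by (cases "emeasure lborel ({a..b} - E k)") auto
        then show ?thesis using that out ab e by (auto simp: ennreal_le_iff)
      qed
      have l12: "l1 + l2 = b - a"
        using split[of lborel] l1 l2 ab by (simp add: ennreal_plus[symmetric] del: ennreal_plus)
      have lower: "ennreal (q * l1) \<le> emeasure N ({a..b} \<inter> E k)"
      proof -
        have "ennreal (q * l1) = ennreal q * emeasure lborel ({a..b} \<inter> E k)"
          using q01 l1 by (simp add: ennreal_mult)
        also have "\<dots> = (\<integral>\<^sup>+y\<in>{a..b} \<inter> E k. ennreal q \<partial>lborel)"
          using Eab by (simp add: nn_integral_cmult_indicator)
        also have "\<dots> \<le> (\<integral>\<^sup>+y\<in>{a..b} \<inter> E k. g y \<partial>lborel)"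
          by (intro nn_integral_mono) (auto simp: E_def indicator_def q_def)
        finally show ?thesis using N_eq Eab by simp
      qed
      have upper: "emeasure N ({a..b} \<inter> E k) \<le> ennreal ((q + e') * l1)"
      proof -
        have "(\<integral>\<^sup>+y\<in>{a..b} \<inter> E k. g y \<partial>lborel) \<le> (\<integral>\<^sup>+y\<in>{a..b} \<inter> E k. ennreal (q + e') \<partial>lborel)"
          by (intro nn_integral_mono) (auto simp: E_def indicator_def q_def algebra_simps)
        also have "\<dots> = ennreal (q + e') * emeasure lborel ({a..b} \<inter> E k)"
          using Eab by (simp add: nn_integral_cmult_indicator)
        also have "\<dots> = ennreal ((q + e') * l1)"
          using q01 l1 e' by (simp add: ennreal_mult)
        finally show ?thesis using N_eq Eab by simp
      qed
      have N2: "emeasure N ({a..b} - E k) \<le> ennreal l2"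
        using le[of "{a..b} - E k"] l2 E by auto
      have Fab: "0 \<le> F b - F a" using mono[of a b] ab by simp
      have "ennreal (F b - F a) = emeasure N ({a..b} \<inter> E k) + emeasure N ({a..b} - E k)"
        using split[of N] sN NI[of a b] ab by simp
      also have "\<dots> \<le> ennreal ((q + e') * l1) + ennreal l2"
        by (rule add_mono[OF upper N2])
      also have "\<dots> = ennreal ((q + e') * l1 + l2)"
        using q01 e' l1 l2 by (intro ennreal_plus[symmetric]) auto
      finally have "ennreal (F b - F a) \<le> ennreal ((q + e') * l1 + l2)" .
      then have up: "F b - F a \<le> (q + e') * l1 + l2"
        using q01 e' l1 l2 by (subst (asm) ennreal_le_iff) auto
      have "ennreal (q * l1) \<le> ennreal (F b - F a)"
        using lower split[of N] sN NI[of a b] ab by (metis add_increasing2 less_imp_le zero_le)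
      then have lo: "q * l1 \<le> F b - F a" using Fab by (subst (asm) ennreal_le_iff) auto
      have ql2: "q * l2 \<le> l2" "0 \<le> q * l2" using q01 l2 by (auto intro: mult_left_le_one_le)
      have el1: "e' * l1 \<le> e' * (b - a)" using l12 l2 e' by (intro mult_left_mono) auto
      have qe: "q * (b - a) = q * l1 + q * l2" by (simp add: l12[symmetric] algebra_simps)
      have eb: "e' * (b - a) = e / 8 * (b - a)" by (simp add: e'_def)
      have pos: "0 < e * (b - a)" using e ab by simp
      have "F b - F a - q * (b - a) \<le> e / 8 * (b - a) + e / 4 * (b - a)"
        using up el1 qe ql2 l2 eb by (simp add: algebra_simps)
      moreover have "F b - F a - q * (b - a) \<ge> - (e / 4 * (b - a))"
        using lo qe ql2 l2 by linarith
      ultimately show ?thesis using pos by (simp add: abs_le_iff)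
    qed
    show "\<exists>q. \<exists>d>0. \<forall>h. \<bar>h\<bar> < d \<longrightarrow> \<bar>F (x + h) - F x - q * h\<bar> \<le> e * \<bar>h\<bar>"
    proof (intro exI conjI allI impI)
      fix h :: real assume h: "\<bar>h\<bar> < d / 2"
      consider "h = 0" | "h > 0" | "h < 0" by linarith
      then show "\<bar>F (x + h) - F x - q * h\<bar> \<le> e * \<bar>h\<bar>"
      proof cases
        case 2
        then show ?thesis using main[of x "x + h"] h by (auto simp: dist_real_def subset_iff)
      next
        case 3
        have "\<bar>F x - F (x + h) - q * (x - (x + h))\<bar> \<le> e * (x - (x + h))"
          by (rule main) (use 3 h in \<open>auto simp: dist_real_def\<close>)
        then show ?thesis using 3 by (simp add: abs_le_iff) 
      qed auto
    qed (use d in auto)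
  qed
qed

text \<open>An affine change turns \<open>f\<close> into the nondecreasing function x/2 + f x/(2K)
  whose increments are at most those of x. Half of the tolerance is kept back to move the slope to a
  rational number, so that only countably many slopes occur later.\<close>

lemma lipschitz_approx_slope:
  fixes f :: "real \<Rightarrow> real"
  assumes f: "L-lipschitz_on UNIV f" and e: "0 < e"
  shows "AE x in lborel. \<exists>q\<in>\<rat>. \<exists>d>0. \<forall>h. \<bar>h\<bar> < d \<longrightarrow> \<bar>f (x + h) - f x - q * h\<bar> \<le> e * \<bar>h\<bar>"
proof -
  define K where "K = L + 1"
  have K: "K > 0" using lipschitz_on_nonneg[OF f] by (simp add: K_def)
  have fK: "\<bar>f y - f x\<bar> \<le> K * \<bar>y - x\<bar>" for x y
  proof -
    have "\<bar>f y - f x\<bar> \<le> L * \<bar>y - x\<bar>" using lipschitz_onD[OF f, of y x] by (simp add: dist_real_def)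
    also have "\<dots> \<le> K * \<bar>y - x\<bar>" by (rule mult_right_mono) (auto simp: K_def)
    finally show ?thesis .
  qed
  define F where "F x = x / 2 + f x / (2 * K)" for x
  have "AE x in lborel. \<exists>q. \<exists>d>0. \<forall>h. \<bar>h\<bar> < d \<longrightarrow> \<bar>F (x + h) - F x - q * h\<bar> \<le> e / (4 * K) * \<bar>h\<bar>"
  proof (rule mono_lipschitz_approx_slope)
    fix x y :: real assume xy: "x \<le> y"
    have b: "\<bar>(f y - f x) / (2 * K)\<bar> \<le> (y - x) / 2"
    proof -
      have "\<bar>(f y - f x) / (2 * K)\<bar> = \<bar>f y - f x\<bar> / (2 * K)" using K by (simp add: abs_mult)
      also have "\<dots> \<le> K * (y - x) / (2 * K)" using fK[where x=x and y=y] xy K by (intro divide_right_mono) auto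
      also have "\<dots> = (y - x) / 2" using K by simp
      finally show ?thesis .
    qed
    have "F y - F x = (y - x) / 2 + (f y - f x) / (2 * K)" by (simp add: F_def diff_divide_distrib)
    moreover have "(y - x) / 2 + (y - x) / 2 = y - x" by simp
    ultimately show "F x \<le> F y" "F y - F x \<le> y - x" using b unfolding abs_le_iff by linarith+
  qed (use e K in auto)
  then show ?thesis
  proof eventually_elim
    fix x
    assume "\<exists>q. \<exists>d>0. \<forall>h. \<bar>h\<bar> < d \<longrightarrow> \<bar>F (x + h) - F x - q * h\<bar> \<le> e / (4 * K) * \<bar>h\<bar>"
    then obtain q d where d: "d > 0" and q: "\<And>h. \<bar>h\<bar> < d \<Longrightarrow> \<bar>F (x + h) - F x - q * h\<bar> \<le> e / (4 * K) * \<bar>h\<bar>"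
      by blast
    define s where "s = 2 * K * (q - 1 / 2)"
    obtain r where r: "r \<in> \<rat>" "s < r" "r < s + e / 2" using Rats_dense_in_real[of s "s + e/2"] e by auto
    show "\<exists>q\<in>\<rat>. \<exists>d>0. \<forall>h. \<bar>h\<bar> < d \<longrightarrow> \<bar>f (x + h) - f x - q * h\<bar> \<le> e * \<bar>h\<bar>"
    proof (intro bexI[of _ r] exI[of _ d] conjI allI impI)
      fix h :: real assume h: "\<bar>h\<bar> < d"
      have "f (x + h) - f x - s * h = 2 * K * (F (x + h) - F x - q * h)"
        using K by (simp add: F_def s_def field_simps)
      then have "\<bar>f (x + h) - f x - s * h\<bar> \<le> 2 * K * (e / (4 * K) * \<bar>h\<bar>)"
        using mult_left_mono[OF q[OF h], of "2 * K"] K by (simp only: abs_mult) simp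
      then have 1: "\<bar>f (x + h) - f x - s * h\<bar> \<le> e / 2 * \<bar>h\<bar>" using K by simp
      have "\<bar>(r - s) * h\<bar> \<le> e / 2 * \<bar>h\<bar>" unfolding abs_mult by (rule mult_right_mono) (use r in auto)
      moreover have "f (x + h) - f x - r * h = (f (x + h) - f x - s * h) - (r - s) * h" by (simp add: algebra_simps)
      ultimately show "\<bar>f (x + h) - f x - r * h\<bar> \<le> e * \<bar>h\<bar>" using 1 by linarith
    qed (use d r in auto)
  qed
qed

text \<open>Tonelli applied to \<open>indicator N (x + t b) * indicator {0..1} t\<close>.\<close>

lemma null_sets_lborel_lines:
  fixes N :: "'a::euclidean_space set" and b :: 'a
  assumes N: "N \<in> sets borel" and lines: "\<And>x. AE t in lborel. x + t *\<^sub>R b \<notin> N"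
  shows "N \<in> null_sets lborel"
proof -
  define h :: "'a \<Rightarrow> real \<Rightarrow> ennreal" where "h x t = indicator N (x + t *\<^sub>R b) * indicator {0..1} t" for x t
  have "(\<lambda>z::'a \<times> real. indicator N (fst z + snd z *\<^sub>R b) * indicator {0..1} (snd z) :: ennreal) \<in> borel_measurable (borel \<Otimes>\<^sub>M borel)"
    using N by measurable
  then have meas: "case_prod h \<in> borel_measurable (lborel \<Otimes>\<^sub>M lborel)"
    by (simp add: h_def case_prod_unfold cong: measurable_cong_sets)
  have "(\<integral>\<^sup>+t. h x t \<partial>lborel) = 0" for x
  proof -
    have "(\<integral>\<^sup>+t. h x t \<partial>lborel) = (\<integral>\<^sup>+t. 0 \<partial>(lborel :: real measure))"
      using lines[of x] by (intro nn_integral_cong_AE) (auto simp: h_def elim: eventually_mono)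
    then show ?thesis by simp
  qed
  then have "0 = (\<integral>\<^sup>+x. (\<integral>\<^sup>+t. h x t \<partial>lborel) \<partial>lborel)" by simp
  also have "\<dots> = (\<integral>\<^sup>+t. (\<integral>\<^sup>+x. h x t \<partial>lborel) \<partial>lborel)"
    by (rule pair_sigma_finite.Fubini'[OF pair_sigma_finite.intro[OF sigma_finite_lborel sigma_finite_lborel], symmetric]) (rule meas)
  also have "\<dots> = (\<integral>\<^sup>+t. emeasure lborel N * indicator {0..1} t \<partial>(lborel :: real measure))"
  proof (rule nn_integral_cong)
    fix t :: real
    have "(\<integral>\<^sup>+x. indicator N (x + t *\<^sub>R b) \<partial>lborel) = (\<integral>\<^sup>+y. indicator N y \<partial>distr lborel borel ((+) (t *\<^sub>R b)))"
      using N by (subst nn_integral_distr) (auto simp: add.commute)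
    also have "\<dots> = emeasure lborel N" using N by (simp add: lborel_distr_plus)
    finally show "(\<integral>\<^sup>+x. h x t \<partial>lborel) = emeasure lborel N * indicator {0..1} t"
      using N by (simp add: h_def nn_integral_multc)
  qed
  also have "\<dots> = emeasure lborel N" by (simp add: nn_integral_cmult_indicator)
  finally show ?thesis using N by auto
qed

text \<open>For a fixed rational slope and a fixed scale the good points form a closed set. The
  exceptional set is therefore Borel, and it suffices that it is null on every line parallel to
  \<open>b\<close>.\<close>

lemma lipschitz_approx_partial_slope:
  fixes f :: "'a::euclidean_space \<Rightarrow> real"
  assumes f: "L-lipschitz_on UNIV f" and e: "0 < e" and b: "b \<in> Basis"
  shows "AE x in lborel. \<exists>q. \<exists>d>0. \<forall>h. \<bar>h\<bar> < d \<longrightarrow> \<bar>f (x + h *\<^sub>R b) - f x - q * h\<bar> \<le> e * \<bar>h\<bar>"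
proof -
  have contf: "continuous_on UNIV f" using f by (rule lipschitz_on_continuous_on)
  define T where "T q n = {x. \<forall>h. \<bar>h\<bar> < 1 / real (Suc n) \<longrightarrow> \<bar>f (x + h *\<^sub>R b) - f x - q * h\<bar> \<le> e * \<bar>h\<bar>}" for q n
  have closedT: "closed (T q n)" for q n
  proof -
    have "T q n = (\<Inter>h\<in>{h. \<bar>h\<bar> < 1 / real (Suc n)}. {x. \<bar>f (x + h *\<^sub>R b) - f x - q * h\<bar> \<le> e * \<bar>h\<bar>})"
      by (auto simp: T_def)
    also have "closed \<dots>"
      by (intro closed_INT ballI closed_Collect_le continuous_intros continuous_on_compose2[OF contf]) auto
    finally show ?thesis .
  qed
  define N where "N = - (\<Union>q\<in>\<rat>. \<Union>n. T q n)"
  have "N \<in> null_sets lborel"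
  proof (rule null_sets_lborel_lines)
    show "N \<in> sets borel" unfolding N_def
      by (intro borel_comp sets.countable_UN'' countable_rat borel_closed closedT) auto
    fix x
    have "L-lipschitz_on UNIV (\<lambda>t. f (x + t *\<^sub>R b))"
    proof (rule lipschitz_onI)
      fix s t :: real
      have "dist (f (x + s *\<^sub>R b)) (f (x + t *\<^sub>R b)) \<le> L * dist (x + s *\<^sub>R b) (x + t *\<^sub>R b)"
        using f by (rule lipschitz_onD) auto
      also have "dist (x + s *\<^sub>R b) (x + t *\<^sub>R b) = dist s t"
        using b by (simp add: dist_norm scaleR_diff_left[symmetric] del: scaleR_diff_left)
      finally show "dist (f (x + s *\<^sub>R b)) (f (x + t *\<^sub>R b)) \<le> L * dist s t" .
    qed (rule lipschitz_on_nonneg[OF f])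
    from lipschitz_approx_slope[OF this e] show "AE t in lborel. x + t *\<^sub>R b \<notin> N"
    proof eventually_elim
      fix t
      assume "\<exists>q\<in>\<rat>. \<exists>d>0. \<forall>h. \<bar>h\<bar> < d \<longrightarrow> \<bar>f (x + (t + h) *\<^sub>R b) - f (x + t *\<^sub>R b) - q * h\<bar> \<le> e * \<bar>h\<bar>"
      then obtain q d where q: "q \<in> \<rat>" and d: "d > 0"
        and qd: "\<And>h. \<bar>h\<bar> < d \<Longrightarrow> \<bar>f (x + (t + h) *\<^sub>R b) - f (x + t *\<^sub>R b) - q * h\<bar> \<le> e * \<bar>h\<bar>" by blast
      obtain n where n: "inverse (real (Suc n)) < d" using reals_Archimedean[OF d] by blast
      have "x + t *\<^sub>R b \<in> T q n"
        unfolding T_def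
      proof safe
        fix h :: real assume "\<bar>h\<bar> < 1 / real (Suc n)"
        then have "\<bar>h\<bar> < d" using n unfolding inverse_eq_divide by linarith
        from qd[OF this] show "\<bar>f (x + t *\<^sub>R b + h *\<^sub>R b) - f (x + t *\<^sub>R b) - q * h\<bar> \<le> e * \<bar>h\<bar>"
          by (simp add: scaleR_add_left add.assoc)
      qed
      with q show "x + t *\<^sub>R b \<notin> N" by (auto simp: N_def)
    qed
  qed
  then show ?thesis
  proof (rule AE_I')
    show "{x \<in> space lborel. \<not> (\<exists>q. \<exists>d>0. \<forall>h. \<bar>h\<bar> < d \<longrightarrow> \<bar>f (x + h *\<^sub>R b) - f x - q * h\<bar> \<le> e * \<bar>h\<bar>)} \<subseteq> N"
    proof
      fix x assume x: "x \<in> {x \<in> space lborel. \<not> (\<exists>q. \<exists>d>0. \<forall>h. \<bar>h\<bar> < d \<longrightarrow> \<bar>f (x + h *\<^sub>R b) - f x - q * h\<bar> \<le> e * \<bar>h\<bar>)}"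
      have False if "x \<in> T q n" for q n
      proof -
        have "(1 / real (Suc n)) > 0" by simp
        with that x show False unfolding T_def by blast
      qed
      then show "x \<in> N" by (auto simp: N_def)
    qed
  qed
qed

section \<open>From partial slopes to the full derivative\<close>

text \<open>If the ball of radius e |y| around x + y misses \<open>S\<close>, it removes the
  fraction (e/(1+e))^d from the ball of radius (1+e) |y| around x. At a density point with tolerance
  half that fraction this cannot happen for small y.\<close>

lemma AE_not_porous:
  fixes S :: "'a::euclidean_space set"
  assumes S: "S \<in> sets borel" and e: "0 < e"
  shows "AE x in lborel. x \<in> S \<longrightarrow> (\<exists>d>0. \<forall>y. norm y < d \<longrightarrow> (\<exists>s\<in>S. norm (s - (x + y)) \<le> e * norm y))"
proof -
  define \<theta> where "\<theta> = (e / (1 + e)) ^ DIM('a) / 2"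
  have \<theta>: "\<theta> > 0" using e by (simp add: \<theta>_def)
  from lebesgue_density[OF S \<theta>] show ?thesis
  proof eventually_elim
    fix x
    assume *: "x \<in> S \<longrightarrow> (\<exists>d>0. \<forall>r. 0 < r \<and> r < d \<longrightarrow>
      emeasure lborel (ball x r - S) \<le> ennreal \<theta> * emeasure lborel (ball x r))"
    show "x \<in> S \<longrightarrow> (\<exists>d>0. \<forall>y. norm y < d \<longrightarrow> (\<exists>s\<in>S. norm (s - (x + y)) \<le> e * norm y))"
    proof
      assume xS: "x \<in> S"
      with * obtain d where d: "d > 0" and dr: "\<And>r. 0 < r \<Longrightarrow> r < d \<Longrightarrow>
        emeasure lborel (ball x r - S) \<le> ennreal \<theta> * emeasure lborel (ball x r)" by blast
      show "\<exists>d>0. \<forall>y. norm y < d \<longrightarrow> (\<exists>s\<in>S. norm (s - (x + y)) \<le> e * norm y)"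
      proof (intro exI conjI allI impI)
        show "d / (1 + e) > 0" using d e by simp
        fix y :: 'a assume y: "norm y < d / (1 + e)"
        show "\<exists>s\<in>S. norm (s - (x + y)) \<le> e * norm y"
        proof (cases "y = 0")
          case True
          with xS show ?thesis by auto
        next
          case False
          define r where "r = (1 + e) * norm y"
          have r: "0 < r" using False e by (simp add: r_def)
          moreover have "r < d" using y e by (simp add: r_def field_simps)
          ultimately have r: "0 < r" "r < d" by auto
          show ?thesis
          proof (rule ccontr)
            assume no: "\<not> ?thesis"
            define c where "c = unit_ball_vol (real DIM('a))"
            have c: "c > 0" by (simp add: c_def)
            have "ball (x + y) (e * norm y) \<subseteq> ball x r - S"
            proof
              fix w assume w: "w \<in> ball (x + y) (e * norm y)"
              have "dist x w \<le> dist x (x + y) + dist (x + y) w" by (rule dist_triangle)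
              then have "w \<in> ball x r" using w by (auto simp: r_def algebra_simps dist_norm)
              moreover have "w \<notin> S" using no w by (force simp: dist_norm norm_minus_commute)
              ultimately show "w \<in> ball x r - S" by simp
            qed
            then have "emeasure lborel (ball (x + y) (e * norm y)) \<le> emeasure lborel (ball x r - S)"
              using S by (intro emeasure_mono) auto
            also have "\<dots> \<le> ennreal \<theta> * emeasure lborel (ball x r)" using dr r by simp
            finally have "ennreal (c * (e * norm y) ^ DIM('a)) \<le> ennreal (\<theta> * (c * r ^ DIM('a)))"
              using e r c \<theta> by (simp add: emeasure_ball c_def[symmetric] ennreal_mult)
            then have "c * (e * norm y) ^ DIM('a) \<le> \<theta> * (c * r ^ DIM('a))"
              using e r c \<theta> by (subst (asm) ennreal_le_iff) auto
            also have "\<theta> * (c * r ^ DIM('a)) = c * (e * norm y) ^ DIM('a) / 2"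
            proof -
              have "(e / (1 + e)) ^ DIM('a) * r ^ DIM('a) = (e * norm y) ^ DIM('a)"
                unfolding power_mult_distrib[symmetric] using e by (simp add: r_def)
              then show ?thesis by (simp add: \<theta>_def)
            qed
            finally have "c * (e * norm y) ^ DIM('a) \<le> 0" by simp
            moreover have "c * (e * norm y) ^ DIM('a) > 0" using c e False by simp
            ultimately show False by linarith
          qed
        qed
      qed
    qed
  qed
qed

text \<open>Partial slopes at x alone do not control a path through several coordinate directions,
  since its corners are other points. \<open>S a n\<close> is the set where the slopes
  \<open>a\<close> work uniformly at scale 1/(n+1). It is not porous at x, so every corner is close
  to a point of this set, and the Lipschitz bound pays for the displacement.\<close>

lemma lipschitz_approx_gradient:
  fixes f :: "'a::euclidean_space \<Rightarrow> real"
  assumes f: "L-lipschitz_on UNIV f" and e: "0 < e"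
  shows "AE x in lborel. \<exists>a. \<exists>d>0. \<forall>y. norm y < d \<longrightarrow> \<bar>f (x + y) - f x - a \<bullet> y\<bar> \<le> e * norm y"
proof -
  have contf: "continuous_on UNIV f" using f by (rule lipschitz_on_continuous_on)
  have L: "L \<ge> 0" using lipschitz_on_nonneg[OF f] .
  have lipf: "\<bar>f x - f y\<bar> \<le> L * norm (x - y)" for x y
    using lipschitz_onD[OF f, of x y] by (simp add: dist_norm)
  \<comment> \<open>There is one coordinate step per dimension. Each costs \<epsilon> for the slope
    and 2 L \<epsilon> for moving both ends of the step from the corner to the nearby good point and
    back.\<close>
  define \<epsilon> where "\<epsilon> = e / (real DIM('a) * (2 * L + 1))"
  have \<epsilon>: "\<epsilon> > 0" using e L by (simp add: \<epsilon>_def)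
  obtain D :: "'a set" where D: "countable D" "\<And>X. open X \<Longrightarrow> X \<noteq> {} \<Longrightarrow> \<exists>d\<in>D. d \<in> X"
    using countable_dense_setE by blast
  define S where "S a n = {x. \<forall>b\<in>Basis. \<forall>h. \<bar>h\<bar> < 1 / real (Suc n) \<longrightarrow>
    \<bar>f (x + h *\<^sub>R b) - f x - (a \<bullet> b) * h\<bar> \<le> \<epsilon> * \<bar>h\<bar>}" for a n
  have closedS: "closed (S a n)" for a n
  proof -
    have "S a n = (\<Inter>b\<in>Basis. \<Inter>h\<in>{h. \<bar>h\<bar> < 1 / real (Suc n)}. {x. \<bar>f (x + h *\<^sub>R b) - f x - (a \<bullet> b) * h\<bar> \<le> \<epsilon> * \<bar>h\<bar>})"
      by (auto simp: S_def)
    also have "closed \<dots>"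
      by (intro closed_INT ballI closed_Collect_le continuous_intros continuous_on_compose2[OF contf]) auto
    finally show ?thesis .
  qed
  have "AE x in lborel. \<forall>b\<in>Basis. \<exists>q. \<exists>d>0. \<forall>h. \<bar>h\<bar> < d \<longrightarrow> \<bar>f (x + h *\<^sub>R b) - f x - q * h\<bar> \<le> \<epsilon> / 2 * \<bar>h\<bar>"
    by (intro AE_finite_allI lipschitz_approx_partial_slope[OF f]) (use \<epsilon> in auto)
  moreover have "AE x in lborel. \<forall>a\<in>D. \<forall>n. x \<in> S a n \<longrightarrow>
      (\<exists>d>0. \<forall>y. norm y < d \<longrightarrow> (\<exists>s\<in>S a n. norm (s - (x + y)) \<le> \<epsilon> * norm y))"
    using D(1) by (intro AE_ball_countable' AE_not_porous borel_closed closedS \<epsilon>) (auto simp: AE_all_countable intro!: AE_not_porous borel_closed closedS \<epsilon>)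
  ultimately show ?thesis
  proof eventually_elim
    fix x
    assume 1: "\<forall>b\<in>Basis. \<exists>q. \<exists>d>0. \<forall>h. \<bar>h\<bar> < d \<longrightarrow> \<bar>f (x + h *\<^sub>R b) - f x - q * h\<bar> \<le> \<epsilon> / 2 * \<bar>h\<bar>"
      and 2: "\<forall>a\<in>D. \<forall>n. x \<in> S a n \<longrightarrow>
      (\<exists>d>0. \<forall>y. norm y < d \<longrightarrow> (\<exists>s\<in>S a n. norm (s - (x + y)) \<le> \<epsilon> * norm y))"
    from 1 obtain q where "\<forall>b\<in>Basis. \<exists>d>0. \<forall>h. \<bar>h\<bar> < d \<longrightarrow> \<bar>f (x + h *\<^sub>R b) - f x - q b * h\<bar> \<le> \<epsilon> / 2 * \<bar>h\<bar>"
      by metis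
    then obtain dd where dd: "\<And>b. b \<in> Basis \<Longrightarrow> dd b > 0"
      "\<And>b h. b \<in> Basis \<Longrightarrow> \<bar>h\<bar> < dd b \<Longrightarrow> \<bar>f (x + h *\<^sub>R b) - f x - q b * h\<bar> \<le> \<epsilon> / 2 * \<bar>h\<bar>"
      by metis
    define d0 where "d0 = Min (dd ` Basis)"
    have d0: "d0 > 0" unfolding d0_def using dd(1) by (subst Min_gr_iff) auto
    have d0': "d0 \<le> dd b" if "b \<in> Basis" for b unfolding d0_def using that by (intro Min_le) auto
    obtain n where n: "inverse (real (Suc n)) < d0" using reals_Archimedean[OF d0] by blast
    define a' where "a' = (\<Sum>b\<in>Basis. q b *\<^sub>R b)"
    have a': "a' \<bullet> b = q b" if "b \<in> Basis" for b
      using that by (simp add: a'_def inner_sum_left_Basis)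
    have "ball a' (\<epsilon> / 2) \<noteq> {}" using \<epsilon> by simp
    then obtain a where a: "a \<in> D" "a \<in> ball a' (\<epsilon> / 2)" using D(2) by blast
    have xS: "x \<in> S a n" unfolding S_def
    proof safe
      fix b h assume b: "(b::'a) \<in> Basis" and h: "\<bar>h\<bar> < 1 / real (Suc n)"
      have "\<bar>h\<bar> < dd b" using h n d0'[OF b] unfolding inverse_eq_divide by linarith
      then have 1: "\<bar>f (x + h *\<^sub>R b) - f x - q b * h\<bar> \<le> \<epsilon> / 2 * \<bar>h\<bar>" using dd(2) b by blast
      have "\<bar>q b - a \<bullet> b\<bar> = \<bar>(a' - a) \<bullet> b\<bar>" using a' b by (simp add: inner_diff_left)
      also have "\<dots> \<le> norm (a' - a)" using b by (rule Basis_le_norm)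
      also have "\<dots> \<le> \<epsilon> / 2" using a by (simp add: dist_norm)
      finally have "\<bar>(q b - a \<bullet> b) * h\<bar> \<le> \<epsilon> / 2 * \<bar>h\<bar>" unfolding abs_mult by (rule mult_right_mono) simp
      moreover have "f (x + h *\<^sub>R b) - f x - (a \<bullet> b) * h = (f (x + h *\<^sub>R b) - f x - q b * h) + (q b - a \<bullet> b) * h"
        by (simp add: algebra_simps)
      ultimately show "\<bar>f (x + h *\<^sub>R b) - f x - (a \<bullet> b) * h\<bar> \<le> \<epsilon> * \<bar>h\<bar>" using 1 by linarith
    qed
    with 2 a obtain d1 where d1: "d1 > 0"
      and near: "\<And>y. norm y < d1 \<Longrightarrow> \<exists>s\<in>S a n. norm (s - (x + y)) \<le> \<epsilon> * norm y" by blast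
    define d where "d = min d1 (1 / real (Suc n))"
    have d: "d > 0" using d1 by (simp add: d_def)
    \<comment> \<open>Induction over the coordinates already travelled; \<open>z\<close> is the
      corner reached and \<open>s\<close> the good point that replaces it.\<close>
    have chain: "\<bar>f (x + (\<Sum>b\<in>B. (y \<bullet> b) *\<^sub>R b)) - f x - (\<Sum>b\<in>B. (a \<bullet> b) * (y \<bullet> b))\<bar>
        \<le> real (card B) * ((2 * L + 1) * \<epsilon> * norm y)"
      if y: "norm y < d" and B: "finite B" "B \<subseteq> Basis" for B and y :: 'a
      using B
    proof (induction B rule: finite_induct)
      case (insert b B)
      define z where "z = (\<Sum>b\<in>B. (y \<bullet> b) *\<^sub>R b)"
      have b: "b \<in> Basis" and BB: "B \<subseteq> Basis" using insert.prems by auto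
      have zy: "norm z \<le> norm y"
      proof -
        have fB: "finite B" by (rule insert.hyps)
        have "norm z ^ 2 = (\<Sum>b\<in>Basis. (z \<bullet> b)^2)"
          unfolding power2_norm_eq_inner unfolding euclidean_inner[of z z] by (simp add: power2_eq_square)
        also have "\<dots> \<le> (\<Sum>b\<in>Basis. (y \<bullet> b)^2)"
        proof (rule sum_mono)
          fix i :: 'a assume i: "i \<in> Basis"
          have "z \<bullet> i = (\<Sum>b\<in>B. if b = i then y \<bullet> i else 0)"
            unfolding z_def inner_sum_left using i BB
            by (intro sum.cong) (auto simp: inner_Basis)
          also have "\<dots> = (if i \<in> B then y \<bullet> i else 0)" using fB by simp
          finally show "(z \<bullet> i)\<^sup>2 \<le> (y \<bullet> i)\<^sup>2" by auto
        qed
        also have "\<dots> = norm y ^ 2"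
          unfolding power2_norm_eq_inner unfolding euclidean_inner[of y y] by (simp add: power2_eq_square)
        finally show ?thesis by (simp add: power2_le_iff_abs_le)
      qed
      have "norm z < d1" using zy y by (simp add: d_def)
      then obtain s where s: "s \<in> S a n" "norm (s - (x + z)) \<le> \<epsilon> * norm z" using near by blast
      define t where "t = y \<bullet> b"
      have t: "\<bar>t\<bar> \<le> norm y" using Basis_le_norm[OF b, of y] by (simp add: t_def)
      have "\<bar>t\<bar> < 1 / real (Suc n)" using t y by (simp add: d_def)
      then have 1: "\<bar>f (s + t *\<^sub>R b) - f s - (a \<bullet> b) * t\<bar> \<le> \<epsilon> * \<bar>t\<bar>" using s b by (auto simp: S_def)
      have "\<epsilon> * norm z \<le> \<epsilon> * norm y" using zy \<epsilon> by (intro mult_left_mono) auto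
      then have sz: "norm (s - (x + z)) \<le> \<epsilon> * norm y" using s by linarith
      have 2: "\<bar>f s - f (x + z)\<bar> \<le> L * (\<epsilon> * norm y)"
        using lipf[of s "x + z"] mult_left_mono[OF sz L] by linarith
      have 3: "\<bar>f (s + t *\<^sub>R b) - f (x + z + t *\<^sub>R b)\<bar> \<le> L * (\<epsilon> * norm y)"
        using lipf[of "s + t *\<^sub>R b" "x + z + t *\<^sub>R b"] mult_left_mono[OF sz L] by (simp add: algebra_simps)
      have 4: "\<epsilon> * \<bar>t\<bar> \<le> \<epsilon> * norm y" using t \<epsilon> by (intro mult_left_mono) auto
      have step: "\<bar>f (x + z + t *\<^sub>R b) - f (x + z) - (a \<bullet> b) * t\<bar> \<le> (2 * L + 1) * \<epsilon> * norm y"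
        using 1 2 3 4 by (simp add: algebra_simps abs_le_iff)
      have IH: "\<bar>f (x + z) - f x - (\<Sum>b\<in>B. (a \<bullet> b) * (y \<bullet> b))\<bar> \<le> real (card B) * ((2 * L + 1) * \<epsilon> * norm y)"
        using insert.IH BB by (simp add: z_def)
      have e1: "x + (\<Sum>b\<in>insert b B. (y \<bullet> b) *\<^sub>R b) = x + z + t *\<^sub>R b"
        using insert.hyps by (simp add: z_def t_def add_ac)
      have e2: "(\<Sum>b\<in>insert b B. (a \<bullet> b) * (y \<bullet> b)) = (a \<bullet> b) * t + (\<Sum>b\<in>B. (a \<bullet> b) * (y \<bullet> b))"
        using insert.hyps by (simp add: t_def)
      have e3: "real (card (insert b B)) * ((2 * L + 1) * \<epsilon> * norm y) =
         (2 * L + 1) * \<epsilon> * norm y + real (card B) * ((2 * L + 1) * \<epsilon> * norm y)"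
        using insert.hyps by (simp add: distrib_right)
      show ?case unfolding e1 e2 e3 using step IH unfolding abs_le_iff by linarith
    qed auto
    show "\<exists>a. \<exists>d>0. \<forall>y. norm y < d \<longrightarrow> \<bar>f (x + y) - f x - a \<bullet> y\<bar> \<le> e * norm y"
    proof (intro exI conjI allI impI)
      fix y :: 'a assume "norm y < d"
      from chain[OF this finite_Basis order_refl]
      have "\<bar>f (x + y) - f x - a \<bullet> y\<bar> \<le> real DIM('a) * ((2 * L + 1) * \<epsilon> * norm y)"
        by (simp add: euclidean_representation euclidean_inner[of a y])
      also have "\<dots> = e * norm y" using L by (simp add: \<epsilon>_def)
      finally show "\<bar>f (x + y) - f x - a \<bullet> y\<bar> \<le> e * norm y" .
    qed (rule d)
  qed
qed

text \<open>Approximate gradients for the tolerances 1/(n+1) at the same point form a Cauchy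
  sequence, and the limit is the derivative.\<close>

theorem rademacher:
  fixes f :: "'a::euclidean_space \<Rightarrow> real"
  assumes f: "L-lipschitz_on UNIV f"
  shows "AE x in lebesgue. f differentiable (at x)"
proof -
  have "AE x in lborel. \<forall>n. \<exists>a. \<exists>d>0. \<forall>y. norm y < d \<longrightarrow> \<bar>f (x + y) - f x - a \<bullet> y\<bar> \<le> 1 / real (Suc n) * norm y"
    unfolding AE_all_countable by (intro allI lipschitz_approx_gradient[OF f]) simp
  then have "AE x in lborel. f differentiable (at x)"
  proof eventually_elim
    fix x
    assume "\<forall>n. \<exists>a. \<exists>d>0. \<forall>y. norm y < d \<longrightarrow> \<bar>f (x + y) - f x - a \<bullet> y\<bar> \<le> 1 / real (Suc n) * norm y"
    then obtain a where a: "\<forall>n. \<exists>d>0. \<forall>y. norm y < d \<longrightarrow> \<bar>f (x + y) - f x - a n \<bullet> y\<bar> \<le> 1 / real (Suc n) * norm y"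
      by metis
    have diff: "norm (a m - a n) \<le> 1 / real (Suc m) + 1 / real (Suc n)" for m n
    proof (cases "a m = a n")
      case False
      obtain d1 d2 where d: "d1 > 0" "d2 > 0"
        and d1: "\<And>y. norm y < d1 \<Longrightarrow> \<bar>f (x + y) - f x - a m \<bullet> y\<bar> \<le> 1 / real (Suc m) * norm y"
        and d2: "\<And>y. norm y < d2 \<Longrightarrow> \<bar>f (x + y) - f x - a n \<bullet> y\<bar> \<le> 1 / real (Suc n) * norm y"
        using a by metis
      \<comment> \<open>Two approximate gradients are compared by moving a short way along their own
        difference.\<close>
      define w where "w = a m - a n"
      have w: "norm w > 0" using False by (simp add: w_def)
      define s where "s = min d1 d2 / (2 * norm w)"
      have s: "s > 0" using d w by (simp add: s_def)
      have ns: "norm (s *\<^sub>R w) = min d1 d2 / 2" using w d by (simp add: s_def)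
      then have n1: "norm (s *\<^sub>R w) < d1" "norm (s *\<^sub>R w) < d2" using d by auto
      have "w \<bullet> (s *\<^sub>R w) \<le> (1 / real (Suc m) + 1 / real (Suc n)) * norm (s *\<^sub>R w)"
        using d1[OF n1(1)] d2[OF n1(2)] unfolding w_def inner_diff_left distrib_right abs_le_iff by linarith
      then have "s * (norm w * norm w) \<le> s * ((1 / real (Suc m) + 1 / real (Suc n)) * norm w)"
        using s by (simp add: dot_square_norm power2_eq_square mult_ac)
      then show ?thesis using s w unfolding w_def[symmetric] by (simp only: mult_le_cancel_left_pos mult_le_cancel_right_pos)
    qed auto
    have "Cauchy a"
    proof (rule metric_CauchyI)
      fix e :: real assume e: "0 < e"
      then obtain N where N: "inverse (real (Suc N)) < e / 2" using reals_Archimedean[of "e/2"] by auto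
      have small: "1 / real (Suc n) < e / 2" if "n \<ge> N" for n
      proof -
        have "1 / real (Suc n) \<le> 1 / real (Suc N)" using that by (intro divide_left_mono) auto
        then show ?thesis using N unfolding inverse_eq_divide by linarith
      qed
      show "\<exists>M. \<forall>m\<ge>M. \<forall>n\<ge>M. dist (a m) (a n) < e"
      proof (intro exI allI impI)
        fix m n assume "N \<le> m" "N \<le> n"
        with diff[of m n] small[of m] small[of n] show "dist (a m) (a n) < e" by (simp add: dist_norm)
      qed
    qed
    then obtain A where A: "a \<longlonglongrightarrow> A" using Cauchy_convergent convergent_def by blast
    have "(f has_derivative (\<lambda>y. A \<bullet> y)) (at x)"
      unfolding has_derivative_at_alt
    proof (intro conjI allI impI bounded_linear_inner_right)
      fix e :: real assume e: "0 < e"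
      have "eventually (\<lambda>n. dist (a n) A < e / 2) sequentially" using A e by (intro tendstoD) auto
      moreover have "eventually (\<lambda>n. 1 / real (Suc n) < e / 2) sequentially"
        using LIMSEQ_Suc[OF lim_1_over_n] e by (intro order_tendstoD(2)[where y=0]) auto
      ultimately have "eventually (\<lambda>n. dist (a n) A < e / 2 \<and> 1 / real (Suc n) < e / 2) sequentially"
        by eventually_elim simp
      then obtain n where n: "dist (a n) A < e / 2" "1 / real (Suc n) < e / 2"
        unfolding eventually_sequentially by blast
      obtain d where d: "d > 0" "\<And>y. norm y < d \<Longrightarrow> \<bar>f (x + y) - f x - a n \<bullet> y\<bar> \<le> 1 / real (Suc n) * norm y"
        using a by blast
      show "\<exists>d>0. \<forall>y. norm (y - x) < d \<longrightarrow> norm (f y - f x - A \<bullet> (y - x)) \<le> e * norm (y - x)"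
      proof (intro exI conjI allI impI)
        fix y assume y: "norm (y - x) < d"
        have 1: "\<bar>f y - f x - a n \<bullet> (y - x)\<bar> \<le> 1 / real (Suc n) * norm (y - x)"
          using d(2)[OF y] by simp
        have "\<bar>(a n - A) \<bullet> (y - x)\<bar> \<le> norm (a n - A) * norm (y - x)" by (rule Cauchy_Schwarz_ineq2)
        moreover have "norm (a n - A) * norm (y - x) \<le> e / 2 * norm (y - x)"
          using n by (intro mult_right_mono) (auto simp: dist_norm)
        moreover have "1 / real (Suc n) * norm (y - x) \<le> e / 2 * norm (y - x)"
          using n by (intro mult_right_mono) auto
        moreover have "f y - f x - A \<bullet> (y - x) = (f y - f x - a n \<bullet> (y - x)) + (a n - A) \<bullet> (y - x)"
          by (simp add: inner_diff_left)
        ultimately show "norm (f y - f x - A \<bullet> (y - x)) \<le> e * norm (y - x)"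
          using 1 unfolding real_norm_def abs_le_iff by linarith
      qed (rule d)
    qed
    then show "f differentiable (at x)" by (rule differentiableI)
  qed
  then show ?thesis by (rule AE_completion)
qed

section \<open>Twice differentiable functions on the torus\<close>

lemma Zd_periodicD: "Zd_periodic f \<Longrightarrow> (\<And>i. k $ i \<in> \<int>) \<Longrightarrow> f (x + k) = f x"
  by (simp add: Zd_periodic_def)

lemma Zd_periodic_comp: "Zd_periodic f \<Longrightarrow> Zd_periodic (\<lambda>x. F (f x))"
  by (simp add: Zd_periodic_def)

lemma Zd_periodic_comp2: "Zd_periodic f \<Longrightarrow> Zd_periodic g \<Longrightarrow> Zd_periodic (\<lambda>x. F (f x) (g x))"
  by (simp add: Zd_periodic_def)

abbreviation unit_cube :: "(real ^ 'd) set" where "unit_cube \<equiv> cbox 0 (\<chi> i. 1)"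

lemma lattice_translate_unit_cube:
  fixes x :: "real ^ 'd"
  obtains k :: "real ^ 'd" where "\<And>i. k $ i \<in> \<int>" "x + k \<in> unit_cube"
proof (rule that)
  let ?k = "(\<chi> i. - of_int \<lfloor>x $ i\<rfloor>) :: real ^ 'd"
  show "?k $ i \<in> \<int>" for i by simp
  show "x + ?k \<in> unit_cube"
  proof -
    have "0 \<le> x $ i - of_int \<lfloor>x $ i\<rfloor> \<and> x $ i - of_int \<lfloor>x $ i\<rfloor> \<le> 1" for i by linarith
    then show ?thesis by (simp add: mem_box_cart)
  qed
qed

lemma Zd_periodic_range:
  fixes f :: "real ^ 'd \<Rightarrow> 'b"
  assumes f: "Zd_periodic f"
  shows "range f = f ` unit_cube"
proof safe
  fix x :: "real ^ 'd"
  obtain k where "\<And>i. k $ i \<in> \<int>" "x + k \<in> unit_cube" by (rule lattice_translate_unit_cube[of x]) blast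
  then show "f x \<in> f ` unit_cube" using Zd_periodicD[OF f, of k x] by (metis imageI)
qed auto

lemma Zd_periodic_bounded:
  fixes f :: "real ^ 'd \<Rightarrow> 'b::metric_space"
  assumes "Zd_periodic f" "continuous_on UNIV f"
  shows "bounded (range f)"
  unfolding Zd_periodic_range[OF assms(1)]
  by (intro compact_imp_bounded compact_continuous_image continuous_on_subset[OF assms(2)] compact_cbox subset_UNIV)

lemma GDERIV_unique:
  assumes "GDERIV f x :> D" "GDERIV f x :> D'"
  shows "D = D'"
proof -
  have "(\<lambda>h. h \<bullet> D) = (\<lambda>h. h \<bullet> D')"
    using assms unfolding gderiv_def by (rule has_derivative_unique)
  then have "D \<bullet> D - D \<bullet> D' = 0" "D' \<bullet> D - D' \<bullet> D' = 0" by (metis diff_self)+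
  then have "(D - D') \<bullet> (D - D') = 0" by (simp add: inner_diff_left inner_diff_right inner_commute)
  then show ?thesis by simp
qed

lemma grad_eq: "GDERIV f x :> D \<Longrightarrow> grad f x = D"
  unfolding grad_def by (rule the_equality) (auto dest: GDERIV_unique)

lemma C2_torus_const: "C2_torus (\<lambda>x. c)"
  unfolding C2_torus_def
  by (intro conjI exI[of _ "\<lambda>x. 0"] allI GDERIV_const)
     (auto simp: Zd_periodic_def zero_blinfun.rep_eq intro: has_derivative_const)

lemma C2_torus_add:
  fixes f g :: "real ^ 'd \<Rightarrow> real"
  assumes "C2_torus f" "C2_torus g"
  shows "C2_torus (\<lambda>x. f x + g x)"
proof -
  obtain gf and hf :: "real ^ 'd \<Rightarrow> (real ^ 'd) \<Rightarrow>\<^sub>L (real ^ 'd)" where f: "Zd_periodic f" "\<And>x. GDERIV f x :> gf x"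
    "\<And>x. (gf has_derivative hf x) (at x)" "continuous_on UNIV hf"
    using assms(1) unfolding C2_torus_def by blast
  obtain gg and hg :: "real ^ 'd \<Rightarrow> (real ^ 'd) \<Rightarrow>\<^sub>L (real ^ 'd)" where g: "Zd_periodic g" "\<And>x. GDERIV g x :> gg x"
    "\<And>x. (gg has_derivative hg x) (at x)" "continuous_on UNIV hg"
    using assms(2) unfolding C2_torus_def by blast
  show ?thesis unfolding C2_torus_def
  proof (intro conjI exI allI)
    show "Zd_periodic (\<lambda>x. f x + g x)" by (rule Zd_periodic_comp2[OF f(1) g(1)])
    show "GDERIV (\<lambda>x. f x + g x) x :> gf x + gg x" for x using f g by (intro GDERIV_add)
    show "((\<lambda>x. gf x + gg x) has_derivative (hf x + hg x)) (at x)" for x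
      unfolding plus_blinfun.rep_eq using f g by (intro has_derivative_add)
    show "continuous_on UNIV (\<lambda>x. hf x + hg x)" using f g by (intro continuous_intros)
  qed
qed

lemma C2_torus_mult:
  fixes f g :: "real ^ 'd \<Rightarrow> real"
  assumes "C2_torus f" "C2_torus g"
  shows "C2_torus (\<lambda>x. f x * g x)"
proof -
  obtain gf and hf :: "real ^ 'd \<Rightarrow> (real ^ 'd) \<Rightarrow>\<^sub>L (real ^ 'd)" where f: "Zd_periodic f" "\<And>x. GDERIV f x :> gf x"
    "\<And>x. (gf has_derivative hf x) (at x)" "continuous_on UNIV hf"
    using assms(1) unfolding C2_torus_def by blast
  obtain gg and hg :: "real ^ 'd \<Rightarrow> (real ^ 'd) \<Rightarrow>\<^sub>L (real ^ 'd)" where g: "Zd_periodic g" "\<And>x. GDERIV g x :> gg x"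
    "\<And>x. (gg has_derivative hg x) (at x)" "continuous_on UNIV hg"
    using assms(2) unfolding C2_torus_def by blast
  have cont: "continuous_on UNIV f" "continuous_on UNIV g" "continuous_on UNIV gf" "continuous_on UNIV gg"
    using f(2,3) g(2,3) unfolding gderiv_def
    by (auto intro!: continuous_at_imp_continuous_on has_derivative_continuous)
  \<comment> \<open>The rank-one operator v -> (v . a) b. It occurs because the Hessian of a product
    contains the two cross terms of the gradients.\<close>
  define T where "T a b = blinfun_scaleR_left b o\<^sub>L blinfun_inner_left a" for a b :: "real ^ 'd"
  have contT: "continuous_on UNIV (\<lambda>x. T (p x) (q x))"
    if "continuous_on UNIV p" "continuous_on UNIV q" for p q :: "real ^ 'd \<Rightarrow> real ^ 'd"
    unfolding T_def using that
    by (intro bounded_bilinear.continuous_on[OF bounded_bilinear_blinfun_compose]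
        bounded_linear.continuous_on[OF bounded_linear_blinfun_scaleR_left]
        bounded_linear.continuous_on[OF bounded_linear_blinfun_inner_left])
  have T: "blinfun_apply (T a b) v = (v \<bullet> a) *\<^sub>R b" for a b v by (simp add: T_def)
  show ?thesis unfolding C2_torus_def
  proof (intro conjI exI allI)
    show "Zd_periodic (\<lambda>x. f x * g x)" by (rule Zd_periodic_comp2[OF f(1) g(1)])
    show "GDERIV (\<lambda>x. f x * g x) x :> f x *\<^sub>R gg x + g x *\<^sub>R gf x" for x using f g by (intro GDERIV_mult)
    show "((\<lambda>x. f x *\<^sub>R gg x + g x *\<^sub>R gf x) has_derivative
       (f x *\<^sub>R hg x + T (gf x) (gg x) + (g x *\<^sub>R hf x + T (gg x) (gf x)))) (at x)" for x
    proof -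
      have "((\<lambda>x. f x *\<^sub>R gg x + g x *\<^sub>R gf x) has_derivative
        (\<lambda>v. (f x *\<^sub>R hg x v + (v \<bullet> gf x) *\<^sub>R gg x) + (g x *\<^sub>R hf x v + (v \<bullet> gg x) *\<^sub>R gf x))) (at x)"
        using f(2,3) g(2,3) unfolding gderiv_def by (intro has_derivative_add has_derivative_scaleR)
      then show ?thesis by (simp add: plus_blinfun.rep_eq scaleR_blinfun.rep_eq T)
    qed
    show "continuous_on UNIV (\<lambda>x. f x *\<^sub>R hg x + T (gf x) (gg x) + (g x *\<^sub>R hf x + T (gg x) (gf x)))"
      using cont f(4) g(4) by (intro continuous_on_add continuous_on_scaleR contT)
  qed
qed

lemma C2_torus_cmult: "C2_torus f \<Longrightarrow> C2_torus (\<lambda>x. c * f x)"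
  by (intro C2_torus_mult C2_torus_const)

lemma C2_torus_uminus: "C2_torus f \<Longrightarrow> C2_torus (\<lambda>x. - f x)"
  using C2_torus_cmult[of f "-1"] by simp

lemma C2_torus_diff: "C2_torus f \<Longrightarrow> C2_torus g \<Longrightarrow> C2_torus (\<lambda>x. f x - g x)"
  using C2_torus_add[OF _ C2_torus_uminus, of f g] by simp

lemma C2_torus_sum: "(\<And>i. i \<in> A \<Longrightarrow> C2_torus (f i)) \<Longrightarrow> C2_torus (\<lambda>x. \<Sum>i\<in>A. f i x)"
  by (induction A rule: infinite_finite_induct) (auto intro: C2_torus_const C2_torus_add)

lemma C2_torus_power: "C2_torus f \<Longrightarrow> C2_torus (\<lambda>x. f x ^ n)"
  by (induction n) (auto intro: C2_torus_const C2_torus_mult)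

lemma C2_torus_sin: "C2_torus (\<lambda>x :: real ^ 'd. sin (2 * pi * x $ i + c))"
  unfolding C2_torus_def
proof (intro conjI exI allI)
  let ?e = "axis i 1 :: real ^ 'd"
  show "Zd_periodic (\<lambda>x :: real ^ 'd. sin (2 * pi * x $ i + c))"
    unfolding Zd_periodic_def
  proof safe
    fix x k :: "real ^ 'd" assume "\<forall>i. k $ i \<in> \<int>"
    then obtain n :: int where n: "k $ i = of_int n" by (metis Ints_cases)
    have "2 * pi * (x + k) $ i + c = (2 * pi * x $ i + c) + 2 * pi * of_int n" by (simp add: n algebra_simps)
    then show "sin (2 * pi * (x + k) $ i + c) = sin (2 * pi * x $ i + c)"
      by (simp only: sin_add sin_int_2pin cos_int_2pin) simp
  qed
  have comp: "x $ i = x \<bullet> ?e" for x :: "real ^ 'd" by (simp add: inner_axis)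
  show "GDERIV (\<lambda>x :: real ^ 'd. sin (2 * pi * x $ i + c)) x :> (2 * pi * cos (2 * pi * x $ i + c)) *\<^sub>R ?e" for x
    unfolding gderiv_def comp by (auto intro!: derivative_eq_intros)
  show "((\<lambda>x. (2 * pi * cos (2 * pi * x $ i + c)) *\<^sub>R ?e) has_derivative
     blinfun_apply ((- (4 * pi\<^sup>2) * sin (2 * pi * x $ i + c)) *\<^sub>R (blinfun_scaleR_left ?e o\<^sub>L blinfun_inner_left ?e))) (at x)" for x
    unfolding comp by (auto intro!: derivative_eq_intros simp: scaleR_blinfun.rep_eq uminus_blinfun.rep_eq power2_eq_square mult_ac)
  show "continuous_on UNIV (\<lambda>x. (- (4 * pi\<^sup>2) * sin (2 * pi * x $ i + c)) *\<^sub>R (blinfun_scaleR_left ?e o\<^sub>L blinfun_inner_left ?e))"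
    by (intro continuous_intros)
qed

lemma C2_torus_cos: "C2_torus (\<lambda>x :: real ^ 'd. cos (2 * pi * x $ i + c))"
proof -
  have "cos (2 * pi * x $ i + c) = sin (2 * pi * x $ i + (c + pi / 2))" for x :: "real ^ 'd"
    using sin_cos_eq[of "pi / 2 + (2 * pi * x $ i + c)"] by (simp add: sin_add add.assoc[symmetric])
  then show ?thesis using C2_torus_sin[of i "c + pi / 2"] by simp
qed

lemma C2_torus_grad:
  fixes f :: "real ^ 'd \<Rightarrow> real"
  assumes "C2_torus f"
  shows "GDERIV f x :> grad f x" and "continuous_on UNIV (grad f)" and "continuous_on UNIV f" and "Zd_periodic f"
proof -
  obtain g and h :: "real ^ 'd \<Rightarrow> (real ^ 'd) \<Rightarrow>\<^sub>L (real ^ 'd)" where f: "Zd_periodic f" "\<And>x. GDERIV f x :> g x"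
    "\<And>x. (g has_derivative h x) (at x)" "continuous_on UNIV h"
    using assms unfolding C2_torus_def by blast
  have g: "grad f = g" using f(2) by (auto intro!: ext grad_eq)
  show "GDERIV f x :> grad f x" "Zd_periodic f" using f by (simp_all add: g)
  show "continuous_on UNIV (grad f)" "continuous_on UNIV f"
    using f(2,3) unfolding gderiv_def g
    by (auto intro!: continuous_at_imp_continuous_on has_derivative_continuous)
qed

lemma C2_grad_periodic:
  fixes \<phi> :: "real ^ 'd \<Rightarrow> real"
  assumes \<phi>: "C2_torus \<phi>"
  shows "Zd_periodic (grad \<phi>)"
  unfolding Zd_periodic_def
proof safe
  fix x k :: "real ^ 'd" assume k: "\<forall>i. k $ i \<in> \<int>"
  have "((\<lambda>y. y + k) has_derivative (\<lambda>v. v)) (at x)" by (auto intro!: derivative_eq_intros)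
  then have "((\<lambda>y. \<phi> (y + k)) has_derivative (\<lambda>v. v \<bullet> grad \<phi> (x + k))) (at x)"
    using C2_torus_grad(1)[OF \<phi>, of "x + k"] unfolding gderiv_def by (rule has_derivative_compose)
  moreover have "(\<lambda>y. \<phi> (y + k)) = \<phi>" using C2_torus_grad(4)[OF \<phi>] k by (auto simp: Zd_periodic_def)
  ultimately have "GDERIV \<phi> x :> grad \<phi> (x + k)" by (simp add: gderiv_def)
  then show "grad \<phi> (x + k) = grad \<phi> x" using grad_eq by metis
qed

text \<open>The Hessian inherits periodicity, so it is bounded and the gradient is globally
  Lipschitz. The mean value theorem along the segment then gives a constant that is uniform in
  x.\<close>

lemma C2_torus_taylor:
  fixes f :: "real ^ 'd \<Rightarrow> real"
  assumes "C2_torus f"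
  obtains C where "C \<ge> 0" "\<And>x h. \<bar>f (x + h) - f x - h \<bullet> grad f x\<bar> \<le> C * (norm h)\<^sup>2"
proof -
  obtain g and h :: "real ^ 'd \<Rightarrow> (real ^ 'd) \<Rightarrow>\<^sub>L (real ^ 'd)" where f: "Zd_periodic f" "\<And>x. GDERIV f x :> g x"
    "\<And>x. (g has_derivative h x) (at x)" "continuous_on UNIV h"
    using assms unfolding C2_torus_def by blast
  have g: "grad f = g" using f(2) by (auto intro!: ext grad_eq)
  have shift: "((\<lambda>y. y + k) has_derivative (\<lambda>v. v)) (at x)" for k x :: "real ^ 'd"
    by (auto intro!: derivative_eq_intros)
  have gper: "Zd_periodic g" using C2_grad_periodic[OF assms] by (simp add: g)
  have "Zd_periodic h"
    unfolding Zd_periodic_def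
  proof safe
    fix x k :: "real ^ 'd" assume k: "\<forall>i. k $ i \<in> \<int>"
    have "((\<lambda>y. g (y + k)) has_derivative h (x + k)) (at x)"
      using f(3)[of "x + k"] by (rule has_derivative_compose[OF shift])
    moreover have "(\<lambda>y. g (y + k)) = g" using gper k by (auto simp: Zd_periodic_def)
    ultimately have "blinfun_apply (h (x + k)) = blinfun_apply (h x)" using f(3)[of x] has_derivative_unique by metis
    then show "h (x + k) = h x" by (simp add: blinfun_apply_inject)
  qed
  then have "bounded (range h)" using f(4) by (rule Zd_periodic_bounded)
  then obtain C where C: "C > 0" "\<And>x. norm (h x) \<le> C" unfolding bounded_pos by blast
  have lip: "norm (g x - g y) \<le> C * norm (x - y)" for x y
    using f(3) C(2) by (intro differentiable_bound[of UNIV g "\<lambda>x. blinfun_apply (h x)" C]) (auto simp: norm_blinfun.rep_eq)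
  show thesis
  proof (rule that)
    show "C \<ge> 0" using C by simp
    fix x v :: "real ^ 'd"
    have der: "((\<lambda>t. f (x + t *\<^sub>R v)) has_derivative (\<lambda>s. (s *\<^sub>R v) \<bullet> g (x + t *\<^sub>R v))) (at t within {0..1})" for t
      by (rule has_derivative_compose[of "\<lambda>t. x + t *\<^sub>R v" "\<lambda>s. s *\<^sub>R v" t "{0..1}" f, OF _ f(2)[of "x + t *\<^sub>R v", unfolded gderiv_def]])
         (auto intro!: derivative_eq_intros)
    obtain t where t: "t \<in> {0<..<1}" "f (x + 1 *\<^sub>R v) - f (x + 0 *\<^sub>R v) = ((1 - 0) *\<^sub>R v) \<bullet> g (x + t *\<^sub>R v)"
      using mvt_simple[of 0 1 "\<lambda>t. f (x + t *\<^sub>R v)" "\<lambda>t s. (s *\<^sub>R v) \<bullet> g (x + t *\<^sub>R v)", OF _ der] by auto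
    have "\<bar>f (x + v) - f x - v \<bullet> grad f x\<bar> = \<bar>v \<bullet> (g (x + t *\<^sub>R v) - g x)\<bar>"
      using t by (simp add: g inner_diff_right)
    also have "\<dots> \<le> norm v * norm (g (x + t *\<^sub>R v) - g x)" by (rule Cauchy_Schwarz_ineq2)
    also have "\<dots> \<le> norm v * (C * norm v)"
    proof (rule mult_left_mono)
      have "norm (g (x + t *\<^sub>R v) - g x) \<le> C * norm (t *\<^sub>R v)" using lip[of "x + t *\<^sub>R v" x] by simp
      also have "\<dots> \<le> C * norm v" using t C by (intro mult_left_mono) (auto simp: mult_left_le_one_le)
      finally show "norm (g (x + t *\<^sub>R v) - g x) \<le> C * norm v" .
    qed simp
    finally show "\<bar>f (x + v) - f x - v \<bullet> grad f x\<bar> \<le> C * (norm v)\<^sup>2"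
      by (simp add: power2_eq_square mult_ac)
  qed
qed

lemma cis_eq_imp_lattice:
  assumes "cis (2 * pi * a) = cis (2 * pi * b)"
  shows "a - b \<in> \<int>"
proof -
  have "sin (2 * pi * a) = sin (2 * pi * b) \<and> cos (2 * pi * a) = cos (2 * pi * b)"
    using assms by (simp add: complex_eq_iff)
  then obtain n :: int where n: "2 * pi * a = 2 * pi * b + 2 * pi * of_int n" unfolding sin_cos_eq_iff by auto
  then have "2 * pi * (a - b) = 2 * pi * of_int n" by (simp add: algebra_simps)
  then show ?thesis by simp
qed

text \<open>Stone--Weierstrass on the torus, embedded in \<open>complex ^ 'd\<close> by the map \<open>E\<close>.\<close>

lemma C2_torus_dense:
  fixes u :: "real ^ 'd \<Rightarrow> real"
  assumes per: "Zd_periodic u" and cont: "continuous_on UNIV u" and e: "0 < e"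
  obtains w where "C2_torus w" "\<And>x. \<bar>u x - w x\<bar> < e"
proof -
  define E :: "real ^ 'd \<Rightarrow> complex ^ 'd" where "E x = (\<chi> i. cis (2 * pi * x $ i))" for x
  have perE: "Zd_periodic E"
    unfolding Zd_periodic_def
  proof safe
    fix x k :: "real ^ 'd" assume k: "\<forall>i. k $ i \<in> \<int>"
    have "cis (2 * pi * (x + k) $ i) = cis (2 * pi * x $ i)" for i
    proof -
      obtain n :: int where n: "k $ i = of_int n" using k by (metis Ints_cases)
      have "2 * pi * (x + k) $ i = (2 * pi * x $ i) + 2 * pi * of_int n" by (simp add: n algebra_simps)
      then show ?thesis
        by (simp only: complex_eq_iff cis.simps sin_add cos_add sin_int_2pin cos_int_2pin) simp
    qed
    then show "E (x + k) = E x" by (simp add: E_def)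
  qed
  have contE: "continuous_on A E" for A
    unfolding E_def by (intro continuous_on_vec_lambda continuous_intros)
  define S where "S = range E"
  have S: "S = E ` unit_cube" unfolding S_def by (rule Zd_periodic_range[OF perE])
  have "compact S" unfolding S by (intro compact_continuous_image contE compact_cbox)
  have uE: "u x = u y" if "E x = E y" for x y
  proof -
    have "(x - y) $ i \<in> \<int>" for i
      using that cis_eq_imp_lattice[of "x $ i" "y $ i"] by (simp add: E_def vec_eq_iff)
    then show ?thesis using Zd_periodicD[OF per, of "x - y" y] by simp
  qed
  define v where "v z = u (SOME x. E x = z)" for z
  have v: "v (E x) = u x" for x
    unfolding v_def by (rule uE) (rule someI[of "\<lambda>y. E y = E x"], simp)
  \<comment> \<open>On the compact unit cube the map \<open>E\<close> is closed: the preimage of a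
    closed set under \<open>v\<close> is the image of a compact piece of the cube.\<close>
  have contv: "continuous_on S v"
    unfolding continuous_on_closed_invariant
  proof (intro allI impI)
    fix B :: "real set" assume B: "closed B"
    have "compact (E ` (unit_cube \<inter> u -` B))"
      using cont B by (intro compact_continuous_image contE compact_Int_closed compact_cbox continuous_closed_vimage)
        (auto simp: continuous_on_eq_continuous_at)
    then have "closed (E ` (unit_cube \<inter> u -` B))" by (rule compact_imp_closed)
    moreover have "E ` (unit_cube \<inter> u -` B) \<inter> S = v -` B \<inter> S"
    proof safe
      fix x assume "u x \<in> B"
      then show "E x \<in> v -` B" by (simp add: v)
    next
      fix z assume z: "v z \<in> B" "z \<in> S"
      then obtain x where "x \<in> unit_cube" "z = E x" unfolding S by blast
      with z show "z \<in> E ` (unit_cube \<inter> u -` B)" by (auto simp: v)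
    qed
    ultimately show "\<exists>A. closed A \<and> A \<inter> S = v -` B \<inter> S" by blast
  qed
  obtain p where p: "real_polynomial_function p" "\<And>z. z \<in> S \<Longrightarrow> \<bar>v z - p z\<bar> < e"
    by (rule Stone_Weierstrass_real_polynomial_function[OF \<open>compact S\<close> contv e]) blast
  \<comment> \<open>A real linear functional of \<open>E x\<close> is a combination of cosines and
    sines of the coordinates; products and sums remain trigonometric polynomials.\<close>
  have "C2_torus (\<lambda>x. p (E x))" using p(1)
  proof (induction p rule: real_polynomial_function.induct)
    case (linear p)
    have "E x = (\<Sum>i\<in>UNIV. cos (2 * pi * x $ i) *\<^sub>R axis i 1 + sin (2 * pi * x $ i) *\<^sub>R axis i \<i>)" for x
    proof -
      have "cis t = cos t *\<^sub>R 1 + sin t *\<^sub>R \<i>" for t by (simp add: complex_eq_iff)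
      then show ?thesis
        by (simp add: vec_eq_iff E_def axis_def if_distrib sum.distrib cong: if_cong)
    qed
    then have "p (E x) = (\<Sum>i\<in>UNIV. p (axis i 1) * cos (2 * pi * x $ i + 0) + p (axis i \<i>) * sin (2 * pi * x $ i + 0))" for x
      using linear by (simp add: linear_simps bounded_linear.linear linear_sum linear_add linear_scale mult.commute)
    then show ?case
      by (simp only:) (intro C2_torus_sum C2_torus_add C2_torus_cmult C2_torus_sin C2_torus_cos)
  qed (auto intro: C2_torus_const C2_torus_add C2_torus_mult)
  moreover have "\<bar>u x - p (E x)\<bar> < e" for x using p(2)[of "E x"] by (simp add: v S_def)
  ultimately show thesis by (rule that)
qed

section \<open>Upper semicontinuous functions\<close>

definition usc :: "('a::topological_space \<Rightarrow> real) \<Rightarrow> bool" where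
  "usc u \<longleftrightarrow> (\<forall>c. open {x. u x < c})"

lemma usc_iff_eventually: "usc u \<longleftrightarrow> (\<forall>x c. u x < c \<longrightarrow> (\<forall>\<^sub>F y in nhds x. u y < c))"
proof
  assume *: "\<forall>x c. u x < c \<longrightarrow> (\<forall>\<^sub>F y in nhds x. u y < c)"
  show "usc u" unfolding usc_def
  proof
    fix c
    show "open {x. u x < c}"
    proof (subst open_subopen, intro ballI)
      fix x assume "x \<in> {x. u x < c}"
      with * have "\<forall>\<^sub>F y in nhds x. u y < c" by simp
      then obtain T where "open T" "x \<in> T" "\<forall>y\<in>T. u y < c" unfolding eventually_nhds by blast
      then show "\<exists>T. open T \<and> x \<in> T \<and> T \<subseteq> {x. u x < c}" by blast
    qed
  qed
qed (auto simp: usc_def eventually_nhds)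

lemma continuous_usc:
  assumes "continuous_on UNIV f"
  shows "usc f"
  unfolding usc_def using assms by (auto intro: open_Collect_less continuous_on_const)

lemma usc_add:
  assumes "usc f" "usc g"
  shows "usc (\<lambda>x. f x + g x)"
  unfolding usc_iff_eventually
proof safe
  fix x c assume c: "f x + g x < c"
  define e where "e = (c - f x - g x) / 2"
  have "e > 0" using c by (simp add: e_def)
  then have "\<forall>\<^sub>F y in nhds x. f y < f x + e" "\<forall>\<^sub>F y in nhds x. g y < g x + e"
    using assms unfolding usc_iff_eventually by auto
  then show "\<forall>\<^sub>F y in nhds x. f y + g y < c"
  proof eventually_elim
    case (elim y)
    moreover have "f x + e + (g x + e) = c" by (simp add: e_def)
    ultimately show ?case by linarith
  qed
qed

lemma usc_compose: "usc f \<Longrightarrow> continuous_on UNIV g \<Longrightarrow> usc (\<lambda>x. f (g x))"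
  unfolding usc_def continuous_on_open_vimage[OF open_UNIV] by (auto simp: vimage_def)

lemma usc_cmult:
  assumes "usc f" "c > 0"
  shows "usc (\<lambda>x. c * f x)"
  unfolding usc_def
proof
  fix b
  have "{x. c * f x < b} = {x. f x < b / c}" using assms(2) by (auto simp: pos_less_divide_eq mult.commute)
  then show "open {x. c * f x < b}" using assms(1) by (simp add: usc_def)
qed

lemma usc_diff_continuous: "usc f \<Longrightarrow> continuous_on UNIV g \<Longrightarrow> usc (\<lambda>x. f x - g x)"
  using usc_add[of f "\<lambda>x. - g x"] continuous_usc[of "\<lambda>x. - g x"] continuous_on_minus by auto

lemma usc_max: "usc f \<Longrightarrow> usc g \<Longrightarrow> usc (\<lambda>x. max (f x) (g x))"
  unfolding usc_def by (auto simp: Collect_conj_eq)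

lemma usc_attains_sup:
  assumes u: "usc u" and K: "compact K" "K \<noteq> {}"
  obtains x where "x \<in> K" "\<And>y. y \<in> K \<Longrightarrow> u y \<le> u x"
proof -
  have "\<exists>x\<in>K. \<forall>y\<in>K. u y \<le> u x"
  proof (rule ccontr)
    assume "\<not> ?thesis"
    then have "\<And>x. x \<in> K \<Longrightarrow> \<exists>y\<in>K. u x < u y" by (auto simp: not_le)
    then have cov: "K \<subseteq> (\<Union>y\<in>K. {x. u x < u y})" by auto
    obtain D where D: "D \<subseteq> K" "finite D" "K \<subseteq> (\<Union>y\<in>D. {x. u x < u y})"
      by (rule compactE_image[OF K(1), of K "\<lambda>y. {x. u x < u y}"]) (use cov u in \<open>auto simp: usc_def\<close>)
    have "D \<noteq> {}" using D K by auto
    then obtain y where y: "y \<in> D" "\<And>z. z \<in> D \<Longrightarrow> u z \<le> u y"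
      using D(2) obtains_MAX[of D u] by (metis Max_ge finite_imageI imageI)
    then obtain z where "z \<in> D" "u y < u z" using D by blast
    with y show False by force
  qed
  with that show thesis by blast
qed

lemma usc_sequence:
  assumes u: "usc u" and x: "x \<longlonglongrightarrow> (l :: 'a::first_countable_topology)" and c: "u l < c"
  shows "\<forall>\<^sub>F n in sequentially. u (x n) < c"
  using u c x unfolding usc_iff_eventually filterlim_def le_filter_def by (auto simp: eventually_filtermap)

lemma usc_periodic_attains_sup:
  fixes u :: "real ^ 'd \<Rightarrow> real"
  assumes "usc u" "Zd_periodic u"
  obtains x where "\<And>y. u y \<le> u x"
proof -
  have "unit_cube \<noteq> ({} :: (real ^ 'd) set)" by (simp add: interval_ne_empty_cart)
  then obtain x where "x \<in> unit_cube" "\<And>y. y \<in> unit_cube \<Longrightarrow> u y \<le> u x"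
    using usc_attains_sup[OF assms(1) compact_cbox] by metis
  then have "u y \<le> u x" for y
    using Zd_periodic_range[OF assms(2)] by (metis (no_types, lifting) imageE rangeI)
  with that show thesis by blast
qed

text \<open>The approximants are the sup-convolutions \<open>\<lambda>y. SUP z. u z - n * dist y z\<close>.\<close>

lemma usc_approx_continuous:
  fixes u :: "real ^ 'd \<Rightarrow> real"
  assumes u: "usc u" and per: "Zd_periodic u" and B: "\<And>x. u x \<le> B"
  obtains U :: "nat \<Rightarrow> real ^ 'd \<Rightarrow> real"
  where "\<And>n. continuous_on UNIV (U n)" "\<And>n. Zd_periodic (U n)" "\<And>n x. u x \<le> U n x"
    "\<And>x. (\<lambda>n. U n x) \<longlonglongrightarrow> u x"
proof (rule that)
  define U where "U n y = (SUP z. u z - real n * dist y z)" for n y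
  have bdd: "bdd_above (range (\<lambda>z. u z - real n * dist y z))" for n y
  proof (rule bdd_aboveI2)
    fix z show "u z - real n * dist y z \<le> B" using B[of z] by (smt (verit) mult_nonneg_nonneg of_nat_0_le_iff zero_le_dist)
  qed
  show ge: "u x \<le> U n x" for n x
    unfolding U_def by (rule cSUP_upper2[OF bdd, of x]) auto
  have lip: "U n y \<le> U n y' + real n * dist y y'" for n y y'
    unfolding U_def
  proof (rule cSUP_least)
    fix z
    have "u z - real n * dist y' z \<le> (SUP z. u z - real n * dist y' z)"
      by (rule cSUP_upper[OF _ bdd]) simp
    moreover have "real n * dist y' z \<le> real n * dist y y' + real n * dist y z"
      unfolding distrib_left[symmetric] by (intro mult_left_mono) (metis dist_commute dist_triangle, simp)
    ultimately show "u z - real n * dist y z \<le> (SUP z. u z - real n * dist y' z) + real n * dist y y'" by linarith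
  qed simp
  show "continuous_on UNIV (U n)" for n
  proof (rule lipschitz_on_continuous_on)
    show "(real n)-lipschitz_on UNIV (U n)"
    proof (rule lipschitz_onI)
      fix x y show "dist (U n x) (U n y) \<le> real n * dist x y"
        using lip[of n x y] lip[of n y x] by (simp add: dist_real_def dist_commute abs_le_iff)
    qed simp
  qed
  show "Zd_periodic (U n)" for n
  proof -
    have le: "U n (x + k) \<le> U n x" if k: "\<And>i. k $ i \<in> \<int>" for x k
      unfolding U_def
    proof (rule cSUP_least)
      fix z
      have "u (z + (- k)) = u z" by (rule Zd_periodicD[OF per]) (use k in auto)
      moreover have "dist (x + k) z = dist x (z - k)" by (simp add: dist_norm algebra_simps)
      ultimately have "u z - real n * dist (x + k) z = u (z - k) - real n * dist x (z - k)" by simp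
      also have "\<dots> \<le> (SUP z. u z - real n * dist x z)" by (rule cSUP_upper[OF _ bdd]) simp
      finally show "u z - real n * dist (x + k) z \<le> (SUP z. u z - real n * dist x z)" .
    qed simp
    show ?thesis unfolding Zd_periodic_def
    proof (intro allI impI)
      fix x k :: "real ^ 'd" assume k: "\<forall>i. k $ i \<in> \<int>"
      have "U n (x + k + (- k)) \<le> U n (x + k)" by (rule le) (use k in auto)
      with le[of k x] k show "U n (x + k) = U n x" by simp
    qed
  qed
  show "(\<lambda>n. U n x) \<longlonglongrightarrow> u x" for x
  proof (rule LIMSEQ_I)
    fix e :: real assume e: "0 < e"
    then have "\<forall>\<^sub>F y in nhds x. u y < u x + e / 2" using u unfolding usc_iff_eventually by simp
    then obtain r where r: "r > 0" "\<And>y. dist y x < r \<Longrightarrow> u y < u x + e / 2"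
      unfolding eventually_nhds_metric by blast
    obtain N :: nat where N: "(B - u x) / r \<le> real N" using real_arch_simple by blast
    have "norm (U n x - u x) < e" if n: "n \<ge> N" for n
    proof -
      have "U n x \<le> u x + e / 2"
        unfolding U_def
      proof (rule cSUP_least)
        fix z
        show "u z - real n * dist x z \<le> u x + e / 2"
        proof (cases "dist z x < r")
          case True
          have "real n * dist x z \<ge> 0" by simp
          with r(2)[OF True] show ?thesis by linarith
        next
          case False
          have "B - u x \<le> real N * r" using N r by (simp add: pos_divide_le_eq)
          also have "\<dots> \<le> real n * dist x z" using False n r by (intro mult_mono) (auto simp: dist_commute)
          finally show ?thesis using B[of z] e by linarith
        qed
      qed simp
      with ge[of x n] e show ?thesis by simp
    qed
    then show "\<exists>no. \<forall>n\<ge>no. norm (U n x - u x) < e" by blast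
  qed
qed

text \<open>No lower bound on the limit is given. Fatou applied to g - f n, together with the
  uniform lower bound \<open>A\<close> on the integrals, makes integrability of the limit a
  conclusion.\<close>

lemma integrable_reverse_fatou:
  fixes f :: "nat \<Rightarrow> 'a \<Rightarrow> real"
  assumes f: "\<And>n. integrable M (f n)" and g: "integrable M g" and fg: "\<And>n x. x \<in> space M \<Longrightarrow> f n x \<le> g x"
    and lim: "\<And>x. x \<in> space M \<Longrightarrow> (\<lambda>n. f n x) \<longlonglongrightarrow> F x" and A: "\<And>n. A \<le> (\<integral>x. f n x \<partial>M)"
  shows "integrable M F" "A \<le> (\<integral>x. F x \<partial>M)"
proof -
  have Fm: "F \<in> borel_measurable M"
    by (rule borel_measurable_LIMSEQ_real[of M f]) (use lim f in auto)
  have Fg: "F x \<le> g x" if "x \<in> space M" for x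
    by (rule LIMSEQ_le_const2[OF lim[OF that]]) (use fg that in auto)
  have "(\<integral>\<^sup>+x. ennreal (g x - F x) \<partial>M) = (\<integral>\<^sup>+x. liminf (\<lambda>n. ennreal (g x - f n x)) \<partial>M)"
  proof (rule nn_integral_cong)
    fix x assume x: "x \<in> space M"
    have "(\<lambda>n. ennreal (g x - f n x)) \<longlonglongrightarrow> ennreal (g x - F x)"
      by (intro tendsto_ennrealI tendsto_diff tendsto_const lim x)
    then show "ennreal (g x - F x) = liminf (\<lambda>n. ennreal (g x - f n x))"
      by (simp add: lim_imp_Liminf)
  qed
  also have "\<dots> \<le> liminf (\<lambda>n. \<integral>\<^sup>+x. ennreal (g x - f n x) \<partial>M)"
    by (rule nn_integral_liminf) (use f g in measurable)
  also have "\<dots> \<le> liminf (\<lambda>n. ennreal ((\<integral>x. g x \<partial>M) - A))"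
  proof (intro Liminf_mono always_eventually allI)
    fix n
    have "(\<integral>\<^sup>+x. ennreal (g x - f n x) \<partial>M) = ennreal (\<integral>x. g x - f n x \<partial>M)"
      by (rule nn_integral_eq_integral) (use f g fg in auto)
    also have "\<dots> \<le> ennreal ((\<integral>x. g x \<partial>M) - A)"
      using A[of n] f g by (intro ennreal_leI) (simp add: Bochner_Integration.integral_diff)
    finally show "(\<integral>\<^sup>+x. ennreal (g x - f n x) \<partial>M) \<le> ennreal ((\<integral>x. g x \<partial>M) - A)" .
  qed
  also have "\<dots> = ennreal ((\<integral>x. g x \<partial>M) - A)" by (simp add: Liminf_const)
  finally have le: "(\<integral>\<^sup>+x. ennreal (g x - F x) \<partial>M) \<le> ennreal ((\<integral>x. g x \<partial>M) - A)" .
  have int: "integrable M (\<lambda>x. g x - F x)"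
  proof (rule integrableI_nonneg)
    show "(\<lambda>x. g x - F x) \<in> borel_measurable M" using Fm g by measurable
    show "AE x in M. 0 \<le> g x - F x" using Fg by (intro AE_I2) simp
    show "(\<integral>\<^sup>+x. ennreal (g x - F x) \<partial>M) < \<infinity>" using le by (simp add: le_less_trans)
  qed
  have "integrable M (\<lambda>x. g x - (g x - F x))" using g int by (rule Bochner_Integration.integrable_diff)
  then show F: "integrable M F" by simp
  have "0 \<le> (\<integral>x. g x - f 0 x \<partial>M)" using fg by (intro integral_nonneg_AE AE_I2) simp
  then have A0: "0 \<le> (\<integral>x. g x \<partial>M) - A" using A[of 0] f g by (simp add: Bochner_Integration.integral_diff)
  have "ennreal (\<integral>x. g x - F x \<partial>M) \<le> ennreal ((\<integral>x. g x \<partial>M) - A)"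
    using le nn_integral_eq_integral[OF int] Fg by (simp add: AE_I2)
  then have "(\<integral>x. g x - F x \<partial>M) \<le> (\<integral>x. g x \<partial>M) - A" using A0 by (simp add: ennreal_le_iff)
  then show "A \<le> (\<integral>x. F x \<partial>M)" using F g by (simp add: Bochner_Integration.integral_diff)
qed

section \<open>The nonlocal operator and semicontinuous subsolutions\<close>

text \<open>The integrand of the operator with a free vector in place of the gradient. It is thus
  defined for nonsmooth \<open>u\<close>, with the slope of a touching paraboloid as
  \<open>p\<close>.\<close>

definition incr :: "(real ^ 'd \<Rightarrow> real ^ 'd \<Rightarrow> real ^ 'd) \<Rightarrow> (real ^ 'd \<Rightarrow> real) \<Rightarrow> real ^ 'd \<Rightarrow> real ^ 'd \<Rightarrow> real ^ 'd \<Rightarrow> real" where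
  "incr j u x p z = u (x + j x z) - u x - indicator (ball 0 1) z * (j x z \<bullet> p)"

text \<open>Upper semicontinuity is what survives suprema and envelopes in Perron's method. A
  supersolution is handled as the subsolution \<open>- u\<close> of the reflected Hamiltonian, so
  this single notion serves both sides.\<close>

definition visc_usc_subsolution ::
  "(real ^ 'd) measure \<Rightarrow> (real ^ 'd \<Rightarrow> real ^ 'd \<Rightarrow> real ^ 'd) \<Rightarrow> real \<Rightarrow>
     (real ^ 'd \<Rightarrow> real ^ 'd \<Rightarrow> real) \<Rightarrow> real \<Rightarrow> (real ^ 'd \<Rightarrow> real) \<Rightarrow> bool" where
  "visc_usc_subsolution \<nu> j lam F a u \<longleftrightarrow> Zd_periodic u \<and> usc u \<and>
     (\<forall>\<phi> xh. C2_torus \<phi> \<and> (\<forall>x. u x - \<phi> x \<le> u xh - \<phi> xh) \<longrightarrow>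
        lam * u xh - nonlocal_op \<nu> j \<phi> xh + F xh (grad \<phi> xh) \<le> a)"

lemma visc_subsolution_iff_usc:
  "visc_subsolution \<nu> j lam F a u \<longleftrightarrow> continuous_on UNIV u \<and> visc_usc_subsolution \<nu> j lam F a u"
  unfolding visc_subsolution_def visc_usc_subsolution_def using continuous_usc by blast

lemma nonlocal_op_incr: "nonlocal_op \<nu> j \<phi> x = (\<integral>z. incr j \<phi> x (grad \<phi> x) z \<partial>\<nu>)"
  by (simp add: nonlocal_op_def incr_def)

lemma grad_uminus: "C2_torus \<phi> \<Longrightarrow> grad (\<lambda>x. - \<phi> x) x = - grad \<phi> x"
  by (rule grad_eq) (rule GDERIV_minus[OF C2_torus_grad(1)])

lemma incr_uminus: "incr j (\<lambda>x. - u x) x (- p) z = - incr j u x p z"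
  by (simp add: incr_def)

lemma nonlocal_op_uminus: "C2_torus \<phi> \<Longrightarrow> nonlocal_op \<nu> j (\<lambda>x. - \<phi> x) x = - nonlocal_op \<nu> j \<phi> x"
  by (simp add: nonlocal_op_incr grad_uminus incr_uminus)

lemma visc_supersolution_iff_usc:
  "visc_supersolution \<nu> j lam F a u \<longleftrightarrow> continuous_on UNIV u \<and>
     visc_usc_subsolution \<nu> j lam (\<lambda>x p. - F x (- p)) (- a) (\<lambda>x. - u x)"
proof -
  have per: "Zd_periodic (\<lambda>x. - u x) = Zd_periodic u" by (simp add: Zd_periodic_def)
  have usc: "usc (\<lambda>x. - u x)" if "continuous_on UNIV u"
    using that by (intro continuous_usc continuous_intros)
  have eq: "(\<forall>\<phi> xh. C2_torus \<phi> \<and> (\<forall>x. u x - \<phi> x \<ge> u xh - \<phi> xh) \<longrightarrow>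
        lam * u xh - nonlocal_op \<nu> j \<phi> xh + F xh (grad \<phi> xh) \<ge> a) \<longleftrightarrow>
      (\<forall>\<phi> xh. C2_torus \<phi> \<and> (\<forall>x. - u x - \<phi> x \<le> - u xh - \<phi> xh) \<longrightarrow>
        lam * - u xh - nonlocal_op \<nu> j \<phi> xh + - F xh (- grad \<phi> xh) \<le> - a)" (is "?L \<longleftrightarrow> ?R")
  proof
    assume L: ?L
    show ?R
    proof safe
      fix \<phi> xh assume \<phi>: "C2_torus \<phi>" "\<forall>x. - u x - \<phi> x \<le> - u xh - \<phi> xh"
      have "\<forall>x. u x - - \<phi> x \<ge> u xh - - \<phi> xh" using \<phi>(2) by (simp add: algebra_simps)
      then have "lam * u xh - nonlocal_op \<nu> j (\<lambda>x. - \<phi> x) xh + F xh (grad (\<lambda>x. - \<phi> x) xh) \<ge> a"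
        using L C2_torus_uminus[OF \<phi>(1)] by blast
      then show "lam * - u xh - nonlocal_op \<nu> j \<phi> xh + - F xh (- grad \<phi> xh) \<le> - a"
        by (simp add: nonlocal_op_uminus grad_uminus \<phi>)
    qed
  next
    assume R: ?R
    show ?L
    proof safe
      fix \<phi> xh assume \<phi>: "C2_torus \<phi>" "\<forall>x. u x - \<phi> x \<ge> u xh - \<phi> xh"
      have "\<forall>x. - u x - - \<phi> x \<le> - u xh - - \<phi> xh" using \<phi>(2) by (simp add: algebra_simps)
      then have "lam * - u xh - nonlocal_op \<nu> j (\<lambda>x. - \<phi> x) xh + - F xh (- grad (\<lambda>x. - \<phi> x) xh) \<le> - a"
        using R C2_torus_uminus[OF \<phi>(1)] by blast
      then show "lam * u xh - nonlocal_op \<nu> j \<phi> xh + F xh (grad \<phi> xh) \<ge> a"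
        by (simp add: nonlocal_op_uminus grad_uminus \<phi>)
    qed
  qed
  have "(P \<and> Q \<and> X) = (Q \<and> P \<and> R \<and> Y)" if "Q \<Longrightarrow> R" "X = Y" for P Q R X Y :: bool using that by (cases Q) auto
  from this[OF usc eq] show ?thesis
    unfolding visc_supersolution_def visc_usc_subsolution_def per .
qed

section \<open>Periodic substitutes for linear and quadratic functions\<close>

lemma sin_sub_le: "\<bar>sin (2 * pi * t) / (2 * pi) - t\<bar> \<le> 8 * t\<^sup>2" for t :: real
proof -
  have "\<bar>sin (2 * pi * t) - (\<Sum>m<2. sin_coeff m * (2 * pi * t) ^ m)\<bar> \<le> inverse (fact 2) * \<bar>2 * pi * t\<bar> ^ 2"
    by (rule Maclaurin_sin_bound)
  then have "\<bar>sin (2 * pi * t) - 2 * pi * t\<bar> \<le> (2 * pi * t)\<^sup>2 / 2"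
    by (simp add: sin_coeff_def numeral_2_eq_2)
  then have "\<bar>sin (2 * pi * t) - 2 * pi * t\<bar> / (2 * pi) \<le> (2 * pi * t)\<^sup>2 / 2 / (2 * pi)"
    by (intro divide_right_mono) auto
  moreover have e: "sin (2 * pi * t) / (2 * pi) - t = (sin (2 * pi * t) - 2 * pi * t) / (2 * pi)"
    by (simp add: diff_divide_distrib)
  moreover have "\<bar>X / (2 * pi)\<bar> = \<bar>X\<bar> / (2 * pi)" for X :: real by simp
  moreover have "(2 * pi * t)\<^sup>2 / 2 / (2 * pi) = pi * t\<^sup>2" by (simp add: power2_eq_square)
  moreover have "pi * t\<^sup>2 \<le> 8 * t\<^sup>2" using pi_less_4 by (intro mult_right_mono) auto
  ultimately show ?thesis by (simp only:)
qed

lemma one_minus_cos_le: "(1 - cos (2 * pi * t)) / 2 \<le> 16 * t\<^sup>2" for t :: real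
proof -
  have "1 - cos (2 * pi * t) = 2 * (sin (pi * t))\<^sup>2"
    using cos_double_sin[of "pi * t"] by (simp add: mult_ac)
  moreover have "(sin (pi * t))\<^sup>2 \<le> (pi * t)\<^sup>2"
    using abs_sin_x_le_abs_x[of "pi * t"] by (simp add: abs_le_square_iff)
  moreover have "pi\<^sup>2 * t\<^sup>2 \<le> 4\<^sup>2 * t\<^sup>2" using pi_less_4 by (intro mult_right_mono power_mono) auto
  ultimately show ?thesis by (simp add: power_mult_distrib)
qed

text \<open>With s = 2 pi |t| in [0, pi] the claim follows from s^2/16 <= 1 - cos s and s^2 >= 36
  t^2. For s <= 3 the first is the quartic Taylor bound; beyond 3 the cosine is negative and s <
  4.\<close>

lemma one_minus_cos_ge: "t\<^sup>2 \<le> (1 - cos (2 * pi * t)) / 2" if "\<bar>t\<bar> \<le> 1 / 2" for t :: real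
proof -
  define s where "s = \<bar>2 * pi * t\<bar>"
  have c: "cos (2 * pi * t) = cos s" by (simp add: s_def)
  have s2: "s\<^sup>2 = 4 * pi\<^sup>2 * t\<^sup>2" by (simp add: s_def power_mult_distrib)
  have "s = 2 * pi * \<bar>t\<bar>" by (simp add: s_def abs_mult)
  also have "\<dots> \<le> 2 * pi * (1 / 2)" using that by (intro mult_left_mono) auto
  finally have s: "0 \<le> s" "s \<le> pi" by (auto simp: s_def)
  have low: "cos r \<le> 1 - r\<^sup>2 / 2 + r ^ 4 / 24" for r :: real
  proof -
    obtain t where t: "cos r = (\<Sum>m<4. cos_coeff m * r ^ m) + (cos (t + 1 / 2 * real 4 * pi) / fact 4) * r ^ 4"
      using Maclaurin_cos_expansion[of r 4] by blast
    have "(cos (t + 1 / 2 * real 4 * pi) / fact 4) * r ^ 4 \<le> (1 / fact 4) * r ^ 4"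
      by (intro mult_right_mono divide_right_mono cos_le_one) auto
    moreover have "(\<Sum>m<4. cos_coeff m * r ^ m) = 1 - r\<^sup>2 / 2"
      by (simp add: cos_coeff_def lessThan_nat_numeral)
    moreover have "(1 / fact 4) * r ^ 4 = r ^ 4 / 24" by (simp add: fact_numeral)
    ultimately show ?thesis using t by linarith
  qed
  have low16: "s\<^sup>2 / 16 \<le> 1 - cos s"
  proof (cases "s \<le> 3")
    case True
    then have "s\<^sup>2 \<le> 3\<^sup>2" using s by (intro power_mono) auto
    then have "s\<^sup>2 * s\<^sup>2 \<le> 9 * s\<^sup>2" by (intro mult_right_mono) auto
    moreover have "s ^ 4 = s\<^sup>2 * s\<^sup>2" by (simp add: power2_eq_square numeral_eq_Suc)
    moreover have "0 \<le> s\<^sup>2" by simp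
    ultimately show ?thesis using low[of s] by linarith
  next
    case False
    have "cos s \<le> cos 3" using False s pi_gt3 by (subst cos_mono_le_eq) auto
    moreover have "cos (3::real) \<le> 0" using low[of 3] by simp
    moreover have "s\<^sup>2 \<le> 4\<^sup>2" using s pi_less_4 by (intro power_mono) auto
    ultimately show ?thesis by simp
  qed
  have "(36 :: real) \<le> 4 * pi\<^sup>2" using power_mono[of 3 pi 2] pi_gt3 by simp
  then have "36 * t\<^sup>2 \<le> 4 * pi\<^sup>2 * t\<^sup>2" by (intro mult_right_mono) auto
  then have "36 * t\<^sup>2 \<le> s\<^sup>2" unfolding s2 .
  moreover have "0 \<le> t\<^sup>2" by simp
  moreover have "a \<le> (1 - d) / 2" if "36 * a \<le> b" "0 \<le> a" "b / 16 \<le> 1 - d" for a b d :: real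
    using that by argo
  ultimately show ?thesis unfolding c using low16 by blast
qed

text \<open>The sum of sin^2(pi (y_i - x_i)): a smooth periodic substitute for |y - x|^2 that
  vanishes exactly on the lattice x + Z^d, and so localizes on the torus where the square itself is
  not an admissible test function.\<close>

definition lattice_dist2 :: "real ^ 'd \<Rightarrow> real ^ 'd \<Rightarrow> real" where
  "lattice_dist2 x y = (\<Sum>i\<in>UNIV. (1 - cos (2 * pi * (y $ i - x $ i))) / 2)"

lemma norm_power2_vec: "(norm (v :: real ^ 'd))\<^sup>2 = (\<Sum>i\<in>UNIV. (v $ i)\<^sup>2)"
  by (simp add: norm_vec_def L2_set_def sum_nonneg)

lemma C2_torus_lattice_dist2: "C2_torus (lattice_dist2 (x :: real ^ 'd))"
proof -
  have "C2_torus (\<lambda>y :: real ^ 'd. \<Sum>i\<in>UNIV. (1 / 2) * (1 - cos (2 * pi * y $ i + (- (2 * pi * x $ i)))))"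
    by (intro C2_torus_sum C2_torus_cmult C2_torus_diff C2_torus_const C2_torus_cos)
  moreover have "(\<lambda>y :: real ^ 'd. \<Sum>i\<in>UNIV. (1 / 2) * (1 - cos (2 * pi * y $ i + (- (2 * pi * x $ i))))) = lattice_dist2 x"
    by (auto simp: lattice_dist2_def fun_eq_iff algebra_simps intro!: sum.cong)
  ultimately show ?thesis by simp
qed

lemma lattice_dist2_le: "lattice_dist2 x y \<le> 16 * (norm (y - x))\<^sup>2"
  unfolding lattice_dist2_def norm_power2_vec sum_distrib_left
  using one_minus_cos_le by (intro sum_mono) simp

lemma lattice_dist2_nonneg: "0 \<le> lattice_dist2 x y"
  unfolding lattice_dist2_def by (intro sum_nonneg) simp

lemma lattice_dist2_le_dim: "lattice_dist2 x (y :: real ^ 'd) \<le> real CARD('d)"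
proof -
  have "(1 - cos t) / 2 \<le> 1" for t :: real using cos_ge_minus_one[of t] by simp
  then have "lattice_dist2 x y \<le> (\<Sum>i\<in>(UNIV :: 'd set). 1)"
    unfolding lattice_dist2_def by (intro sum_mono)
  then show ?thesis by simp
qed

lemma lattice_dist2_eq_0D:
  assumes "lattice_dist2 x y = 0"
  shows "(y - x) $ i \<in> \<int>"
proof -
  have "(1 - cos (2 * pi * (y $ i - x $ i))) / 2 = 0"
    using assms unfolding lattice_dist2_def by (subst (asm) sum_nonneg_eq_0_iff) auto
  then have "cos (2 * pi * (y $ i - x $ i)) = 1" by simp
  then obtain n :: int where "2 * pi * (y $ i - x $ i) = of_int n * 2 * pi"
    unfolding cos_one_2pi_int by auto
  then have "y $ i - x $ i = of_int n" by simp
  then show ?thesis by simp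
qed

lemma lattice_translate_half_cube:
  fixes w :: "real ^ 'd"
  obtains k :: "real ^ 'd" where "\<And>i. k $ i \<in> \<int>" "\<And>i. \<bar>(w + k) $ i\<bar> \<le> 1 / 2"
proof (rule that)
  let ?k = "(\<chi> i. - of_int (round (w $ i))) :: real ^ 'd"
  show "?k $ i \<in> \<int>" for i by simp
  show "\<bar>(w + ?k) $ i\<bar> \<le> 1 / 2" for i
    using of_int_round_abs_le[of "w $ i"] by (simp add: abs_minus_commute)
qed

lemma lattice_representative_near:
  fixes x y :: "real ^ 'd"
  obtains k :: "real ^ 'd" where "\<And>i. k $ i \<in> \<int>" "(norm (y + k - x))\<^sup>2 \<le> lattice_dist2 x y"
proof -
  obtain k :: "real ^ 'd" where k: "\<And>i. k $ i \<in> \<int>" and half: "\<And>i. \<bar>(y - x + k) $ i\<bar> \<le> 1 / 2"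
    by (rule lattice_translate_half_cube[of "y - x"]) blast
  have "(norm (y + k - x))\<^sup>2 \<le> lattice_dist2 x (y + k)"
    unfolding norm_power2_vec lattice_dist2_def
  proof (intro sum_mono)
    fix i
    have "\<bar>(y + k) $ i - x $ i\<bar> \<le> 1 / 2" using half[of i] by (simp add: algebra_simps)
    then show "((y + k - x) $ i)\<^sup>2 \<le> (1 - cos (2 * pi * ((y + k) $ i - x $ i))) / 2"
      using one_minus_cos_ge by simp
  qed
  also have "lattice_dist2 x (y + k) = lattice_dist2 x y"
    by (rule Zd_periodicD[OF C2_torus_grad(4)[OF C2_torus_lattice_dist2] k])
  finally show thesis using that k by blast
qed

text \<open>Sines replace the linear part, with an error of at most 8 |p| |y - x|^2 that is added to
  the quadratic coefficient. Among the lattice translates of y one has all coordinates of y - x in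
  [-1/2, 1/2]; there \<open>lattice_dist2\<close> dominates the square, and periodicity carries the
  inequality to the others.\<close>

lemma periodic_paraboloid:
  fixes x p :: "real ^ 'd"
  assumes u: "Zd_periodic u" and C: "C \<ge> 0" and le: "\<And>y. u y \<le> u x + (y - x) \<bullet> p + C * (norm (y - x))\<^sup>2"
  obtains P K where "C2_torus P" "\<And>y. u y \<le> P y"
    "\<And>y. \<bar>P y - u x - (y - x) \<bullet> p\<bar> \<le> K * (norm (y - x))\<^sup>2" "K \<ge> 0"
proof (rule that)
  define T where "T y = (\<Sum>i\<in>UNIV. p $ i * (sin (2 * pi * (y $ i - x $ i)) / (2 * pi)))" for y
  define C' where "C' = C + 8 * norm p"
  define P where "P y = u x + T y + C' * lattice_dist2 x y" for y
  have C': "C' \<ge> 0" using C by (simp add: C'_def)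
  have "C2_torus (\<lambda>y :: real ^ 'd. \<Sum>i\<in>UNIV. (p $ i / (2 * pi)) * sin (2 * pi * y $ i + (- (2 * pi * x $ i))))"
    by (intro C2_torus_sum C2_torus_cmult C2_torus_sin)
  also have "(\<lambda>y :: real ^ 'd. \<Sum>i\<in>UNIV. (p $ i / (2 * pi)) * sin (2 * pi * y $ i + (- (2 * pi * x $ i)))) = T"
    by (auto simp: T_def fun_eq_iff algebra_simps intro!: sum.cong)
  finally have "C2_torus T" .
  then show P: "C2_torus P" unfolding P_def
    by (intro C2_torus_add C2_torus_const C2_torus_cmult C2_torus_lattice_dist2)
  have T: "\<bar>T y - (y - x) \<bullet> p\<bar> \<le> 8 * norm p * (norm (y - x))\<^sup>2" for y
  proof -
    have eq: "T y - (y - x) \<bullet> p = (\<Sum>i\<in>UNIV. p $ i * (sin (2 * pi * (y $ i - x $ i)) / (2 * pi) - (y $ i - x $ i)))"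
    proof -
      have "(y - x) \<bullet> p = (\<Sum>i\<in>UNIV. p $ i * (y $ i - x $ i))" by (simp add: inner_vec_def mult.commute)
      then show ?thesis by (simp add: T_def sum_subtractf[symmetric] right_diff_distrib)
    qed
    have "\<bar>T y - (y - x) \<bullet> p\<bar> \<le> (\<Sum>i\<in>UNIV. \<bar>p $ i * (sin (2 * pi * (y $ i - x $ i)) / (2 * pi) - (y $ i - x $ i))\<bar>)"
      unfolding eq by (rule sum_abs)
    also have "\<dots> \<le> (\<Sum>i\<in>UNIV. norm p * (8 * (y $ i - x $ i)\<^sup>2))"
      unfolding abs_mult by (intro sum_mono mult_mono sin_sub_le component_le_norm_cart) auto
    also have "\<dots> = 8 * norm p * (norm (y - x))\<^sup>2"
      by (simp add: norm_power2_vec sum_distrib_left mult_ac)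
    finally show ?thesis .
  qed
  show "u y \<le> P y" for y
  proof -
    obtain k where k: "\<And>i. k $ i \<in> \<int>" and near: "(norm (y + k - x))\<^sup>2 \<le> lattice_dist2 x y"
      by (rule lattice_representative_near[of y x]) blast
    define y' where "y' = y + k"
    have uy: "u y' = u y" "P y' = P y" "lattice_dist2 x y' = lattice_dist2 x y"
      using Zd_periodicD[OF u k] Zd_periodicD[OF C2_torus_grad(4)[OF P] k]
        Zd_periodicD[OF C2_torus_grad(4)[OF C2_torus_lattice_dist2] k] by (simp_all add: y'_def)
    have "(norm (y' - x))\<^sup>2 \<le> lattice_dist2 x y'" using near uy(3) by (simp add: y'_def)
    then have "C' * (norm (y' - x))\<^sup>2 \<le> C' * lattice_dist2 x y'" using C' by (rule mult_left_mono)
    then have "u y' \<le> P y'" using le[of y'] T[of y'] by (simp add: P_def C'_def algebra_simps abs_le_iff)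
    then show ?thesis using uy by simp
  qed
  show "\<bar>P y - u x - (y - x) \<bullet> p\<bar> \<le> (8 * norm p + 16 * C') * (norm (y - x))\<^sup>2" for y
  proof -
    have "C' * lattice_dist2 x y \<le> C' * (16 * (norm (y - x))\<^sup>2)"
      using C' lattice_dist2_le by (intro mult_left_mono) auto
    moreover have "0 \<le> C' * lattice_dist2 x y" by (rule mult_nonneg_nonneg[OF C' lattice_dist2_nonneg])
    moreover have "P y - u x - (y - x) \<bullet> p = (T y - (y - x) \<bullet> p) + C' * lattice_dist2 x y" by (simp add: P_def)
    ultimately show ?thesis using T[of y] unfolding distrib_right abs_le_iff by linarith
  qed
  show "8 * norm p + 16 * C' \<ge> 0" using C' by simp
qed

lemma GDERIV_quadratic:
  assumes "\<And>y. \<bar>f y - f x - (y - x) \<bullet> p\<bar> \<le> K * (norm (y - x))\<^sup>2"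
  shows "GDERIV f x :> p"
  unfolding gderiv_def has_derivative_at_alt
proof (intro conjI allI impI bounded_linear_inner_left)
  fix e :: real assume e: "0 < e"
  show "\<exists>d>0. \<forall>y. norm (y - x) < d \<longrightarrow> norm (f y - f x - (y - x) \<bullet> p) \<le> e * norm (y - x)"
  proof (intro exI conjI allI impI)
    show "e / (\<bar>K\<bar> + 1) > 0" using e by simp
    fix y assume y: "norm (y - x) < e / (\<bar>K\<bar> + 1)"
    have "K * norm (y - x) \<le> (\<bar>K\<bar> + 1) * norm (y - x)" by (intro mult_right_mono) auto
    also have "\<dots> \<le> (\<bar>K\<bar> + 1) * (e / (\<bar>K\<bar> + 1))" using y by (intro mult_left_mono) auto
    also have "\<dots> = e" by simp
    finally have "K * norm (y - x) * norm (y - x) \<le> e * norm (y - x)" by (rule mult_right_mono) simp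
    then show "norm (f y - f x - (y - x) \<bullet> p) \<le> e * norm (y - x)"
      using assms[of y] by (simp add: power2_eq_square mult_ac)
  qed
qed

section \<open>The jump kernel and integrable majorants\<close>

locale levy_kernel =
  fixes \<nu> :: "(real ^ 'd) measure" and j :: "real ^ 'd \<Rightarrow> real ^ 'd \<Rightarrow> real ^ 'd"
    and C\<^sub>\<nu> C\<^sub>j :: real
  assumes nu_borel: "sets \<nu> = sets borel"
    and j_periodic: "Zd_periodic j"
    and j_borel: "(\<lambda>(x, z). j x z) \<in> borel_measurable borel"
    and N: "C\<^sub>\<nu> > 0" "(\<integral>\<^sup>+ z. ennreal (min 1 ((norm z)\<^sup>2)) \<partial>\<nu>) \<le> ennreal C\<^sub>\<nu>"
    and J1: "C\<^sub>j > 0" "\<And>x z. norm (j x z) \<le> C\<^sub>j * norm z"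
      "\<And>x y z. norm (j x z - j y z) \<le> C\<^sub>j * norm (x - y) * norm z"
begin

definition wt :: "real ^ 'd \<Rightarrow> real" where "wt z = min 1 ((norm z)\<^sup>2)"

lemma borel_measurable_nu: "f \<in> borel_measurable borel \<Longrightarrow> f \<in> borel_measurable \<nu>"
  using measurable_cong_sets[OF nu_borel refl] by blast

lemma wt_nonneg: "wt z \<ge> 0" by (simp add: wt_def)

lemma wt_in_ball: "norm z < 1 \<Longrightarrow> wt z = (norm z)\<^sup>2"
  by (simp add: wt_def min_absorb2 power_le_one)

lemma wt_outside_ball: "norm z \<ge> 1 \<Longrightarrow> wt z = 1"
  by (simp add: wt_def min_def one_le_power)

lemma wt_measurable: "wt \<in> borel_measurable \<nu>"
  unfolding wt_def by (rule borel_measurable_nu) measurable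

lemma integrable_wt: "integrable \<nu> wt"
proof (rule integrableI_nonneg[OF wt_measurable])
  show "AE z in \<nu>. 0 \<le> wt z" by (simp add: wt_nonneg)
  show "(\<integral>\<^sup>+ z. ennreal (wt z) \<partial>\<nu>) < \<infinity>"
    using N(2) unfolding wt_def by (simp add: le_less_trans)
qed

lemma integral_wt_le: "(\<integral>z. wt z \<partial>\<nu>) \<le> C\<^sub>\<nu>"
proof -
  have "ennreal (\<integral>z. wt z \<partial>\<nu>) \<le> ennreal C\<^sub>\<nu>"
    using N(2)[folded wt_def] nn_integral_eq_integral[OF integrable_wt] wt_nonneg by simp
  then show ?thesis using N(1) by (simp add: ennreal_le_iff)
qed

lemma j_measurable: "j x \<in> borel_measurable \<nu>"
proof (rule borel_measurable_nu)
  have "(\<lambda>z. (x, z)) \<in> borel_measurable borel"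
    by (intro borel_measurable_continuous_onI continuous_intros)
  from measurable_compose[OF this j_borel] show "j x \<in> borel_measurable borel" by simp
qed

lemma incr_measurable: "u \<in> borel_measurable borel \<Longrightarrow> incr j u x p \<in> borel_measurable \<nu>"
proof -
  assume u: "u \<in> borel_measurable borel"
  have [measurable]: "j x \<in> borel_measurable \<nu>" by (rule j_measurable)
  have "(\<lambda>z. x + j x z) \<in> borel_measurable \<nu>" by measurable
  then have [measurable]: "(\<lambda>z. u (x + j x z)) \<in> borel_measurable \<nu>" using u by (rule measurable_compose)
  have [measurable]: "(indicator (ball 0 1) :: real ^ 'd \<Rightarrow> real) \<in> borel_measurable \<nu>"
    by (intro borel_measurable_nu borel_measurable_indicator) auto
  show ?thesis unfolding incr_def by measurable
qed

lemma norm_j_power2: "(norm (j x z))\<^sup>2 \<le> C\<^sub>j\<^sup>2 * (norm z)\<^sup>2"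
  using power_mono[OF J1(2)[of x z], of 2] by (simp add: power_mult_distrib)

text \<open>The paraboloid handles jumps in the unit ball, where the compensator removes the linear
  term, and the bound \<open>M\<close> handles the rest. The estimate is one-sided because an upper
  semicontinuous \<open>u\<close> is only touched from above.\<close>

lemma incr_le_wt:
  assumes C: "C \<ge> 0" and M: "M \<ge> 0" and le: "\<And>y. u y \<le> u x + (y - x) \<bullet> p + C * (norm (y - x))\<^sup>2"
    and bd: "\<And>y. u y \<le> u x + M"
  shows "incr j u x p z \<le> (C * C\<^sub>j\<^sup>2 + M) * wt z"
proof (cases "norm z < 1")
  case True
  have "C * (norm (j x z))\<^sup>2 \<le> C * (C\<^sub>j\<^sup>2 * (norm z)\<^sup>2)" using C norm_j_power2 by (intro mult_left_mono) auto
  moreover have "0 \<le> M * (norm z)\<^sup>2" using M by simp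
  ultimately show ?thesis using le[of "x + j x z"] True by (simp add: incr_def wt_in_ball algebra_simps)
next
  case False
  have "0 \<le> C * C\<^sub>j\<^sup>2" using C by simp
  with False bd[of "x + j x z"] show ?thesis by (simp add: incr_def wt_outside_ball)
qed

lemma C2_incr_bound:
  assumes "C2_torus \<phi>"
  obtains K where "K \<ge> 0" "\<And>x z. \<bar>incr j \<phi> x (grad \<phi> x) z\<bar> \<le> K * wt z"
proof -
  obtain C where C: "C \<ge> 0" "\<And>x h. \<bar>\<phi> (x + h) - \<phi> x - h \<bullet> grad \<phi> x\<bar> \<le> C * (norm h)\<^sup>2"
    using C2_torus_taylor[OF assms] by blast
  have "bounded (range \<phi>)" using C2_torus_grad[OF assms] by (intro Zd_periodic_bounded)
  then obtain M where M: "M > 0" "\<And>x. \<bar>\<phi> x\<bar> \<le> M" unfolding bounded_pos by auto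
  have up: "incr j \<psi> x q z \<le> (C * C\<^sub>j\<^sup>2 + 2 * M) * wt z"
    if \<psi>: "\<And>h. \<psi> (x + h) - \<psi> x - h \<bullet> q \<le> C * (norm h)\<^sup>2" "\<And>y. \<bar>\<psi> y\<bar> \<le> M" for \<psi> x q z
  proof (rule incr_le_wt)
    show "\<psi> y \<le> \<psi> x + (y - x) \<bullet> q + C * (norm (y - x))\<^sup>2" for y using \<psi>(1)[of "y - x"] by simp
    show "\<psi> y \<le> \<psi> x + 2 * M" for y using \<psi>(2)[of y] \<psi>(2)[of x] by (simp add: abs_le_iff)
  qed (use C M in auto)
  show thesis
  proof (rule that)
    show "C * C\<^sub>j\<^sup>2 + 2 * M \<ge> 0" using C M by simp
    fix x z
    have 1: "incr j \<phi> x (grad \<phi> x) z \<le> (C * C\<^sub>j\<^sup>2 + 2 * M) * wt z"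
      by (rule up) (use C(2) M in \<open>auto simp: abs_le_iff\<close>)
    have 2: "incr j (\<lambda>y. - \<phi> y) x (- grad \<phi> x) z \<le> (C * C\<^sub>j\<^sup>2 + 2 * M) * wt z"
    proof (rule up)
      show "- \<phi> (x + h) - - \<phi> x - h \<bullet> - grad \<phi> x \<le> C * (norm h)\<^sup>2" for h using C(2)[of x h] by (simp add: abs_le_iff)
    qed (use M in auto)
    show "\<bar>incr j \<phi> x (grad \<phi> x) z\<bar> \<le> (C * C\<^sub>j\<^sup>2 + 2 * M) * wt z"
      using 1 2 unfolding incr_uminus by (simp add: abs_le_iff)
  qed
qed

lemma C2_borel: "C2_torus \<phi> \<Longrightarrow> \<phi> \<in> borel_measurable borel"
  by (intro borel_measurable_continuous_onI C2_torus_grad)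

lemma integrable_incr_C2:
  assumes "C2_torus \<phi>"
  shows "integrable \<nu> (incr j \<phi> x (grad \<phi> x))"
proof -
  obtain K where K: "K \<ge> 0" "\<And>x z. \<bar>incr j \<phi> x (grad \<phi> x) z\<bar> \<le> K * wt z" using C2_incr_bound[OF assms] by blast
  show ?thesis
    by (rule Bochner_Integration.integrable_bound[of \<nu> "\<lambda>z. K * wt z"])
       (use K wt_nonneg integrable_wt incr_measurable[OF C2_borel[OF assms]] in auto)
qed

lemma nonlocal_op_tendsto:
  assumes \<phi>: "C2_torus \<phi>" and x: "x \<longlonglongrightarrow> l"
  shows "(\<lambda>n. nonlocal_op \<nu> j \<phi> (x n)) \<longlonglongrightarrow> nonlocal_op \<nu> j \<phi> l"
proof -
  obtain K where K: "K \<ge> 0" "\<And>x z. \<bar>incr j \<phi> x (grad \<phi> x) z\<bar> \<le> K * wt z" using C2_incr_bound[OF \<phi>] by blast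
  have cont: "isCont \<phi> y" "isCont (grad \<phi>) y" for y
    using C2_torus_grad[OF \<phi>] by (auto simp: continuous_on_eq_continuous_at)
  show ?thesis unfolding nonlocal_op_incr
  proof (rule integral_dominated_convergence[where w="\<lambda>z. K * wt z"])
    show "AE z in \<nu>. (\<lambda>n. incr j \<phi> (x n) (grad \<phi> (x n)) z) \<longlonglongrightarrow> incr j \<phi> l (grad \<phi> l) z"
    proof (rule AE_I2)
      fix z
      have "(\<lambda>n. j (x n) z) \<longlonglongrightarrow> j l z"
      proof (rule metric_tendsto_imp_tendsto)
        show "(\<lambda>n. C\<^sub>j * norm z * norm (x n - l)) \<longlonglongrightarrow> 0"
          using tendsto_mult_right_zero[OF tendsto_norm_zero[OF LIM_zero[OF x]]] by blast
        show "\<forall>\<^sub>F n in sequentially. dist (j (x n) z) (j l z) \<le> dist (C\<^sub>j * norm z * norm (x n - l)) 0"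
          using J1 by (auto simp: dist_norm abs_mult mult_ac)
      qed
      then show "(\<lambda>n. incr j \<phi> (x n) (grad \<phi> (x n)) z) \<longlonglongrightarrow> incr j \<phi> l (grad \<phi> l) z"
        unfolding incr_def using x
        by (intro tendsto_diff tendsto_mult tendsto_const tendsto_inner
            isCont_tendsto_compose[OF cont(1)] isCont_tendsto_compose[OF cont(2)] tendsto_add)
    qed
  qed (use K integrable_wt incr_measurable[OF C2_borel[OF \<phi>]] in auto)
qed

text \<open>The test functions \<open>\<eta>\<^sub>n P + (1 - \<eta>\<^sub>n) w\<^sub>n\<close> converge to \<open>u\<close> from above; here \<open>P\<close> is the
  periodic paraboloid, \<open>w\<^sub>n\<close> is smooth with \<open>u \<le> w\<^sub>n \<le> P + 2 / (n + 1)\<close>, and \<open>\<eta>\<^sub>n\<close> concentrates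
  on the lattice \<open>x + \<int>\<^sup>d\<close>. Fatou's lemma passes to the limit, since all of them stay below a
  common paraboloid at \<open>x\<close>.\<close>

lemma usc_subsolution_pointwise:
  assumes sub: "visc_usc_subsolution \<nu> j lam F a u"
    and B: "\<And>y. \<bar>u y\<bar> \<le> B"
    and C: "C \<ge> 0" and le: "\<And>y. u y \<le> u x + (y - x) \<bullet> p + C * (norm (y - x))\<^sup>2"
  shows "integrable \<nu> (incr j u x p)" "lam * u x + F x p - a \<le> (\<integral>z. incr j u x p z \<partial>\<nu>)"
proof -
  have per: "Zd_periodic u" and usc: "usc u" using sub by (auto simp: visc_usc_subsolution_def)
  obtain P K where P: "C2_torus P" "\<And>y. u y \<le> P y" "K \<ge> 0"
    and PK: "\<And>y. \<bar>P y - u x - (y - x) \<bullet> p\<bar> \<le> K * (norm (y - x))\<^sup>2"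
    using periodic_paraboloid[OF per C le] by metis
  have "bounded (range P)" using C2_torus_grad[OF P(1)] by (intro Zd_periodic_bounded)
  then obtain BP where BP: "BP > 0" "\<And>x. \<bar>P x\<bar> \<le> BP" unfolding bounded_pos by auto
  obtain U :: "nat \<Rightarrow> real ^ 'd \<Rightarrow> real" where U: "\<And>n. continuous_on UNIV (U n)" "\<And>n. Zd_periodic (U n)"
    "\<And>n x. u x \<le> U n x" "\<And>x. (\<lambda>n. U n x) \<longlonglongrightarrow> u x"
    using usc_approx_continuous[OF usc per, of B] B by (metis abs_le_D1)
  \<comment> \<open>The upward shift equals the approximation error, so the smooth function stays
    above min (U n) P, hence above \<open>u\<close>.\<close>
  have "\<exists>w. C2_torus w \<and> (\<forall>y. \<bar>(min (U n y) (P y) + 1 / real (Suc n)) - w y\<bar> < 1 / real (Suc n))" for n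
  proof -
    have 1: "continuous_on UNIV (\<lambda>y. min (U n y) (P y) + 1 / real (Suc n))"
      using U(1) C2_torus_grad(3)[OF P(1)] by (intro continuous_intros)
    have 2: "Zd_periodic (\<lambda>y. min (U n y) (P y) + 1 / real (Suc n))"
      using U(2)[of n] C2_torus_grad(4)[OF P(1)] by (simp add: Zd_periodic_def)
    have 3: "0 < 1 / real (Suc n)" by simp
    obtain w where "C2_torus w" "\<And>y. \<bar>(min (U n y) (P y) + 1 / real (Suc n)) - w y\<bar> < 1 / real (Suc n)"
      by (rule C2_torus_dense[OF 2 1 3]) blast
    then show ?thesis by blast
  qed
  then obtain w where w: "\<And>n. C2_torus (w n)"
    "\<And>n y. \<bar>(min (U n y) (P y) + 1 / real (Suc n)) - w n y\<bar> < 1 / real (Suc n)" by metis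
  have w_lower: "u y \<le> w n y" for n y
    using w(2)[of n y] U(3)[of y n] P(2)[of y] by (simp add: abs_less_iff min_def split: if_splits)
  have w_upper: "w n y \<le> P y + 2 / real (Suc n)" "w n y \<le> U n y + 2 / real (Suc n)" for n y
    using w(2)[of n y] by (auto simp: abs_less_iff min_def add_divide_distrib split: if_splits)
  define d where "d = real CARD('d)"
  have d: "d > 0" by (simp add: d_def)
  define S where "S = lattice_dist2 x"
  \<comment> \<open>Equal to 1 on the lattice through x and tending to 0 off it. Bernoulli's
    inequality bounds 1 - \<eta> by n S/d, which vanishes to second order at x.\<close>
  define \<eta> where "\<eta> n y = (1 - S y / d) ^ n" for n y
  have S: "0 \<le> S y" "S y \<le> d" "S y \<le> 16 * (norm (y - x))\<^sup>2" for y
    using lattice_dist2_nonneg lattice_dist2_le_dim lattice_dist2_le by (auto simp: S_def d_def)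
  have Sd: "0 \<le> S y / d" "S y / d \<le> 1" for y using S d by auto
  have \<eta>: "0 \<le> \<eta> n y" "\<eta> n y \<le> 1" for n y
    unfolding \<eta>_def using Sd by (auto intro: power_le_one)
  have \<eta>_lower: "1 - \<eta> n y \<le> real n * S y / d" for n y
    using Bernoulli_inequality[of "- (S y / d)" n] Sd[of y] by (simp add: \<eta>_def)
  define \<phi> where "\<phi> n y = \<eta> n y * P y + (1 - \<eta> n y) * w n y" for n y
  have C2\<eta>: "C2_torus (\<eta> n)" for n
  proof -
    have "C2_torus (\<lambda>y. (1 - (1 / d) * S y) ^ n)" unfolding S_def
      by (intro C2_torus_power C2_torus_diff C2_torus_const C2_torus_cmult C2_torus_lattice_dist2)
    then show ?thesis by (simp add: \<eta>_def[abs_def])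
  qed
  have C2\<phi>: "C2_torus (\<phi> n)" for n
    unfolding \<phi>_def by (intro C2_torus_add C2_torus_mult C2_torus_diff C2_torus_const P(1) w(1) C2\<eta>)
  have S0: "S x = 0" by (simp add: S_def lattice_dist2_def)
  have Px: "P x = u x" using PK[of x] by simp
  have \<phi>x: "\<phi> n x = u x" for n by (simp add: \<phi>_def \<eta>_def S0 Px)
  have \<phi>u: "u y \<le> \<phi> n y" for n y
  proof -
    have "\<eta> n y * u y + (1 - \<eta> n y) * u y \<le> \<phi> n y"
      unfolding \<phi>_def using \<eta>[where n=n and y=y] P(2) w_lower by (intro add_mono mult_left_mono) auto
    then show ?thesis by (simp add: algebra_simps)
  qed
  have \<phi>_diff: "\<phi> n y - P y = (1 - \<eta> n y) * (w n y - P y)" for n y by (simp add: \<phi>_def algebra_simps)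
  \<comment> \<open>Replacing \<open>P\<close> by \<open>w n\<close> away from the lattice changes
    the function only quadratically near x. The quadratic constant depends on n, which is harmless
    for the gradient.\<close>
  have G\<phi>: "grad (\<phi> n) x = p" for n
  proof (rule grad_eq, rule GDERIV_quadratic)
    fix y
    define D where "D = B + 2 + 2 * BP"
    have "\<bar>w n y - P y\<bar> \<le> D"
    proof -
      have "2 / real (Suc n) \<le> 2" by (simp add: divide_le_eq)
      then show ?thesis using w_upper(1)[of n y] w_lower[of y n] B[of y] BP(2)[of y] BP(1)
        unfolding D_def by (simp only: abs_le_iff) linarith
    qed
    moreover have "D \<ge> 0" using B[of x] BP by (simp add: D_def)
    moreover have "1 - \<eta> n y \<le> real n * (16 * (norm (y - x))\<^sup>2) / d"
    proof -
      have "real n * S y / d \<le> real n * (16 * (norm (y - x))\<^sup>2) / d"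
        using S(3) d by (intro divide_right_mono mult_left_mono) auto
      then show ?thesis using \<eta>_lower[of n y] by linarith
    qed
    ultimately have "\<bar>\<phi> n y - P y\<bar> \<le> (real n * (16 * (norm (y - x))\<^sup>2) / d) * D"
      unfolding \<phi>_diff abs_mult using \<eta>[where n=n and y=y] by (intro mult_mono) auto
    then have "\<bar>\<phi> n y - P y\<bar> \<le> (real n * 16 / d * D) * (norm (y - x))\<^sup>2" by (simp add: mult_ac)
    then show "\<bar>\<phi> n y - \<phi> n x - (y - x) \<bullet> p\<bar> \<le> (real n * 16 / d * D + K) * (norm (y - x))\<^sup>2"
      using PK[of y] unfolding \<phi>x distrib_right abs_le_iff by linarith
  qed
  have A: "lam * u x + F x p - a \<le> (\<integral>z. incr j (\<phi> n) x p z \<partial>\<nu>)" for n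
  proof -
    have "\<forall>y. u y - \<phi> n y \<le> u x - \<phi> n x" using \<phi>u by (simp add: \<phi>x)
    then have "lam * u x - nonlocal_op \<nu> j (\<phi> n) x + F x (grad (\<phi> n) x) \<le> a"
      using sub C2\<phi> unfolding visc_usc_subsolution_def by blast
    then show ?thesis by (simp add: nonlocal_op_incr G\<phi>)
  qed
  \<comment> \<open>The decisive uniformity: the factor n in 1 - \<eta> <= n S/d is compensated by w
    n - P <= 2/(n+1). One paraboloid therefore lies above all test functions, although their second
    derivatives may blow up.\<close>
  have \<phi>_up: "\<phi> n y \<le> P y + 2 * S y" for n y
  proof -
    have "(1 - \<eta> n y) * (w n y - P y) \<le> (1 - \<eta> n y) * (2 / real (Suc n))"
      using \<eta>[where n=n and y=y] w_upper(1)[of n y] by (intro mult_left_mono) auto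
    also have "\<dots> \<le> (real n * S y / d) * (2 / real (Suc n))"
      using \<eta>_lower by (intro mult_right_mono) auto
    also have "\<dots> = 2 * S y * (real n / (d * real (Suc n)))" by simp
    also have "\<dots> \<le> 2 * S y * 1"
    proof (intro mult_left_mono)
      have "real n \<le> 1 * real (Suc n)" by simp
      also have "\<dots> \<le> d * real (Suc n)" unfolding d_def by (intro mult_right_mono) auto
      finally show "real n / (d * real (Suc n)) \<le> 1" using d by (simp add: divide_le_eq_1)
    qed (use S in simp)
    finally show ?thesis using \<phi>_diff[of n y] by simp
  qed
  define M where "M = BP + 2 * d + B"
  have M: "M \<ge> 0" using BP d B[of x] by (simp add: M_def)
  define K' where "K' = (K + 32) * C\<^sub>j\<^sup>2 + M"
  have dom: "incr j (\<phi> n) x p z \<le> K' * wt z" for n z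
    unfolding K'_def
  proof (rule incr_le_wt)
    show "\<phi> n y \<le> \<phi> n x + (y - x) \<bullet> p + (K + 32) * (norm (y - x))\<^sup>2" for y
      using \<phi>_up[of n y] PK[of y] S(3)[of y] unfolding \<phi>x abs_le_iff distrib_right by linarith
    show "\<phi> n y \<le> \<phi> n x + M" for y
      using \<phi>_up[of n y] BP(2)[of y] S(2)[of y] B[of x] unfolding \<phi>x M_def abs_le_iff by linarith
  qed (use P M in auto)
  \<comment> \<open>On the lattice all terms equal \<open>u x\<close>. Off the lattice \<eta>
    disappears and \<open>w n\<close> is squeezed between \<open>u\<close> and U n +
    2/(n+1).\<close>
  have lim: "(\<lambda>n. \<phi> n y) \<longlonglongrightarrow> u y" for y
  proof (cases "S y = 0")
    case True
    then have k: "(y - x) $ i \<in> \<int>" for i unfolding S_def by (rule lattice_dist2_eq_0D)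
    have "P y = P x" "u y = u x"
      using Zd_periodicD[OF per, of "y - x" x] Zd_periodicD[OF C2_torus_grad(4)[OF P(1)], of "y - x" x] k by simp_all
    then have "\<phi> n y = u y" for n by (simp add: \<phi>_def \<eta>_def True Px)
    then show ?thesis by simp
  next
    case False
    then have "0 < S y / d" using S(1)[of y] d by simp
    then have "\<bar>1 - S y / d\<bar> < 1" using Sd[of y] by simp
    then have \<eta>0: "(\<lambda>n. \<eta> n y) \<longlonglongrightarrow> 0" unfolding \<eta>_def by (intro LIMSEQ_power_zero) simp
    have "(\<lambda>n. 2 / real (Suc n)) \<longlonglongrightarrow> 0" using LIMSEQ_Suc[OF lim_const_over_n[of 2]] by simp
    then have "(\<lambda>n. U n y + 2 / real (Suc n)) \<longlonglongrightarrow> u y + 0" by (intro tendsto_add U(4))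
    then have "(\<lambda>n. w n y) \<longlonglongrightarrow> u y"
      using w_lower w_upper(2)
      by (intro tendsto_sandwich[of "\<lambda>_. u y" "\<lambda>n. w n y" _ "\<lambda>n. U n y + 2 / real (Suc n)"] always_eventually allI tendsto_const)
        simp_all
    then have "(\<lambda>n. \<eta> n y * P y + (1 - \<eta> n y) * w n y) \<longlonglongrightarrow> 0 * P y + (1 - 0) * u y"
      by (intro tendsto_intros \<eta>0)
    then show ?thesis by (simp add: \<phi>_def)
  qed
  have int: "integrable \<nu> (incr j (\<phi> n) x p)" for n
    using integrable_incr_C2[OF C2\<phi>, of n x] by (simp add: G\<phi>)
  have lim2: "(\<lambda>n. incr j (\<phi> n) x p z) \<longlonglongrightarrow> incr j u x p z" for z
    unfolding incr_def by (intro tendsto_diff tendsto_const lim)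
  note fatou = integrable_reverse_fatou[of \<nu> "\<lambda>n. incr j (\<phi> n) x p" "\<lambda>z. K' * wt z", OF int _ dom lim2 A]
  show "integrable \<nu> (incr j u x p)" "lam * u x + F x p - a \<le> (\<integral>z. incr j u x p z \<partial>\<nu>)"
    using fatou integrable_wt by auto
qed

end

section \<open>Comparison\<close>

lemma Zd_periodic_neg: "Zd_periodic f \<Longrightarrow> (\<And>i. k $ i \<in> \<int>) \<Longrightarrow> f (x - k) = f x"
  using Zd_periodicD[of f "- k" x] by simp

text \<open>The doubled function is invariant only under simultaneous lattice translations of both
  points. In the coordinates x and x - y the first can be moved to the unit cube and the second is
  confined by the growth of \<theta>; the margin 4 B is twice the maximal oscillation of either
  summand.\<close>

lemma doubling_attains_sup:
  fixes f g :: "real ^ 'd \<Rightarrow> real" and \<theta> :: "real ^ 'd \<Rightarrow> real"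
  assumes f: "usc f" "Zd_periodic f" and g: "usc g" "Zd_periodic g" and \<theta>: "continuous_on UNIV \<theta>"
    and B: "\<And>x. \<bar>f x\<bar> \<le> B" "\<And>x. \<bar>g x\<bar> \<le> B"
    and R: "\<And>w. R < norm w \<Longrightarrow> \<theta> 0 + 4 * B \<le> \<theta> w"
  obtains x y where "\<And>x' y'. f x' + g y' - \<theta> (x' - y') \<le> f x + g y - \<theta> (x - y)"
proof -
  define \<Psi> where "\<Psi> p = f (fst p) + g (fst p - snd p) - \<theta> (snd p)" for p :: "(real ^ 'd) \<times> (real ^ 'd)"
  have "usc \<Psi>" unfolding \<Psi>_def
    by (intro usc_diff_continuous usc_add usc_compose[OF f(1)] usc_compose[OF g(1)] continuous_on_compose2[OF \<theta>] continuous_intros) auto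
  define K where "K = (unit_cube :: (real ^ 'd) set) \<times> cball (0 :: real ^ 'd) (max R 0)"
  have "compact K" unfolding K_def by (intro compact_Times compact_cbox compact_cball)
  moreover have "(0, 0) \<in> K" by (simp add: K_def mem_box_cart)
  then have "K \<noteq> {}" by blast
  ultimately obtain p where p: "p \<in> K" "\<And>q. q \<in> K \<Longrightarrow> \<Psi> q \<le> \<Psi> p"
    using usc_attains_sup[OF \<open>usc \<Psi>\<close>] by metis
  show thesis
  proof (rule that)
    fix x' y'
    have main: "\<Psi> (x', w) \<le> \<Psi> p" if w: "norm w \<le> max R 0" for x' w
    proof -
      obtain k where k: "\<And>i. k $ i \<in> \<int>" "x' + k \<in> unit_cube" by (rule lattice_translate_unit_cube[of x']) blast
      have "\<Psi> (x' + k, w) = \<Psi> (x', w)"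
        using Zd_periodicD[OF f(2) k(1), of x'] Zd_periodicD[OF g(2) k(1), of "x' - w"] by (simp add: \<Psi>_def algebra_simps)
      moreover have "(x' + k, w) \<in> K" using k w by (simp add: K_def)
      ultimately show ?thesis using p(2) by metis
    qed
    have "f x' + g y' - \<theta> (x' - y') \<le> \<Psi> p"
    proof (cases "norm (x' - y') \<le> max R 0")
      case True
      from main[OF this, of x'] show ?thesis by (simp add: \<Psi>_def)
    next
      case False
      then have "\<theta> 0 + 4 * B \<le> \<theta> (x' - y')" by (intro R) simp
      moreover have "\<Psi> (x', 0) \<le> \<Psi> p" by (rule main) simp
      ultimately show ?thesis using B(1)[of x'] B(2)[of x'] B(2)[of y'] unfolding \<Psi>_def by (simp add: abs_le_iff)
    qed
    then show "f x' + g y' - \<theta> (x' - y') \<le> f (fst p) + g (fst p - snd p) - \<theta> (fst p - (fst p - snd p))"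
      by (simp add: \<Psi>_def)
  qed
qed

locale superlinear_hamiltonian = levy_kernel \<nu> j C\<^sub>\<nu> C\<^sub>j
  for \<nu> :: "(real ^ 'd) measure" and j :: "real ^ 'd \<Rightarrow> real ^ 'd \<Rightarrow> real ^ 'd" and C\<^sub>\<nu> C\<^sub>j +
  fixes G :: "real ^ 'd \<Rightarrow> real ^ 'd \<Rightarrow> real" and \<alpha>\<^sub>0 \<alpha>\<^sub>1 \<gamma> :: real
  assumes params: "\<alpha>\<^sub>0 > 0" "\<alpha>\<^sub>1 > 0" "\<gamma> > 1"
    and G_periodic: "Zd_periodic G"
    and G_convex: "\<And>x. convex_on UNIV (G x)"
    and G1: "\<And>x p. \<alpha>\<^sub>0 * norm p powr \<gamma> - 1 / \<alpha>\<^sub>0 \<le> G x p"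
      "\<And>x p. G x p \<le> \<alpha>\<^sub>1 * (norm p powr \<gamma> + 1)"
    and G2: "\<And>x p q. \<bar>G x p - G x q\<bar> \<le>
      \<alpha>\<^sub>1 * (norm p + norm q + 1) powr (\<gamma> - 1) * norm (p - q)"
    and G3: "\<And>x y p. \<bar>G x p - G y p\<bar> \<le> \<alpha>\<^sub>1 * (norm p powr \<gamma> + 1) * norm (x - y)"
begin

text \<open>Convexity between \<open>\<epsilon> q\<close> and \<open>t q\<close>; \<open>\<epsilon>\<close> is so small that \<open>\<epsilon> G(x, q)\<close>
  dominates \<open>G(x, \<epsilon> q)\<close> up to a constant, which uses \<open>\<gamma> > 1\<close>.\<close>

lemma superlinear_gain:
  obtains c\<^sub>1 K where "c\<^sub>1 > 0" "K \<ge> 0"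
    "\<And>x q t. t \<ge> 1 \<Longrightarrow> (t - 1) * (c\<^sub>1 * norm q powr \<gamma> - K) \<le> G x (t *\<^sub>R q) - t * G x q"
proof -
  \<comment> \<open>Chosen so that \<alpha>1 \<epsilon>^\<gamma> <= \<epsilon> \<alpha>0/2; the
    exponent 1/(\<gamma> - 1) solves this.\<close>
  define \<epsilon> where "\<epsilon> = min (1 / 2) ((\<alpha>\<^sub>0 / (2 * \<alpha>\<^sub>1)) powr (1 / (\<gamma> - 1)))"
  have \<epsilon>: "\<epsilon> > 0" "\<epsilon> \<le> 1 / 2" using params by (auto simp: \<epsilon>_def)
  have "\<epsilon> powr (\<gamma> - 1) \<le> ((\<alpha>\<^sub>0 / (2 * \<alpha>\<^sub>1)) powr (1 / (\<gamma> - 1))) powr (\<gamma> - 1)"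
    using \<epsilon> params by (intro powr_mono2) (auto simp: \<epsilon>_def)
  also have "\<dots> = \<alpha>\<^sub>0 / (2 * \<alpha>\<^sub>1)" using params by (simp add: powr_powr)
  finally have "\<alpha>\<^sub>1 * \<epsilon> powr (\<gamma> - 1) \<le> \<alpha>\<^sub>0 / 2" using params by (simp add: pos_le_divide_eq mult_ac)
  then have "\<epsilon> * (\<alpha>\<^sub>1 * \<epsilon> powr (\<gamma> - 1)) \<le> \<epsilon> * (\<alpha>\<^sub>0 / 2)" using \<epsilon> by (intro mult_left_mono) auto
  moreover have "\<epsilon> * \<epsilon> powr (\<gamma> - 1) = \<epsilon> powr \<gamma>"
    using \<epsilon> powr_add[of \<epsilon> 1 "\<gamma> - 1"] by simp
  ultimately have \<epsilon>\<gamma>: "\<alpha>\<^sub>1 * \<epsilon> powr \<gamma> \<le> \<epsilon> * \<alpha>\<^sub>0 / 2" by (metis mult.left_commute times_divide_eq_right)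
  define b where "b = \<epsilon> / \<alpha>\<^sub>0 + \<alpha>\<^sub>1"
  have b: "b \<ge> 0" using \<epsilon> params by (simp add: b_def)
  show thesis
  proof (rule that)
    show "\<epsilon> * \<alpha>\<^sub>0 / 2 > 0" "2 * b \<ge> 0" using \<epsilon> params b by auto
    fix x q :: "real ^ 'd" and t :: real assume t: "t \<ge> 1"
    \<comment> \<open>The weight that writes q as a convex combination of t q and \<epsilon>
      q.\<close>
    define \<tau> where "\<tau> = (1 - \<epsilon>) / (t - \<epsilon>)"
    have te: "t - \<epsilon> > 0" "1 - \<epsilon> > 0" using t \<epsilon> by auto
    have \<tau>: "0 \<le> \<tau>" "\<tau> \<le> 1" using t te by (auto simp: \<tau>_def)
    have "\<tau> * t + (1 - \<tau>) * \<epsilon> = \<epsilon> + \<tau> * (t - \<epsilon>)" by (simp add: algebra_simps)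
    also have "\<dots> = 1" using te by (simp add: \<tau>_def)
    finally have comb: "\<tau> * t + (1 - \<tau>) * \<epsilon> = 1" .
    have "\<tau> *\<^sub>R (t *\<^sub>R q) + (1 - \<tau>) *\<^sub>R (\<epsilon> *\<^sub>R q) = q"
      using comb by (metis scaleR_left_distrib scaleR_one scaleR_scaleR)
    then have "G x q \<le> \<tau> * G x (t *\<^sub>R q) + (1 - \<tau>) * G x (\<epsilon> *\<^sub>R q)"
      using convex_onD[OF G_convex[of x], of "1 - \<tau>" "t *\<^sub>R q" "\<epsilon> *\<^sub>R q"] \<tau> by simp
    then have "(t - \<epsilon>) * G x q \<le> (t - \<epsilon>) * (\<tau> * G x (t *\<^sub>R q) + (1 - \<tau>) * G x (\<epsilon> *\<^sub>R q))"
      using te by (intro mult_left_mono) auto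
    also have "\<dots> = ((t - \<epsilon>) * \<tau>) * G x (t *\<^sub>R q) + ((t - \<epsilon>) - (t - \<epsilon>) * \<tau>) * G x (\<epsilon> *\<^sub>R q)"
      by (simp add: algebra_simps)
    also have "(t - \<epsilon>) * \<tau> = 1 - \<epsilon>" using te by (simp add: \<tau>_def)
    finally have conv: "(t - \<epsilon>) * G x q \<le> (1 - \<epsilon>) * G x (t *\<^sub>R q) + (t - 1) * G x (\<epsilon> *\<^sub>R q)" by simp
    define X where "X = norm q powr \<gamma>"
    have X: "X \<ge> 0" by (simp add: X_def)
    have "G x (\<epsilon> *\<^sub>R q) \<le> \<alpha>\<^sub>1 * (\<epsilon> powr \<gamma> * X + 1)"
      using G1(2)[of x "\<epsilon> *\<^sub>R q"] \<epsilon> by (simp add: X_def powr_mult)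
    also have "\<dots> = \<alpha>\<^sub>1 * \<epsilon> powr \<gamma> * X + \<alpha>\<^sub>1" by (simp add: algebra_simps)
    also have "\<dots> \<le> \<epsilon> * \<alpha>\<^sub>0 / 2 * X + \<alpha>\<^sub>1" using \<epsilon>\<gamma> X by (intro add_mono mult_right_mono) auto
    finally have g1: "G x (\<epsilon> *\<^sub>R q) \<le> \<epsilon> * \<alpha>\<^sub>0 / 2 * X + \<alpha>\<^sub>1" .
    have "\<epsilon> * (\<alpha>\<^sub>0 * X - 1 / \<alpha>\<^sub>0) \<le> \<epsilon> * G x q"
      using G1(1)[where x=x and p=q] \<epsilon> unfolding X_def by (intro mult_left_mono) auto
    then have g2: "\<epsilon> * \<alpha>\<^sub>0 * X - \<epsilon> / \<alpha>\<^sub>0 \<le> \<epsilon> * G x q" by (simp add: algebra_simps)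
    have "\<epsilon> * \<alpha>\<^sub>0 / 2 * X - b \<le> \<epsilon> * G x q - G x (\<epsilon> *\<^sub>R q)" using g1 g2 unfolding b_def by simp
    then have "(t - 1) * (\<epsilon> * \<alpha>\<^sub>0 / 2 * X - b) \<le> (t - 1) * (\<epsilon> * G x q - G x (\<epsilon> *\<^sub>R q))"
      using t by (intro mult_left_mono) auto
    also have "\<dots> \<le> (1 - \<epsilon>) * (G x (t *\<^sub>R q) - t * G x q)" using conv by (simp add: algebra_simps)
    finally have main: "(t - 1) * (\<epsilon> * \<alpha>\<^sub>0 / 2 * X - b) \<le> (1 - \<epsilon>) * (G x (t *\<^sub>R q) - t * G x q)" .
    \<comment> \<open>Convexity yields the gain with the factor 1 - \<epsilon> on the other side.
      That factor lies between 1/2 and 1, so it is removed at the price of doubling the constant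
      \<open>b\<close>.\<close>
    have "(1 - \<epsilon>) * ((t - 1) * (\<epsilon> * \<alpha>\<^sub>0 / 2 * X - 2 * b)) \<le> (t - 1) * (\<epsilon> * \<alpha>\<^sub>0 / 2 * X - b)"
    proof -
      have "(1 - \<epsilon>) * (\<epsilon> * \<alpha>\<^sub>0 / 2 * X - 2 * b) = (1 - \<epsilon>) * (\<epsilon> * \<alpha>\<^sub>0 / 2 * X) - (1 - \<epsilon>) * (2 * b)"
        by (simp add: right_diff_distrib)
      also have "\<dots> \<le> \<epsilon> * \<alpha>\<^sub>0 / 2 * X - b"
      proof (rule diff_mono)
        show "(1 - \<epsilon>) * (\<epsilon> * \<alpha>\<^sub>0 / 2 * X) \<le> \<epsilon> * \<alpha>\<^sub>0 / 2 * X"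
          using \<epsilon> params X by (intro mult_left_le_one_le) auto
        have "1 / 2 * (2 * b) \<le> (1 - \<epsilon>) * (2 * b)" using \<epsilon> b by (intro mult_right_mono) auto
        then show "b \<le> (1 - \<epsilon>) * (2 * b)" by simp
      qed
      finally have "(t - 1) * ((1 - \<epsilon>) * (\<epsilon> * \<alpha>\<^sub>0 / 2 * X - 2 * b)) \<le> (t - 1) * (\<epsilon> * \<alpha>\<^sub>0 / 2 * X - b)"
        using t by (intro mult_left_mono) auto
      then show ?thesis by (simp only: mult.left_commute)
    qed
    with main have "(1 - \<epsilon>) * ((t - 1) * (\<epsilon> * \<alpha>\<^sub>0 / 2 * X - 2 * b)) \<le> (1 - \<epsilon>) * (G x (t *\<^sub>R q) - t * G x q)" by (rule order_trans[rotated])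
    then show "(t - 1) * (\<epsilon> * \<alpha>\<^sub>0 / 2 * norm q powr \<gamma> - 2 * b) \<le> G x (t *\<^sub>R q) - t * G x q"
      using te unfolding X_def by (simp only: mult_le_cancel_left_pos)
  qed
qed

text \<open>In the application \<open>b\<close> grows at infinity and its own integral may be
  infinite. The minimum with the integrable weight makes dominated convergence available.\<close>

lemma integral_min_wt_tendsto_0:
  assumes \<omega>: "\<omega> \<longlonglongrightarrow> 0" "\<And>n. 0 \<le> \<omega> n" and K: "K \<ge> 0" and b: "b \<in> borel_measurable borel" "\<And>z. 0 \<le> b z"
  shows "(\<lambda>n. \<integral>z. min (K * wt z) (\<omega> n * b z) \<partial>\<nu>) \<longlonglongrightarrow> 0"
proof -
  have [measurable]: "b \<in> borel_measurable \<nu>" "wt \<in> borel_measurable \<nu>"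
    using borel_measurable_nu[OF b(1)] wt_measurable by auto
  have "(\<lambda>n. \<integral>z. min (K * wt z) (\<omega> n * b z) \<partial>\<nu>) \<longlonglongrightarrow> (\<integral>z. 0 \<partial>\<nu>)"
  proof (rule integral_dominated_convergence[where w="\<lambda>z. K * wt z"])
    show "AE z in \<nu>. (\<lambda>n. min (K * wt z) (\<omega> n * b z)) \<longlonglongrightarrow> 0"
    proof (rule AE_I2)
      fix z
      have "(\<lambda>n. min (K * wt z) (\<omega> n * b z)) \<longlonglongrightarrow> min (K * wt z) (0 * b z)"
        by (intro tendsto_min tendsto_mult tendsto_const \<omega>)
      then show "(\<lambda>n. min (K * wt z) (\<omega> n * b z)) \<longlonglongrightarrow> 0" using K wt_nonneg[of z] by (simp add: min_absorb2)
    qed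
    show "AE z in \<nu>. norm (min (K * wt z) (\<omega> n * b z)) \<le> K * wt z" for n
      using K wt_nonneg b(2) \<omega>(2)[of n] by (intro AE_I2) (auto simp: min_def)
  qed (use integrable_wt in auto)
  then show ?thesis by simp
qed

text \<open>Doubling of variables for \<open>\<mu> u - v\<close> with fixed \<open>\<mu> < 1\<close>: the superlinear gain of size
  \<open>1 - \<mu>\<close> absorbs the error of (G3), which the usual penalty terms do not control for \<open>\<gamma> > 1\<close>.\<close>

lemma comparison:
  assumes lam: "lam > 0"
    and u: "visc_usc_subsolution \<nu> j lam G a u" and uB: "\<And>x. \<bar>u x\<bar> \<le> B"
    and v: "visc_usc_subsolution \<nu> j lam (\<lambda>x p. - G x (- p)) (- a) (\<lambda>x. - v x)" and vB: "\<And>x. \<bar>v x\<bar> \<le> B"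
  shows "u x\<^sub>0 \<le> v x\<^sub>0"
proof (rule ccontr)
  assume neg: "\<not> u x\<^sub>0 \<le> v x\<^sub>0"
  define s where "s = (u x\<^sub>0 - v x\<^sub>0) / 2"
  have s: "s > 0" "u x\<^sub>0 - v x\<^sub>0 = 2 * s" using neg by (auto simp: s_def)
  obtain c\<^sub>1 K where c\<^sub>1: "c\<^sub>1 > 0" and K: "K \<ge> 0"
    and gain: "\<And>x q t. t \<ge> 1 \<Longrightarrow> (t - 1) * (c\<^sub>1 * norm q powr \<gamma> - K) \<le> G x (t *\<^sub>R q) - t * G x q"
    using superlinear_gain by metis
  have B0: "B \<ge> 0" using uB[of 0] by simp
  \<comment> \<open>The two summands make 1 - \<mu> = 1/(2 + D) so small that (1 - \<mu>) B <= s and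
    (1 - \<mu>)(K + |a|) <= lam s/2: passing to \<mu> u keeps a positive maximum, and the lower
    order terms use at most half of it.\<close>
  define D where "D = B / s + (K + \<bar>a\<bar>) / (lam * s / 2)"
  have D: "D \<ge> 0" using s B0 K lam by (simp add: D_def)
  define \<mu> where "\<mu> = 1 - 1 / (2 + D)"
  have \<mu>: "0 < \<mu>" "\<mu> < 1" "1 - \<mu> = 1 / (2 + D)" using D by (auto simp: \<mu>_def)
  have small1: "(1 - \<mu>) * B \<le> s"
  proof -
    have "B = s * (B / s)" using s by simp
    also have "\<dots> \<le> s * (2 + D)" using s lam K unfolding D_def by (intro mult_left_mono) auto
    finally show ?thesis unfolding \<mu>(3) using D by (simp add: pos_divide_le_eq)
  qed
  have small2: "(1 - \<mu>) * (K + \<bar>a\<bar>) \<le> lam * s / 2"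
  proof -
    have "K + \<bar>a\<bar> = (lam * s / 2) * ((K + \<bar>a\<bar>) / (lam * s / 2))" using s lam by simp
    also have "\<dots> \<le> (lam * s / 2) * (2 + D)" using s lam B0 unfolding D_def by (intro mult_left_mono) auto
    finally show ?thesis unfolding \<mu>(3) using D by (simp add: pos_divide_le_eq)
  qed
  have uper: "Zd_periodic u" "usc u" and vper: "Zd_periodic (\<lambda>x. - v x)" "usc (\<lambda>x. - v x)"
    using u v by (auto simp: visc_usc_subsolution_def)
  \<comment> \<open>With doubling penalties, testing the maximum at level k with the maximizers of
    level k+1 gives M (k+1) + \<omega> (k+1)/4 <= M k. As \<open>M\<close> decreases and is bounded
    below, this forces the penalty \<omega> to 0.\<close>
  define nn where "nn k = (2::real) ^ k" for k :: nat
  have nn: "nn k \<ge> 1" "nn k > 0" "nn (Suc k) = 2 * nn k" for k by (auto simp: nn_def)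
  define \<theta> where "\<theta> k w = nn k / 2 * (norm w)\<^sup>2" for k and w :: "real ^ 'd"
  have "\<exists>x y. \<forall>x' y'. \<mu> * u x' - v y' - \<theta> k (x' - y') \<le> \<mu> * u x - v y - \<theta> k (x - y)" for k
  proof -
    obtain x y where "\<And>x' y'. \<mu> * u x' + - v y' - \<theta> k (x' - y') \<le> \<mu> * u x + - v y - \<theta> k (x - y)"
    proof (rule doubling_attains_sup[of "\<lambda>x. \<mu> * u x" "\<lambda>y. - v y" "\<theta> k" B "8 * B + 1"])
      show "usc (\<lambda>x. \<mu> * u x)" by (rule usc_cmult[OF uper(2) \<mu>(1)])
      show "Zd_periodic (\<lambda>x. \<mu> * u x)" using uper(1) by (rule Zd_periodic_comp)
      show "continuous_on UNIV (\<theta> k)" unfolding \<theta>_def by (intro continuous_intros)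
      show "\<bar>\<mu> * u x\<bar> \<le> B" for x
        using mult_mono[of "\<bar>\<mu>\<bar>" 1 "\<bar>u x\<bar>" B] \<mu> uB[of x] by (simp add: abs_mult)
      show "\<bar>- v x\<bar> \<le> B" for x using vB by simp
      fix w :: "real ^ 'd" assume w: "8 * B + 1 < norm w"
      have "8 * B * 1 \<le> norm w * norm w" using w B0 by (intro mult_mono) auto
      also have "\<dots> \<le> nn k * (norm w)\<^sup>2" using nn(1)[of k] mult_right_mono[of 1 "nn k" "(norm w)\<^sup>2"] by (simp add: power2_eq_square)
      finally show "\<theta> k 0 + 4 * B \<le> \<theta> k w" by (simp add: \<theta>_def)
    qed (use vper that in auto)
    then show ?thesis by auto
  qed
  then obtain x y where xy: "\<And>k x' y'. \<mu> * u x' - v y' - \<theta> k (x' - y') \<le> \<mu> * u (x k) - v (y k) - \<theta> k (x k - y k)"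
    by metis
  define M where "M k = \<mu> * u (x k) - v (y k) - \<theta> k (x k - y k)" for k
  define w where "w k = x k - y k" for k
  define \<omega> where "\<omega> k = nn k * (norm (w k))\<^sup>2" for k
  have \<omega>0: "\<omega> k \<ge> 0" for k using nn(2)[of k] by (simp add: \<omega>_def)
  have Ms: "M k \<ge> s" for k
  proof -
    have "\<mu> * u x\<^sub>0 = u x\<^sub>0 - (1 - \<mu>) * u x\<^sub>0" by (simp add: algebra_simps)
    moreover have "(1 - \<mu>) * u x\<^sub>0 \<le> (1 - \<mu>) * B" using uB[of x\<^sub>0] \<mu>(2) by (intro mult_left_mono) auto
    moreover have "\<mu> * u x\<^sub>0 - v x\<^sub>0 \<le> M k" using xy[where k=k and x'=x\<^sub>0 and y'=x\<^sub>0] by (simp add: M_def \<theta>_def)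
    ultimately show ?thesis using small1 s by linarith
  qed
  have Mdec: "M (Suc k) + \<omega> (Suc k) / 4 \<le> M k" for k
    using xy[where k=k and x'="x (Suc k)" and y'="y (Suc k)"] nn(3)[of k] by (simp add: M_def \<theta>_def \<omega>_def w_def)
  have "decseq M" 
  proof (rule decseq_SucI)
    show "M (Suc k) \<le> M k" for k using Mdec[of k] \<omega>0[of "Suc k"] by linarith
  qed
  then obtain L where L: "M \<longlonglongrightarrow> L" using decseq_convergent[of M s] Ms by blast
  have "(\<lambda>k. \<omega> (Suc k)) \<longlonglongrightarrow> 0"
  proof (rule tendsto_sandwich[of "\<lambda>_. 0" _ _ "\<lambda>k. 4 * (M k - M (Suc k))"])
    have "(\<lambda>k. 4 * (M k - M (Suc k))) \<longlonglongrightarrow> 4 * (L - L)"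
      by (intro tendsto_intros L LIMSEQ_Suc[OF L])
    then show "(\<lambda>k. 4 * (M k - M (Suc k))) \<longlonglongrightarrow> 0" by simp
    show "\<forall>\<^sub>F k in sequentially. \<omega> (Suc k) \<le> 4 * (M k - M (Suc k))"
    proof (intro always_eventually allI)
      show "\<omega> (Suc k) \<le> 4 * (M k - M (Suc k))" for k using Mdec[of k] by argo
    qed
  qed (use \<omega>0 in auto)
  then have \<omega>lim: "\<omega> \<longlonglongrightarrow> 0" by (rule LIMSEQ_imp_Suc)
  have wlim: "(\<lambda>k. norm (w k)) \<longlonglongrightarrow> 0"
  proof -
    have "(\<lambda>k. (norm (w k))\<^sup>2) \<longlonglongrightarrow> 0"
    proof (rule tendsto_sandwich[of "\<lambda>_. 0" _ _ \<omega>])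
      show "\<forall>\<^sub>F k in sequentially. (norm (w k))\<^sup>2 \<le> \<omega> k"
      proof (intro always_eventually allI)
        fix k
        have "1 * (norm (w k))\<^sup>2 \<le> nn k * (norm (w k))\<^sup>2" by (rule mult_right_mono[OF nn(1)]) simp
        then show "(norm (w k))\<^sup>2 \<le> \<omega> k" by (simp add: \<omega>_def)
      qed
    qed (use \<omega>lim in auto)
    then have "(\<lambda>k. sqrt ((norm (w k))\<^sup>2)) \<longlonglongrightarrow> sqrt 0" by (intro tendsto_real_sqrt)
    then show ?thesis by simp
  qed
  define K' where "K' = 4 * B + C\<^sub>j\<^sup>2"
  define b where "b z = C\<^sub>j * norm z + C\<^sub>j\<^sup>2 * (norm z)\<^sup>2" for z :: "real ^ 'd"
  have K'0: "K' \<ge> 0" using B0 by (simp add: K'_def)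
  have b0: "b z \<ge> 0" for z using J1(1) by (simp add: b_def)
  have bm: "b \<in> borel_measurable borel" unfolding b_def by measurable
  \<comment> \<open>In the limit the last two terms vanish and leave lam s <= lam s/2. The
    hypothesis on |w k| lets the gain absorb the error of (G3), and \<omega> k <= 1 gives a majorant
    independent of k.\<close>
  have est: "lam * s \<le> lam * s / 2 + \<alpha>\<^sub>1 * norm (w k) + (\<integral>z. min (K' * wt z) (\<omega> k * b z) \<partial>\<nu>)"
    if w1: "\<alpha>\<^sub>1 * norm (w k) \<le> (1 - \<mu>) * c\<^sub>1" and \<omega>1: "\<omega> k \<le> 1" for k
  proof -
    define p where "p = nn k *\<^sub>R w k"
    have quad: "\<theta> k (w k + h) = \<theta> k (w k) + h \<bullet> p + nn k / 2 * (norm h)\<^sup>2" for h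
      by (simp add: \<theta>_def p_def power2_norm_eq_inner inner_add_left inner_add_right inner_commute algebra_simps)
    have ule: "u x' \<le> u (x k) + (x' - x k) \<bullet> ((1 / \<mu>) *\<^sub>R p) + nn k / (2 * \<mu>) * (norm (x' - x k))\<^sup>2" for x'
    proof -
      have "\<mu> * u x' \<le> \<mu> * u (x k) + \<theta> k (w k + (x' - x k)) - \<theta> k (w k)"
        using xy[where k=k and x'=x' and y'="y k"] by (simp add: w_def algebra_simps)
      then have "\<mu> * u x' \<le> \<mu> * (u (x k) + (x' - x k) \<bullet> ((1 / \<mu>) *\<^sub>R p) + nn k / (2 * \<mu>) * (norm (x' - x k))\<^sup>2)"
        unfolding quad using \<mu> by (simp add: distrib_left)
      then show ?thesis using \<mu>(1) by (simp only: mult_le_cancel_left_pos)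
    qed
    have vle: "- v y' \<le> - v (y k) + (y' - y k) \<bullet> (- p) + nn k / 2 * (norm (y' - y k))\<^sup>2" for y'
    proof -
      have "- v y' \<le> - v (y k) + \<theta> k (w k + (y k - y')) - \<theta> k (w k)"
        using xy[where k=k and x'="x k" and y'=y'] by (simp add: w_def algebra_simps)
      then show ?thesis unfolding quad by (simp add: inner_diff_left norm_minus_commute)
    qed
    have "nn k / (2 * \<mu>) \<ge> 0" "nn k / 2 \<ge> 0" using nn(2)[of k] \<mu> by auto
    note PWu = usc_subsolution_pointwise[OF u uB this(1) ule]
    note PWv = usc_subsolution_pointwise[OF v _ \<open>nn k / 2 \<ge> 0\<close> vle]
    have vB': "\<bar>- v z\<bar> \<le> B" for z using vB by simp
    define E where "E z = \<mu> * incr j u (x k) ((1 / \<mu>) *\<^sub>R p) z + incr j (\<lambda>x. - v x) (y k) (- p) z" for z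
    have Eint: "integrable \<nu> E" unfolding E_def using PWu(1) PWv(1)[OF vB'] by (intro Bochner_Integration.integrable_add integrable_mult_right)
    have Eval: "(\<integral>z. E z \<partial>\<nu>) = \<mu> * (\<integral>z. incr j u (x k) ((1 / \<mu>) *\<^sub>R p) z \<partial>\<nu>) + (\<integral>z. incr j (\<lambda>x. - v x) (y k) (- p) z \<partial>\<nu>)"
      unfolding E_def using PWu(1) PWv(1)[OF vB'] by simp
    have "\<mu> * (lam * u (x k) + G (x k) ((1 / \<mu>) *\<^sub>R p) - a) \<le> \<mu> * (\<integral>z. incr j u (x k) ((1 / \<mu>) *\<^sub>R p) z \<partial>\<nu>)"
      using PWu(2) \<mu> by (intro mult_left_mono) auto
    with PWv(2)[OF vB'] have lower: "lam * (\<mu> * u (x k) - v (y k)) + (\<mu> * G (x k) ((1 / \<mu>) *\<^sub>R p) - G (y k) p) + (1 - \<mu>) * a \<le> (\<integral>z. E z \<partial>\<nu>)"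
      unfolding Eval by (simp add: algebra_simps)
    have Eup: "E z \<le> min (K' * wt z) (\<omega> k * b z)" for z
    proof -
      define h where "h = j (x k) z - j (y k) z"
      have hn: "norm h \<le> C\<^sub>j * norm (w k) * norm z" using J1(3) by (simp add: h_def w_def)
      have Eeq: "E z = (\<mu> * u (x k + j (x k) z) - v (y k + j (y k) z)) - (\<mu> * u (x k) - v (y k)) - indicator (ball 0 1) z * (h \<bullet> p)"
        using \<mu> by (simp add: E_def incr_def h_def algebra_simps inner_diff_left)
      \<comment> \<open>Both points are displaced by their own jumps, so only the difference
        \<open>h\<close> of the jumps enters the penalty. In the unit ball its linear part cancels
        against the compensators.\<close>
      have E1: "E z \<le> h \<bullet> p + nn k / 2 * (norm h)\<^sup>2 - indicator (ball 0 1) z * (h \<bullet> p)"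
      proof -
        have eq: "x k + j (x k) z - (y k + j (y k) z) = w k + h" by (simp add: w_def h_def)
        have "\<mu> * u (x k + j (x k) z) - v (y k + j (y k) z) - \<theta> k (w k + h) \<le> \<mu> * u (x k) - v (y k) - \<theta> k (w k)"
          using xy[where k=k and x'="x k + j (x k) z" and y'="y k + j (y k) z"] unfolding eq w_def[symmetric] .
        then show ?thesis using quad[of h] unfolding Eeq by linarith
      qed
      have E2: "E z \<le> 4 * B - indicator (ball 0 1) z * (h \<bullet> p)"
      proof -
        have "\<bar>\<mu> * u x'\<bar> \<le> B" for x'
          using mult_mono[of "\<bar>\<mu>\<bar>" 1 "\<bar>u x'\<bar>" B] \<mu> uB[of x'] by (simp add: abs_mult)
        from this[of "x k"] this[of "x k + j (x k) z"] vB[of "y k"] vB[of "y k + j (y k) z"] show ?thesis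
          unfolding Eeq abs_le_iff by linarith
      qed
      have h2: "nn k / 2 * (norm h)\<^sup>2 \<le> \<omega> k * (C\<^sub>j\<^sup>2 * (norm z)\<^sup>2)"
      proof -
        have "(norm h)\<^sup>2 \<le> (C\<^sub>j * norm (w k) * norm z)\<^sup>2" using hn by (intro power_mono) auto
        then have "nn k / 2 * (norm h)\<^sup>2 \<le> nn k * (C\<^sub>j * norm (w k) * norm z)\<^sup>2"
          using nn(2)[of k] by (intro mult_mono) auto
        then show ?thesis by (simp add: \<omega>_def power_mult_distrib mult_ac)
      qed
      have hp: "h \<bullet> p \<le> \<omega> k * (C\<^sub>j * norm z)"
      proof -
        have "h \<bullet> p \<le> norm h * norm p" by (rule norm_cauchy_schwarz)
        also have "\<dots> \<le> (C\<^sub>j * norm (w k) * norm z) * (nn k * norm (w k))"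
          using hn nn(2)[of k] order_trans[OF norm_ge_zero hn] by (intro mult_mono) (auto simp: p_def)
        finally show ?thesis by (simp add: \<omega>_def power2_eq_square mult_ac)
      qed
      have nz: "0 \<le> \<omega> k * (C\<^sub>j * norm z)" using \<omega>0 J1(1) by simp
      show ?thesis
      proof (cases "norm z < 1")
        case True
        then have E3: "E z \<le> nn k / 2 * (norm h)\<^sup>2" using E1 by simp
        have "\<omega> k * (C\<^sub>j\<^sup>2 * (norm z)\<^sup>2) \<le> 1 * (C\<^sub>j\<^sup>2 * (norm z)\<^sup>2)" using \<omega>1 by (intro mult_right_mono) auto
        also have "\<dots> \<le> K' * wt z"
          unfolding K'_def wt_in_ball[OF True] mult_1 using B0 by (intro mult_right_mono) auto
        finally have "E z \<le> K' * wt z" using E3 h2 by linarith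
        moreover have "E z \<le> \<omega> k * b z" using E3 h2 nz unfolding b_def distrib_left by linarith
        ultimately show ?thesis by simp
      next
        case False
        then have wz: "wt z = 1" by (intro wt_outside_ball) simp
        have "E z \<le> 4 * B" using E2 False by simp
        then have "E z \<le> K' * wt z" unfolding wz K'_def by (simp add: add_increasing2)
        moreover have "E z \<le> \<omega> k * b z" using E1 False h2 hp unfolding b_def distrib_left by simp
        ultimately show ?thesis by simp
      qed
    qed
    have mint: "integrable \<nu> (\<lambda>z. min (K' * wt z) (\<omega> k * b z))"
    proof (rule Bochner_Integration.integrable_bound[of \<nu> "\<lambda>z. K' * wt z"])
      show "AE z in \<nu>. norm (min (K' * wt z) (\<omega> k * b z)) \<le> norm (K' * wt z)"
        using K'0 wt_nonneg b0 \<omega>0[of k] by (intro AE_I2) (auto simp: min_def)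
      show "(\<lambda>z. min (K' * wt z) (\<omega> k * b z)) \<in> borel_measurable \<nu>"
        using wt_measurable borel_measurable_nu[OF bm] by measurable
    qed (use integrable_wt in auto)
    have upper: "(\<integral>z. E z \<partial>\<nu>) \<le> (\<integral>z. min (K' * wt z) (\<omega> k * b z) \<partial>\<nu>)"
      by (intro integral_mono Eint mint Eup)
    define X where "X = norm p powr \<gamma>"
    have X: "X \<ge> 0" by (simp add: X_def)
    \<comment> \<open>The gain with ratio t = 1/\<mu>, multiplied by \<mu>.\<close>
    have g: "(1 - \<mu>) * (c\<^sub>1 * X - K) \<le> \<mu> * G (x k) ((1 / \<mu>) *\<^sub>R p) - G (x k) p"
    proof -
      have "(1 / \<mu> - 1) * (c\<^sub>1 * X - K) \<le> G (x k) ((1 / \<mu>) *\<^sub>R p) - 1 / \<mu> * G (x k) p"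
        unfolding X_def using \<mu> by (intro gain) (simp add: le_divide_eq)
      then have "\<mu> * ((1 / \<mu> - 1) * (c\<^sub>1 * X - K)) \<le> \<mu> * (G (x k) ((1 / \<mu>) *\<^sub>R p) - 1 / \<mu> * G (x k) p)"
        using \<mu> by (intro mult_left_mono) auto
      moreover have "\<mu> * ((1 / \<mu> - 1) * (c\<^sub>1 * X - K)) = (\<mu> * (1 / \<mu>) - \<mu>) * (c\<^sub>1 * X - K)" by (simp add: algebra_simps)
      moreover have "\<mu> * (G (x k) ((1 / \<mu>) *\<^sub>R p) - 1 / \<mu> * G (x k) p) = \<mu> * G (x k) ((1 / \<mu>) *\<^sub>R p) - (\<mu> * (1 / \<mu>)) * G (x k) p"
        by (simp add: algebra_simps)
      moreover have "\<mu> * (1 / \<mu>) = 1" using \<mu> by simp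
      ultimately show ?thesis by simp
    qed
    have "\<bar>G (x k) p - G (y k) p\<bar> \<le> \<alpha>\<^sub>1 * (X + 1) * norm (w k)" unfolding X_def w_def by (rule G3)
    also have "\<dots> = (\<alpha>\<^sub>1 * norm (w k)) * X + \<alpha>\<^sub>1 * norm (w k)" by (simp add: algebra_simps)
    \<comment> \<open>\<mu> is fixed while |w k| tends to 0, so the large factor |p|^\<gamma> in the
      error is dominated by the same factor in the gain.\<close>
    also have "\<dots> \<le> ((1 - \<mu>) * c\<^sub>1) * X + \<alpha>\<^sub>1 * norm (w k)" using w1 X by (intro add_right_mono mult_right_mono)
    finally have g3: "\<bar>G (x k) p - G (y k) p\<bar> \<le> (1 - \<mu>) * c\<^sub>1 * X + \<alpha>\<^sub>1 * norm (w k)" .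
    have "M k \<le> \<mu> * u (x k) - v (y k)" using nn(2)[of k] by (simp add: M_def \<theta>_def)
    then have "lam * s \<le> lam * (\<mu> * u (x k) - v (y k))" using Ms[of k] lam by (intro mult_left_mono) auto
    moreover have "(1 - \<mu>) * a \<ge> - ((1 - \<mu>) * \<bar>a\<bar>)"
    proof -
      have "(1 - \<mu>) * (- a) \<le> (1 - \<mu>) * \<bar>a\<bar>" using \<mu>(2) by (intro mult_left_mono) auto
      then show ?thesis by simp
    qed
    ultimately show ?thesis using lower upper g g3 small2
      unfolding right_diff_distrib distrib_left mult.assoc abs_le_iff by linarith
  qed
  have "(\<lambda>k. lam * s / 2 + \<alpha>\<^sub>1 * norm (w k) + (\<integral>z. min (K' * wt z) (\<omega> k * b z) \<partial>\<nu>)) \<longlonglongrightarrow> lam * s / 2 + \<alpha>\<^sub>1 * 0 + 0"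
    by (intro tendsto_intros wlim integral_min_wt_tendsto_0 \<omega>lim \<omega>0 K'0 bm b0)
  moreover have "\<forall>\<^sub>F k in sequentially. lam * s \<le> lam * s / 2 + \<alpha>\<^sub>1 * norm (w k) + (\<integral>z. min (K' * wt z) (\<omega> k * b z) \<partial>\<nu>)"
  proof -
    have "(\<lambda>k. \<alpha>\<^sub>1 * norm (w k)) \<longlonglongrightarrow> \<alpha>\<^sub>1 * 0" by (intro tendsto_intros wlim)
    then have "\<forall>\<^sub>F k in sequentially. \<alpha>\<^sub>1 * norm (w k) < (1 - \<mu>) * c\<^sub>1"
      using \<mu>(2) c\<^sub>1 by (intro order_tendstoD(2)[of "\<lambda>k. \<alpha>\<^sub>1 * norm (w k)" "\<alpha>\<^sub>1 * 0"]) auto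
    moreover have "\<forall>\<^sub>F k in sequentially. \<omega> k < 1" using \<omega>lim by (rule order_tendstoD(2)) simp
    ultimately show ?thesis by eventually_elim (rule est, auto)
  qed
  ultimately have "lam * s \<le> lam * s / 2 + \<alpha>\<^sub>1 * 0 + 0" by (rule tendsto_lowerbound) simp
  moreover have "lam * s > 0" using lam s by simp
  ultimately show False by linarith
qed

end

section \<open>Perron's method\<close>

text \<open>The infimum over shrinking balls of the supremum of \<open>f\<close>. The recovery
  sequence is the form in which the envelope is used: it transports near-optimal values of
  \<open>f\<close> to the envelope at x.\<close>

lemma usc_envelope:
  fixes f :: "real ^ 'd \<Rightarrow> real"
  assumes per: "Zd_periodic f" and B: "\<And>x. \<bar>f x\<bar> \<le> B"
  obtains g where "usc g" "Zd_periodic g" "\<And>x. f x \<le> g x" "\<And>x. \<bar>g x\<bar> \<le> B"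
    "\<And>x. \<exists>y. y \<longlonglongrightarrow> x \<and> (\<lambda>n. f (y n)) \<longlonglongrightarrow> g x"
proof (rule that)
  define b where "b x n = (SUP y\<in>ball x (1 / real (Suc n)). f y)" for x n
  define g where "g x = (INF n. b x n)" for x
  have xin: "x \<in> ball x (1 / real (Suc n))" for x :: "real ^ 'd" and n by simp
  have bdd: "bdd_above (f ` A)" for A using B by (intro bdd_aboveI2[of _ _ B]) (simp add: abs_le_iff)
  have fb: "f y \<le> b x n" if "y \<in> ball x (1 / real (Suc n))" for x y n
    unfolding b_def using that by (intro cSUP_upper bdd)
  have bB: "b x n \<le> B" for x n
    unfolding b_def using xin[of x n] B by (intro cSUP_least) (auto simp: abs_le_iff)
  have fbx: "f x \<le> b x n" for x n by (rule fb[OF xin])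
  have bddb: "bdd_below (range (b x))" for x using fbx by (intro bdd_belowI2[of _ "f x"])
  show fg: "f x \<le> g x" for x unfolding g_def using fbx by (intro cINF_greatest) auto
  have gb: "g x \<le> b x n" for x n unfolding g_def by (intro cINF_lower bddb) auto
  show "\<bar>g x\<bar> \<le> B" for x
    using fg[of x] gb[of x 0] bB[of x 0] B[of x] by (simp add: abs_le_iff)
  show usc: "usc g" unfolding usc_iff_eventually
  proof (intro allI impI)
    fix x c assume "g x < c"
    then obtain n where n: "b x n < c" unfolding g_def using cINF_less_iff[OF _ bddb] by auto
    define r where "r = 1 / real (Suc n)"
    have r: "r > 0" by (simp add: r_def)
    then obtain m where m: "inverse (real (Suc m)) < r / 2" using reals_Archimedean[of "r/2"] by auto
    show "\<forall>\<^sub>F y in nhds x. g y < c"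
      unfolding eventually_nhds_metric
    proof (intro exI conjI allI impI)
      show "r / 2 > 0" using r by simp
      fix y assume y: "dist y x < r / 2"
      have "b y m \<le> b x n"
        unfolding b_def[of y m]
      proof (rule cSUP_least)
        fix z assume z: "z \<in> ball y (1 / real (Suc m))"
        have "dist x z \<le> dist y x + dist y z" by (metis dist_commute dist_triangle)
        then have "z \<in> ball x (1 / real (Suc n))" using z y m unfolding r_def inverse_eq_divide mem_ball by linarith
        then show "f z \<le> b x n" by (rule fb)
      qed (use xin[of y m] in blast)
      with gb[of y m] n show "g y < c" by linarith
    qed
  qed
  show "Zd_periodic g"
  proof -
    have le: "b (x + k) n \<le> b x n" if k: "\<And>i. k $ i \<in> \<int>" for x k n
      unfolding b_def[of "x + k" n]
    proof (rule cSUP_least)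
      fix z assume "z \<in> ball (x + k) (1 / real (Suc n))"
      then have "z - k \<in> ball x (1 / real (Suc n))" by (simp add: dist_norm algebra_simps)
      then have "f (z - k) \<le> b x n" by (rule fb)
      then show "f z \<le> b x n" using Zd_periodic_neg[OF per k] by simp
    qed (use xin[of "x + k" n] in blast)
    have "b (x + k) n = b x n" if k: "\<forall>i. k $ i \<in> \<int>" for x k n
      using le[of k x n] le[of "- k" "x + k" n] k by simp
    then show ?thesis by (simp add: Zd_periodic_def g_def)
  qed
  show "\<exists>y. y \<longlonglongrightarrow> x \<and> (\<lambda>n. f (y n)) \<longlonglongrightarrow> g x" for x
  proof -
    have "\<exists>y\<in>ball x (1 / real (Suc n)). g x - 1 / real (Suc n) < f y" for n
    proof -
      have "1 / real (Suc n) > 0" by simp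
      then have "g x - 1 / real (Suc n) < b x n" using gb[of x n] by linarith
      then show ?thesis unfolding b_def using less_cSUP_iff[OF _ bdd] xin[of x n] by blast
    qed
    then obtain y where y: "\<And>n. y n \<in> ball x (1 / real (Suc n))" "\<And>n. g x - 1 / real (Suc n) < f (y n)" by metis
    have lim: "y \<longlonglongrightarrow> x"
    proof (rule metric_tendsto_imp_tendsto)
      show "(\<lambda>n. 1 / real (Suc n)) \<longlonglongrightarrow> 0" by (rule LIMSEQ_Suc[OF lim_1_over_n])
      show "\<forall>\<^sub>F n in sequentially. dist (y n) x \<le> dist (1 / real (Suc n)) 0"
        using y(1) by (intro always_eventually allI) (auto simp: dist_commute less_imp_le)
    qed
    \<comment> \<open>The choice of \<open>y n\<close> gives the lower bound; the upper one is
      semicontinuity of the envelope itself, which lies above \<open>f\<close>.\<close>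
    have "(\<lambda>n. f (y n)) \<longlonglongrightarrow> g x"
    proof (rule order_tendstoI)
      fix c assume "g x < c"
      then have "\<forall>\<^sub>F n in sequentially. g (y n) < c" by (rule usc_sequence[OF usc lim])
      then show "\<forall>\<^sub>F n in sequentially. f (y n) < c" by eventually_elim (use fg le_less_trans in blast)
    next
      fix c assume "c < g x"
      have "(\<lambda>n. g x - 1 / real (Suc n)) \<longlonglongrightarrow> g x - 0"
        by (intro tendsto_diff tendsto_const LIMSEQ_Suc[OF lim_1_over_n])
      then have "\<forall>\<^sub>F n in sequentially. c < g x - 1 / real (Suc n)" using \<open>c < g x\<close> by (intro order_tendstoD(1)) auto
      then show "\<forall>\<^sub>F n in sequentially. c < f (y n)" by eventually_elim (use y(2) less_trans in blast)
    qed
    with lim show ?thesis by blast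
  qed
qed

section \<open>Gradients and the operator on test functions\<close>

lemma grad_add: "C2_torus f \<Longrightarrow> C2_torus g \<Longrightarrow> grad (\<lambda>x. f x + g x) x = grad f x + grad g x"
  by (rule grad_eq) (intro GDERIV_add C2_torus_grad(1))

lemma grad_const: "grad (\<lambda>x. c) x = 0"
  by (rule grad_eq) (rule GDERIV_const)

lemma grad_cmult: "C2_torus f \<Longrightarrow> grad (\<lambda>x. c * f x) x = c *\<^sub>R grad f x"
  using grad_eq[OF GDERIV_mult[OF GDERIV_const C2_torus_grad(1), of f c x]] by simp

lemma grad_at_max:
  assumes "GDERIV f x :> p" "\<And>y. f y \<le> f x"
  shows "p = 0"
proof -
  have "(\<lambda>h. h \<bullet> p) = (\<lambda>v. 0)"
    by (rule differential_zero_maxmin[of x UNIV f "\<lambda>h. h \<bullet> p"]) (use assms in \<open>auto simp: gderiv_def\<close>)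
  then have "p \<bullet> p = 0" by metis
  then show ?thesis by simp
qed

lemma C2_touching_grad_eq:
  assumes f: "C2_torus f" and g: "C2_torus g" and le: "\<And>y. f y - g y \<le> f x - g x"
  shows "grad f x = grad g x"
  using grad_at_max[of "\<lambda>y. f y - g y" x "grad f x - grad g x"] GDERIV_diff[OF C2_torus_grad(1)[OF f] C2_torus_grad(1)[OF g]] le
  by simp

lemma lattice_dist2_self: "lattice_dist2 x x = 0"
  by (simp add: lattice_dist2_def)

lemma grad_lattice_dist2: "grad (lattice_dist2 x) x = 0"
proof (rule grad_eq)
  show "GDERIV (lattice_dist2 x) x :> 0"
    by (rule GDERIV_quadratic[of _ _ _ 16]) (use lattice_dist2_le in \<open>simp add: lattice_dist2_self abs_of_nonneg[OF lattice_dist2_nonneg]\<close>)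
qed

context levy_kernel
begin

lemma nonlocal_op_add:
  assumes "C2_torus f" "C2_torus g"
  shows "nonlocal_op \<nu> j (\<lambda>x. f x + g x) x = nonlocal_op \<nu> j f x + nonlocal_op \<nu> j g x"
proof -
  have "incr j (\<lambda>x. f x + g x) x (grad f x + grad g x) z = incr j f x (grad f x) z + incr j g x (grad g x) z" for z
    by (simp add: incr_def inner_add_right algebra_simps)
  then show ?thesis using integrable_incr_C2[OF assms(1), of x] integrable_incr_C2[OF assms(2), of x]
    by (simp add: nonlocal_op_incr grad_add[OF assms])
qed

lemma nonlocal_op_cmult:
  assumes "C2_torus f"
  shows "nonlocal_op \<nu> j (\<lambda>x. c * f x) x = c * nonlocal_op \<nu> j f x"
proof -
  have "incr j (\<lambda>x. c * f x) x (c *\<^sub>R grad f x) z = c * incr j f x (grad f x) z" for z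
    by (simp add: incr_def algebra_simps)
  then show ?thesis by (simp add: nonlocal_op_incr grad_cmult[OF assms])
qed

lemma nonlocal_op_const: "nonlocal_op \<nu> j (\<lambda>x. c) x = 0"
  by (simp add: nonlocal_op_incr grad_const incr_def)

text \<open>At a touching point the gradients agree, so the compensators cancel and the integrands
  are ordered for every jump.\<close>

lemma nonlocal_op_mono_touching:
  assumes f: "C2_torus f" and g: "C2_torus g" and le: "\<And>y. f y - g y \<le> f x - g x"
  shows "nonlocal_op \<nu> j f x \<le> nonlocal_op \<nu> j g x"
proof -
  have eq: "grad f x = grad g x" using f g le by (rule C2_touching_grad_eq)
  have "incr j f x (grad f x) z \<le> incr j g x (grad g x) z" for z
    using le[of "x + j x z"] by (simp add: incr_def eq)
  then show ?thesis unfolding nonlocal_op_incr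
    by (intro integral_mono integrable_incr_C2 f g)
qed

lemma nonlocal_op_periodic:
  assumes "C2_torus \<phi>"
  shows "Zd_periodic (nonlocal_op \<nu> j \<phi>)"
  unfolding Zd_periodic_def
proof safe
  fix x k :: "real ^ 'd" assume k: "\<forall>i. k $ i \<in> \<int>"
  have \<phi>: "\<phi> (y + k) = \<phi> y" for y using Zd_periodicD[OF C2_torus_grad(4)[OF assms]] k by blast
  have g: "grad \<phi> (x + k) = grad \<phi> x" using Zd_periodicD[OF C2_grad_periodic[OF assms]] k by blast
  have jk: "j (x + k) = j x" using Zd_periodicD[OF j_periodic] k by blast
  have "x + k + j x z = x + j x z + k" for z by simp
  then show "nonlocal_op \<nu> j \<phi> (x + k) = nonlocal_op \<nu> j \<phi> x"
    by (simp only: nonlocal_op_incr incr_def g jk \<phi>)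
qed

text \<open>Stability under suprema: family members that are nearly optimal along a recovery
  sequence have maxima against the perturbed test function near xh, and their inequalities pass to
  the limit by continuity of \<open>F\<close> and of the operator on smooth functions.\<close>

lemma usc_subsolution_Sup:
  assumes S: "\<And>u. u \<in> S \<Longrightarrow> visc_usc_subsolution \<nu> j lam F a u"
    and F: "\<And>x p x' p'. x \<longlonglongrightarrow> x' \<Longrightarrow> p \<longlonglongrightarrow> p' \<Longrightarrow> (\<lambda>n. F (x n) (p n)) \<longlonglongrightarrow> F x' p'"
    and W: "\<And>u x. u \<in> S \<Longrightarrow> u x \<le> W x" "\<And>x e. e > 0 \<Longrightarrow> \<exists>u\<in>S. W x - e < u x"
    and g: "usc g" "Zd_periodic g" "\<And>x. W x \<le> g x" "\<And>x. \<exists>y. y \<longlonglongrightarrow> x \<and> (\<lambda>n. W (y n)) \<longlonglongrightarrow> g x"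
  shows "visc_usc_subsolution \<nu> j lam F a g"
  unfolding visc_usc_subsolution_def
proof (intro conjI allI impI; (elim conjE)?)
  fix \<phi> xh assume \<phi>: "C2_torus \<phi>" and max: "\<forall>x. g x - \<phi> x \<le> g xh - \<phi> xh"
  define Q where "Q = lattice_dist2 xh"
  have Q: "C2_torus Q" unfolding Q_def by (rule C2_torus_lattice_dist2)
  have main: "lam * g xh - (nonlocal_op \<nu> j \<phi> xh + \<eta> * nonlocal_op \<nu> j Q xh) + F xh (grad \<phi> xh) \<le> a"
    if \<eta>: "\<eta> > 0" for \<eta>
  proof -
    \<comment> \<open>The perturbation makes the maximum at xh strict modulo the lattice, which
      forces the nearby maximizers to converge. It does not change the gradient at xh, and its
      effect on the operator is linear in \<eta>.\<close>
    define \<psi> where "\<psi> x = \<phi> x + \<eta> * Q x" for x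
    have \<psi>: "C2_torus \<psi>" unfolding \<psi>_def by (intro C2_torus_add C2_torus_cmult \<phi> Q)
    have g\<psi>: "grad \<psi> xh = grad \<phi> xh"
      unfolding \<psi>_def by (simp only: grad_add[OF \<phi> C2_torus_cmult[OF Q]] grad_cmult[OF Q]) (simp add: Q_def grad_lattice_dist2)
    have I\<psi>: "nonlocal_op \<nu> j \<psi> xh = nonlocal_op \<nu> j \<phi> xh + \<eta> * nonlocal_op \<nu> j Q xh"
      unfolding \<psi>_def by (simp only: nonlocal_op_add[OF \<phi> C2_torus_cmult[OF Q]] nonlocal_op_cmult[OF Q])
    obtain y where y: "y \<longlonglongrightarrow> xh" "(\<lambda>n. W (y n)) \<longlonglongrightarrow> g xh" using g(4) by blast
    have "\<exists>u\<in>S. W (y n) - 1 / real (Suc n) < u (y n)" for n by (rule W(2)) simp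
    then obtain u where u: "\<And>n. u n \<in> S" "\<And>n. W (y n) - 1 / real (Suc n) < u n (y n)" by metis
    have su: "visc_usc_subsolution \<nu> j lam F a (u n)" for n using S u by blast
    have "\<exists>x. (\<forall>z. u n z - \<psi> z \<le> u n x - \<psi> x) \<and> (norm (x - xh))\<^sup>2 \<le> Q x" for n
    proof -
      have us: "usc (u n)" "Zd_periodic (u n)" using su[of n] by (auto simp: visc_usc_subsolution_def)
      have "usc (\<lambda>z. u n z - \<psi> z)" by (intro usc_diff_continuous us C2_torus_grad(3) \<psi>)
      moreover have per: "Zd_periodic (\<lambda>z. u n z - \<psi> z)" by (rule Zd_periodic_comp2[OF us(2) C2_torus_grad(4)[OF \<psi>]])
      ultimately obtain x where x: "\<And>z. u n z - \<psi> z \<le> u n x - \<psi> x"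
        by (rule usc_periodic_attains_sup) blast
      \<comment> \<open>A maximizer is determined only up to lattice translation; the representative
        close to xh is taken.\<close>
      obtain k where k: "\<And>i. k $ i \<in> \<int>" "(norm (x + k - xh))\<^sup>2 \<le> lattice_dist2 xh x"
        by (rule lattice_representative_near[of x xh]) blast
      have "u n (x + k) - \<psi> (x + k) = u n x - \<psi> x" by (rule Zd_periodicD[OF per k(1)])
      moreover have "Q (x + k) = Q x" by (rule Zd_periodicD[OF C2_torus_grad(4)[OF Q] k(1)])
      ultimately show ?thesis using x k(2) by (intro exI[of _ "x + k"]) (simp add: Q_def)
    qed
    then obtain x where x: "\<And>n z. u n z - \<psi> z \<le> u n (x n) - \<psi> (x n)" "\<And>n. (norm (x n - xh))\<^sup>2 \<le> Q (x n)" by metis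
    have ineq: "lam * u n (x n) - nonlocal_op \<nu> j \<psi> (x n) + F (x n) (grad \<psi> (x n)) \<le> a" for n
      using su[of n] \<psi> x(1) unfolding visc_usc_subsolution_def by blast
    define m where "m = g xh - \<phi> xh"
    define low where "low n = W (y n) - 1 / real (Suc n) - \<psi> (y n)" for n
    have cont\<psi>: "isCont \<psi> z" "isCont (grad \<psi>) z" for z
      using C2_torus_grad[OF \<psi>] by (auto simp: continuous_on_eq_continuous_at)
    have "low \<longlonglongrightarrow> g xh - 0 - \<psi> xh"
      unfolding low_def by (intro tendsto_diff y(2) LIMSEQ_Suc[OF lim_1_over_n] isCont_tendsto_compose[OF cont\<psi>(1) y(1)])
    then have low: "low \<longlonglongrightarrow> m" by (simp add: m_def \<psi>_def Q_def lattice_dist2_self)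
    have lowle: "low n \<le> u n (x n) - \<psi> (x n)" for n
      using x(1)[where n=n and z="y n"] u(2)[of n] by (simp add: low_def)
    \<comment> \<open>Together with \<open>lowle\<close> this squeezes \<eta> Q (x n) below m - low
      n, which tends to 0, and also identifies the limit of the values.\<close>
    have uple: "u n (x n) - \<psi> (x n) \<le> m - \<eta> * Q (x n)" for n
      using W(1)[OF u(1), of n "x n"] g(3)[of "x n"] spec[OF max, of "x n"] by (simp add: m_def \<psi>_def)
    have Q0: "Q z \<ge> 0" for z by (simp add: Q_def lattice_dist2_nonneg)
    have "(\<lambda>n. Q (x n)) \<longlonglongrightarrow> 0"
    proof (rule tendsto_sandwich[of "\<lambda>_. 0" _ _ "\<lambda>n. (m - low n) / \<eta>"])
      have "(\<lambda>n. (m - low n) / \<eta>) \<longlonglongrightarrow> (m - m) / \<eta>" by (intro tendsto_intros low) (use \<eta> in auto)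
      then show "(\<lambda>n. (m - low n) / \<eta>) \<longlonglongrightarrow> 0" by simp
      have "Q (x n) \<le> (m - low n) / \<eta>" for n
        using lowle[of n] uple[of n] \<eta> by (simp add: pos_le_divide_eq mult.commute)
      then show "\<forall>\<^sub>F n in sequentially. Q (x n) \<le> (m - low n) / \<eta>" by simp
    qed (use Q0 in auto)
    have "(\<lambda>n. (norm (x n - xh))\<^sup>2) \<longlonglongrightarrow> 0"
      by (rule tendsto_sandwich[of "\<lambda>_. 0" _ _ "\<lambda>n. Q (x n)"]) (use x(2) \<open>(\<lambda>n. Q (x n)) \<longlonglongrightarrow> 0\<close> in auto)
    then have "(\<lambda>n. sqrt ((norm (x n - xh))\<^sup>2)) \<longlonglongrightarrow> sqrt 0" by (intro tendsto_real_sqrt)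
    then have "(\<lambda>n. norm (x n - xh)) \<longlonglongrightarrow> 0" by simp
    then have xlim: "x \<longlonglongrightarrow> xh" by (metis LIM_zero_cancel tendsto_norm_zero_iff)
    have "(\<lambda>n. u n (x n) - \<psi> (x n)) \<longlonglongrightarrow> m"
    proof (rule tendsto_sandwich[of low _ _ "\<lambda>_. m"])
      have "u n (x n) - \<psi> (x n) \<le> m" for n using uple[of n] mult_nonneg_nonneg[OF less_imp_le[OF \<eta>] Q0[of "x n"]] by linarith
      then show "\<forall>\<^sub>F n in sequentially. u n (x n) - \<psi> (x n) \<le> m" by simp
    qed (use lowle low in auto)
    then have "(\<lambda>n. (u n (x n) - \<psi> (x n)) + \<psi> (x n)) \<longlonglongrightarrow> m + \<psi> xh"
      by (intro tendsto_add isCont_tendsto_compose[OF cont\<psi>(1) xlim])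
    then have ulim: "(\<lambda>n. u n (x n)) \<longlonglongrightarrow> g xh" by (simp add: m_def \<psi>_def Q_def lattice_dist2_self)
    have "(\<lambda>n. lam * u n (x n) - nonlocal_op \<nu> j \<psi> (x n) + F (x n) (grad \<psi> (x n))) \<longlonglongrightarrow>
        lam * g xh - nonlocal_op \<nu> j \<psi> xh + F xh (grad \<psi> xh)"
      by (intro tendsto_add tendsto_diff tendsto_mult tendsto_const ulim nonlocal_op_tendsto[OF \<psi> xlim]
          F xlim isCont_tendsto_compose[OF cont\<psi>(2) xlim])
    then have "lam * g xh - nonlocal_op \<nu> j \<psi> xh + F xh (grad \<psi> xh) \<le> a"
      by (rule LIMSEQ_le_const2) (use ineq in auto)
    then show ?thesis by (simp add: g\<psi> I\<psi>)
  qed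
  have "((\<lambda>\<eta>. lam * g xh - (nonlocal_op \<nu> j \<phi> xh + \<eta> * nonlocal_op \<nu> j Q xh) + F xh (grad \<phi> xh)) \<longlongrightarrow>
     lam * g xh - (nonlocal_op \<nu> j \<phi> xh + 0 * nonlocal_op \<nu> j Q xh) + F xh (grad \<phi> xh)) (at_right 0)"
    by (intro tendsto_intros)
  then have "lam * g xh - (nonlocal_op \<nu> j \<phi> xh + 0 * nonlocal_op \<nu> j Q xh) + F xh (grad \<phi> xh) \<le> a"
    by (rule tendsto_upperbound) (use main in \<open>auto simp: eventually_at_right_less eventually_at_filter\<close>)
  then show "lam * g xh - nonlocal_op \<nu> j \<phi> xh + F xh (grad \<phi> xh) \<le> a" by simp
qed (use g in auto)

text \<open>Perron's bump: where the lower envelope \<open>V\<close> fails to be a supersolution, \<open>max W (\<psi> + \<kappa>)\<close>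
  is again a subsolution. No localization is needed, because test functions are global.\<close>

lemma perron_bump:
  assumes W: "visc_usc_subsolution \<nu> j lam F a W"
    and F: "\<And>x p x' p'. x \<longlonglongrightarrow> x' \<Longrightarrow> p \<longlonglongrightarrow> p' \<Longrightarrow> (\<lambda>n. F (x n) (p n)) \<longlonglongrightarrow> F x' p'" and Fper: "Zd_periodic F"
    and V: "\<And>x. V x \<le> W x" "\<And>x. \<exists>y. y \<longlonglongrightarrow> x \<and> (\<lambda>n. W (y n)) \<longlonglongrightarrow> V x"
    and \<phi>: "C2_torus \<phi>" and touch: "\<And>x. \<phi> x \<le> V x" "\<phi> xh = V xh"
    and fail: "lam * \<phi> xh - nonlocal_op \<nu> j \<phi> xh + F xh (grad \<phi> xh) < a"
  shows "\<exists>U. visc_usc_subsolution \<nu> j lam F a U \<and> (\<forall>x. W x \<le> U x) \<and> (\<exists>x. W x < U x)"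
proof -
  define Q where "Q = lattice_dist2 xh"
  have Q: "C2_torus Q" unfolding Q_def by (rule C2_torus_lattice_dist2)
  have Qx: "Q xh = 0" "Q z \<ge> 0" for z by (auto simp: Q_def lattice_dist2_self lattice_dist2_nonneg)
  have "((\<lambda>\<eta>. lam * \<phi> xh - (nonlocal_op \<nu> j \<phi> xh + (- \<eta>) * nonlocal_op \<nu> j Q xh) + F xh (grad \<phi> xh)) \<longlongrightarrow>
     lam * \<phi> xh - (nonlocal_op \<nu> j \<phi> xh + (- 0) * nonlocal_op \<nu> j Q xh) + F xh (grad \<phi> xh)) (at_right 0)"
    by (intro tendsto_intros)
  then have "\<forall>\<^sub>F \<eta> in at_right 0. lam * \<phi> xh - (nonlocal_op \<nu> j \<phi> xh + (- \<eta>) * nonlocal_op \<nu> j Q xh) + F xh (grad \<phi> xh) < a"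
    by (rule order_tendstoD(2)) (use fail in simp)
  moreover have "\<forall>\<^sub>F \<eta> in at_right (0::real). 0 < \<eta>" by (rule eventually_at_right_less)
  ultimately have "\<forall>\<^sub>F \<eta> in at_right 0. 0 < \<eta> \<and> lam * \<phi> xh - (nonlocal_op \<nu> j \<phi> xh + (- \<eta>) * nonlocal_op \<nu> j Q xh) + F xh (grad \<phi> xh) < a"
    by eventually_elim simp
  then obtain \<eta> where \<eta>: "\<eta> > 0" "lam * \<phi> xh - (nonlocal_op \<nu> j \<phi> xh + (- \<eta>) * nonlocal_op \<nu> j Q xh) + F xh (grad \<phi> xh) < a"
    using eventually_happens'[of "at_right (0::real)"] trivial_limit_at_right_real by blast
  \<comment> \<open>Lowering \<phi> away from xh makes the contact from below strict modulo the
    lattice, and \<eta> is small enough to keep the strict failure of the supersolution inequality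
    at xh.\<close>
  define \<psi> where "\<psi> x = \<phi> x + (- \<eta>) * Q x" for x
  have \<psi>: "C2_torus \<psi>" unfolding \<psi>_def by (intro C2_torus_add C2_torus_cmult \<phi> Q)
  have g\<psi>: "grad \<psi> xh = grad \<phi> xh"
    unfolding \<psi>_def by (simp only: grad_add[OF \<phi> C2_torus_cmult[OF Q]] grad_cmult[OF Q]) (simp add: Q_def grad_lattice_dist2)
  have I\<psi>: "nonlocal_op \<nu> j \<psi> xh = nonlocal_op \<nu> j \<phi> xh + (- \<eta>) * nonlocal_op \<nu> j Q xh"
    unfolding \<psi>_def by (simp only: nonlocal_op_add[OF \<phi> C2_torus_cmult[OF Q]] nonlocal_op_cmult[OF Q])
  define H where "H x = lam * \<psi> x - nonlocal_op \<nu> j \<psi> x + F x (grad \<psi> x)" for x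
  have Hxh: "H xh < a" using \<eta>(2) by (simp add: H_def g\<psi> I\<psi>) (simp add: \<psi>_def Qx)
  have Hper: "Zd_periodic H"
    using C2_torus_grad(4)[OF \<psi>] nonlocal_op_periodic[OF \<psi>] C2_grad_periodic[OF \<psi>] Fper
    unfolding Zd_periodic_def H_def by simp
  have cont\<psi>: "isCont \<psi> z" "isCont (grad \<psi>) z" for z
    using C2_torus_grad[OF \<psi>] by (auto simp: continuous_on_eq_continuous_at)
  have "isCont H xh"
    unfolding continuous_at_sequentially o_def
  proof (intro allI impI)
    fix x :: "nat \<Rightarrow> real ^ 'd" assume x: "x \<longlonglongrightarrow> xh"
    show "(\<lambda>n. H (x n)) \<longlonglongrightarrow> H xh"
      unfolding H_def
      by (intro tendsto_add tendsto_diff tendsto_mult tendsto_const nonlocal_op_tendsto[OF \<psi> x]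
          F x isCont_tendsto_compose[OF cont\<psi>(2) x] isCont_tendsto_compose[OF cont\<psi>(1) x])
  qed
  define e where "e = (a - H xh) / 2"
  have e: "e > 0" using Hxh by (simp add: e_def)
  obtain r where r: "r > 0" "\<And>z. dist z xh < r \<Longrightarrow> dist (H z) (H xh) < e"
    using \<open>isCont H xh\<close> e unfolding continuous_at_eps_delta by blast
  \<comment> \<open>Since \<psi> + \<eta> Q = \<phi> <= V <= W, the lifted function can exceed
    \<open>W\<close> only where Q < r^2, that is within r of the lattice through xh. The second
    bound keeps lam \<kappa> within the slack \<open>e\<close>.\<close>
  define \<kappa> where "\<kappa> = min (\<eta> * r\<^sup>2) (e / (\<bar>lam\<bar> + 1))"
  have \<kappa>: "\<kappa> > 0" "\<kappa> \<le> \<eta> * r\<^sup>2" using \<eta> r e by (auto simp: \<kappa>_def)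
  have lam\<kappa>: "lam * \<kappa> \<le> e"
  proof -
    have "lam * \<kappa> \<le> (\<bar>lam\<bar> + 1) * (e / (\<bar>lam\<bar> + 1))" using \<kappa>(1) e by (intro mult_mono) (auto simp: \<kappa>_def)
    then show ?thesis by simp
  qed
  define U where "U x = max (W x) (\<psi> x + \<kappa>)" for x
  have Wus: "usc W" "Zd_periodic W" using W by (auto simp: visc_usc_subsolution_def)
  have "visc_usc_subsolution \<nu> j lam F a U"
    unfolding visc_usc_subsolution_def
  proof (intro conjI allI impI; (elim conjE)?)
    show "Zd_periodic U" unfolding U_def using Wus(2) C2_torus_grad(4)[OF \<psi>] by (simp add: Zd_periodic_def)
    show "usc U" unfolding U_def
      by (intro usc_max Wus continuous_usc continuous_intros C2_torus_grad(3) \<psi>)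
    fix \<xi> x\<^sub>1 assume \<xi>: "C2_torus \<xi>" and max: "\<forall>x. U x - \<xi> x \<le> U x\<^sub>1 - \<xi> x\<^sub>1"
    show "lam * U x\<^sub>1 - nonlocal_op \<nu> j \<xi> x\<^sub>1 + F x\<^sub>1 (grad \<xi> x\<^sub>1) \<le> a"
    proof (cases "U x\<^sub>1 = W x\<^sub>1")
      case True
      have "W x - \<xi> x \<le> W x\<^sub>1 - \<xi> x\<^sub>1" for x
        using spec[OF max, of x] True by (simp add: U_def)
      then show ?thesis using W \<xi> True unfolding visc_usc_subsolution_def by metis
    next
      case False
      then have U1: "U x\<^sub>1 = \<psi> x\<^sub>1 + \<kappa>" "W x\<^sub>1 < \<psi> x\<^sub>1 + \<kappa>" by (auto simp: U_def max_def split: if_splits)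
      have "\<psi> x\<^sub>1 + \<eta> * Q x\<^sub>1 \<le> W x\<^sub>1" using touch(1)[of x\<^sub>1] V(1)[of x\<^sub>1] by (simp add: \<psi>_def)
      then have "\<eta> * Q x\<^sub>1 < \<eta> * r\<^sup>2" using U1(2) \<kappa>(2) by linarith
      then have Qr: "Q x\<^sub>1 < r\<^sup>2" using \<eta>(1) by simp
      obtain k where k: "\<And>i. k $ i \<in> \<int>" "(norm (x\<^sub>1 + k - xh))\<^sup>2 \<le> lattice_dist2 xh x\<^sub>1"
        by (rule lattice_representative_near[of x\<^sub>1 xh]) blast
      have "(norm (x\<^sub>1 + k - xh))\<^sup>2 < r\<^sup>2" using k(2) Qr by (simp add: Q_def)
      then have "norm (x\<^sub>1 + k - xh) < r" using r(1) by (simp add: power2_less_imp_less)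
      then have "dist (H (x\<^sub>1 + k)) (H xh) < e" by (intro r(2)) (simp add: dist_norm)
      then have "H (x\<^sub>1 + k) < H xh + e" unfolding dist_real_def by linarith
      also have "H (x\<^sub>1 + k) = H x\<^sub>1" by (rule Zd_periodicD[OF Hper k(1)])
      finally have H1: "H x\<^sub>1 + e < a" by (simp add: e_def field_simps)
      \<comment> \<open>Here the test function touches the smooth \<psi> + \<kappa> from above, so
        gradient and operator are compared with those of \<psi>, for which the strict inequality
        holds near the lattice.\<close>
      have le: "\<psi> y - \<xi> y \<le> \<psi> x\<^sub>1 - \<xi> x\<^sub>1" for y
        using spec[OF max, of y] U1 by (simp add: U_def)
      have "lam * U x\<^sub>1 - nonlocal_op \<nu> j \<xi> x\<^sub>1 + F x\<^sub>1 (grad \<xi> x\<^sub>1) \<le>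
          lam * (\<psi> x\<^sub>1 + \<kappa>) - nonlocal_op \<nu> j \<psi> x\<^sub>1 + F x\<^sub>1 (grad \<psi> x\<^sub>1)"
        using nonlocal_op_mono_touching[OF \<psi> \<xi> le] C2_touching_grad_eq[OF \<psi> \<xi> le] U1 by simp
      also have "\<dots> = H x\<^sub>1 + lam * \<kappa>" by (simp add: H_def algebra_simps)
      finally show ?thesis using H1 lam\<kappa> by linarith
    qed
  qed
  moreover have "\<exists>x. W x < U x"
  proof -
    \<comment> \<open>At xh the lift exceeds \<open>V\<close>, not necessarily \<open>W\<close>.
      Along a recovery sequence \<open>W\<close> approaches \<open>V xh\<close>, and there the
      increase is strict.\<close>
    obtain y where y: "y \<longlonglongrightarrow> xh" "(\<lambda>n. W (y n)) \<longlonglongrightarrow> V xh" using V(2) by blast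
    have "(\<lambda>n. \<psi> (y n) + \<kappa> - W (y n)) \<longlonglongrightarrow> \<psi> xh + \<kappa> - V xh"
      by (intro tendsto_intros y isCont_tendsto_compose[OF cont\<psi>(1)])
    then have "\<forall>\<^sub>F n in sequentially. 0 < \<psi> (y n) + \<kappa> - W (y n)"
      by (rule order_tendstoD(1)) (use \<kappa> touch(2) in \<open>simp add: \<psi>_def Qx\<close>)
    then obtain n where "0 < \<psi> (y n) + \<kappa> - W (y n)" by (auto simp: eventually_sequentially)
    then show ?thesis by (intro exI[of _ "y n"]) (simp add: U_def)
  qed
  moreover have "W x \<le> U x" for x by (simp add: U_def)
  ultimately show ?thesis by blast
qed

end

lemma usc_imp_continuous:
  fixes f :: "'a::t2_space \<Rightarrow> real"
  assumes "usc f" "usc (\<lambda>x. - f x)"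
  shows "continuous_on UNIV f"
  unfolding continuous_on_eq_continuous_at[OF open_UNIV]
proof
  fix x
  have "(f \<longlongrightarrow> f x) (nhds x)"
  proof (rule order_tendstoI)
    fix c assume "f x < c"
    then show "\<forall>\<^sub>F y in nhds x. f y < c" using assms(1) unfolding usc_iff_eventually by blast
  next
    fix c assume "c < f x"
    then have "\<forall>\<^sub>F y in nhds x. - f y < - c" using assms(2) unfolding usc_iff_eventually by (metis neg_less_iff_less)
    then show "\<forall>\<^sub>F y in nhds x. c < f y" by simp
  qed
  then show "isCont f x" unfolding isCont_def by (rule tendsto_mono[OF at_within_le_nhds])
qed

section \<open>Existence for positive \<open>lam\<close>\<close>

context superlinear_hamiltonian
begin

lemma G_tendsto:
  assumes x: "x \<longlonglongrightarrow> x'" and p: "p \<longlonglongrightarrow> p'"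
  shows "(\<lambda>n. G (x n) (p n)) \<longlonglongrightarrow> G x' p'"
proof (rule metric_tendsto_imp_tendsto)
  define r where "r n = \<alpha>\<^sub>1 * (norm (p n) + norm p' + 1) powr (\<gamma> - 1) * norm (p n - p') +
    \<alpha>\<^sub>1 * (norm p' powr \<gamma> + 1) * norm (x n - x')" for n
  have "norm p' + norm p' + 1 \<noteq> 0" using norm_ge_zero[of p'] by linarith
  then have "r \<longlonglongrightarrow> \<alpha>\<^sub>1 * (norm p' + norm p' + 1) powr (\<gamma> - 1) * norm (p' - p') + \<alpha>\<^sub>1 * (norm p' powr \<gamma> + 1) * norm (x' - x')"
    unfolding r_def by (intro tendsto_add tendsto_mult tendsto_powr tendsto_norm tendsto_diff tendsto_const x p)
  then show "r \<longlonglongrightarrow> 0" by simp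
  have "dist (G (x n) (p n)) (G x' p') \<le> dist (r n) 0" for n
  proof -
    have "\<bar>G (x n) (p n) - G x' p'\<bar> \<le> \<bar>G (x n) (p n) - G (x n) p'\<bar> + \<bar>G (x n) p' - G x' p'\<bar>" by linarith
    also have "\<dots> \<le> r n" unfolding r_def by (intro add_mono G2 G3)
    finally show ?thesis by (simp add: dist_real_def)
  qed
  then show "\<forall>\<^sub>F n in sequentially. dist (G (x n) (p n)) (G x' p') \<le> dist (r n) 0" by simp
qed

lemma G_at_0: "- (1 / \<alpha>\<^sub>0) \<le> G x 0" "G x 0 \<le> \<alpha>\<^sub>1"
  using G1[where x=x and p=0] by auto

text \<open>A constant touches \<open>u\<close> from above at its maximum; operator and gradient
  vanish there and only G(x, 0) remains.\<close>

lemma usc_subsolution_upper_bound: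
  assumes u: "visc_usc_subsolution \<nu> j lam G a u" and lam: "lam \<ge> 0"
  shows "lam * u x \<le> a + 1 / \<alpha>\<^sub>0"
proof -
  obtain x\<^sub>0 where x\<^sub>0: "\<And>y. u y \<le> u x\<^sub>0"
    using usc_periodic_attains_sup u unfolding visc_usc_subsolution_def by metis
  have "lam * u x\<^sub>0 - nonlocal_op \<nu> j (\<lambda>x. 0) x\<^sub>0 + G x\<^sub>0 (grad (\<lambda>x. 0) x\<^sub>0) \<le> a"
  proof -
    have "C2_torus (\<lambda>x :: real ^ 'd. 0)" by (rule C2_torus_const)
    moreover have "\<forall>x. u x - (\<lambda>x. 0) x \<le> u x\<^sub>0 - (\<lambda>x. 0) x\<^sub>0" using x\<^sub>0 by simp
    ultimately show ?thesis using u unfolding visc_usc_subsolution_def by blast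
  qed
  then have "lam * u x\<^sub>0 \<le> a + 1 / \<alpha>\<^sub>0" using G_at_0(1)[of x\<^sub>0] by (simp add: nonlocal_op_const grad_const)
  moreover have "lam * u x \<le> lam * u x\<^sub>0" using x\<^sub>0 lam by (rule mult_left_mono)
  ultimately show ?thesis by linarith
qed

lemma const_subsolution:
  assumes "lam * b + \<alpha>\<^sub>1 \<le> a"
  shows "visc_usc_subsolution \<nu> j lam G a (\<lambda>x. b)"
  unfolding visc_usc_subsolution_def
proof (intro conjI allI impI; (elim conjE)?)
  show "Zd_periodic (\<lambda>x. b)" by (simp add: Zd_periodic_def)
  show "usc (\<lambda>x :: real ^ 'd. b)" by (intro continuous_usc continuous_intros)
  fix \<phi> :: "real ^ 'd \<Rightarrow> real" and xh assume \<phi>: "C2_torus \<phi>" and max: "\<forall>x. b - \<phi> x \<le> b - \<phi> xh"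
  have le: "(\<lambda>x. b) y - \<phi> y \<le> (\<lambda>x. b) xh - \<phi> xh" for y using max by simp
  have "0 \<le> nonlocal_op \<nu> j \<phi> xh"
    using nonlocal_op_mono_touching[OF C2_torus_const \<phi> le] by (simp add: nonlocal_op_const)
  moreover have "grad \<phi> xh = 0" using C2_touching_grad_eq[OF C2_torus_const \<phi> le] by (simp add: grad_const)
  ultimately show "lam * b - nonlocal_op \<nu> j \<phi> xh + G xh (grad \<phi> xh) \<le> a"
    using G_at_0(2)[of xh] assms by simp
qed

text \<open>The supremum of the family equals its upper envelope, since stability puts that envelope
  back into the family. Its lower envelope is a supersolution, because otherwise a bump contradicts
  maximality. Comparison reverses the trivial order of the two envelopes, so both coincide and
  continuity comes out as a consequence.\<close>

theorem perron_existence: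
  assumes lam: "lam > 0"
  shows "\<exists>u. visc_solution \<nu> j lam G a u"
proof -
  \<comment> \<open>\<open>- K\<^sub>0\<close> is a constant subsolution and serves as the lower
    bound of the family; \<open>K\<^sub>1\<close> bounds every subsolution from above by testing at
    its maximum.\<close>
  define K\<^sub>0 where "K\<^sub>0 = (\<alpha>\<^sub>1 + \<bar>a\<bar>) / lam"
  define K\<^sub>1 where "K\<^sub>1 = (\<bar>a\<bar> + 1 / \<alpha>\<^sub>0) / lam"
  define S where "S = {u. visc_usc_subsolution \<nu> j lam G a u \<and> (\<forall>x. - K\<^sub>0 \<le> u x)}"
  have K: "K\<^sub>0 \<ge> 0" "K\<^sub>1 \<ge> 0" using lam params by (auto simp: K\<^sub>0_def K\<^sub>1_def)
  have "lam * (- K\<^sub>0) + \<alpha>\<^sub>1 \<le> a" using lam by (simp add: K\<^sub>0_def)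
  then have const: "(\<lambda>x. - K\<^sub>0) \<in> S" unfolding S_def using const_subsolution by auto
  have upper: "u x \<le> K\<^sub>1" if "u \<in> S" for u x
  proof -
    have "lam * u x \<le> a + 1 / \<alpha>\<^sub>0" using that lam usc_subsolution_upper_bound[of lam a u x] by (simp add: S_def)
    also have "\<dots> \<le> \<bar>a\<bar> + 1 / \<alpha>\<^sub>0" by simp
    finally show ?thesis using lam by (simp add: K\<^sub>1_def pos_le_divide_eq mult.commute)
  qed
  define W where "W x = (SUP u\<in>S. u x)" for x
  have bdd: "bdd_above ((\<lambda>u. u x) ` S)" for x using upper by (intro bdd_aboveI2) auto
  have SW: "u x \<le> W x" if "u \<in> S" for u x unfolding W_def by (rule cSUP_upper[OF that bdd])
  have WS: "\<exists>u\<in>S. W x - e < u x" if "e > 0" for x e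
  proof -
    have "W x - e < (SUP u\<in>S. u x)" using that by (simp add: W_def)
    moreover have "S \<noteq> {}" using const by blast
    ultimately show ?thesis using less_cSUP_iff[OF _ bdd] by blast
  qed
  define B where "B = K\<^sub>0 + K\<^sub>1"
  have WB: "\<bar>W x\<bar> \<le> B" for x
  proof -
    have "W x \<le> K\<^sub>1" unfolding W_def using const upper by (intro cSUP_least) auto
    then show ?thesis using SW[OF const, of x] K by (simp add: B_def abs_le_iff)
  qed
  have Wper: "Zd_periodic W"
    unfolding Zd_periodic_def W_def
  proof (intro allI impI SUP_cong refl)
    fix x k :: "real ^ 'd" and u assume "\<forall>i. k $ i \<in> \<int>" "u \<in> S"
    then show "u (x + k) = u x" by (auto simp: S_def visc_usc_subsolution_def Zd_periodic_def)
  qed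
  obtain g where g: "usc g" "Zd_periodic g" "\<And>x. W x \<le> g x" "\<And>x. \<bar>g x\<bar> \<le> B"
    "\<And>x. \<exists>y. y \<longlonglongrightarrow> x \<and> (\<lambda>n. W (y n)) \<longlonglongrightarrow> g x"
    using usc_envelope[OF Wper WB] by metis
  have "visc_usc_subsolution \<nu> j lam G a g"
    by (rule usc_subsolution_Sup[of S lam G a W g]) (use SW WS g G_tendsto in \<open>auto simp: S_def\<close>)
  moreover have "- K\<^sub>0 \<le> g x" for x using SW[OF const, of x] g(3)[of x] by linarith
  ultimately have "g \<in> S" by (simp add: S_def)
  then have "g = W" using SW g(3) by (intro ext antisym) auto
  then have subW: "visc_usc_subsolution \<nu> j lam G a W" using \<open>g \<in> S\<close> by (simp add: S_def)
  have "Zd_periodic (\<lambda>x. - W x)" using Wper by (rule Zd_periodic_comp)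
  moreover have "\<bar>- W x\<bar> \<le> B" for x using WB by simp
  ultimately obtain h where h: "usc h" "Zd_periodic h" "\<And>x. - W x \<le> h x" "\<And>x. \<bar>h x\<bar> \<le> B"
    "\<And>x. \<exists>y. y \<longlonglongrightarrow> x \<and> (\<lambda>n. - W (y n)) \<longlonglongrightarrow> h x"
    using usc_envelope[of "\<lambda>x. - W x" B] by metis
  define V where "V x = - h x" for x
  have VW: "V x \<le> W x" for x using h(3)[of x] by (simp add: V_def)
  have Vseq: "\<exists>y. y \<longlonglongrightarrow> x \<and> (\<lambda>n. W (y n)) \<longlonglongrightarrow> V x" for x
  proof -
    obtain y where "y \<longlonglongrightarrow> x" "(\<lambda>n. - W (y n)) \<longlonglongrightarrow> h x" using h(5) by blast
    then show ?thesis using tendsto_minus[of "\<lambda>n. - W (y n)" "h x"] by (auto simp: V_def)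
  qed
  have superV: "visc_usc_subsolution \<nu> j lam (\<lambda>x p. - G x (- p)) (- a) (\<lambda>x. - V x)"
    unfolding visc_usc_subsolution_def
  proof (intro conjI allI impI; (elim conjE)?)
    fix \<phi> xh assume \<phi>: "C2_torus \<phi>" and max: "\<forall>x. - V x - \<phi> x \<le> - V xh - \<phi> xh"
    \<comment> \<open>The reflected test function, raised by a constant so that it touches
      \<open>V\<close> from below with equality at xh.\<close>
    define \<psi> where "\<psi> x = - \<phi> x + (V xh + \<phi> xh)" for x
    have \<psi>: "C2_torus \<psi>" unfolding \<psi>_def by (intro C2_torus_add C2_torus_uminus C2_torus_const \<phi>)
    have g\<psi>: "grad \<psi> xh = - grad \<phi> xh"
      unfolding \<psi>_def by (simp only: grad_add[OF C2_torus_uminus[OF \<phi>] C2_torus_const] grad_uminus[OF \<phi>] grad_const add_0_right)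
    have I\<psi>: "nonlocal_op \<nu> j \<psi> xh = - nonlocal_op \<nu> j \<phi> xh"
      unfolding \<psi>_def by (simp only: nonlocal_op_add[OF C2_torus_uminus[OF \<phi>] C2_torus_const] nonlocal_op_uminus[OF \<phi>] nonlocal_op_const add_0_right)
    show "lam * - V xh - nonlocal_op \<nu> j \<phi> xh + - G xh (- grad \<phi> xh) \<le> - a"
    proof (rule ccontr)
      assume "\<not> lam * - V xh - nonlocal_op \<nu> j \<phi> xh + - G xh (- grad \<phi> xh) \<le> - a"
      then have fail: "lam * \<psi> xh - nonlocal_op \<nu> j \<psi> xh + G xh (grad \<psi> xh) < a"
        unfolding g\<psi> I\<psi> by (simp add: \<psi>_def)
      have le: "\<psi> x \<le> V x" for x using spec[OF max, of x] by (simp add: \<psi>_def)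
      have eq: "\<psi> xh = V xh" by (simp add: \<psi>_def)
      obtain U where U: "visc_usc_subsolution \<nu> j lam G a U" "\<And>x. W x \<le> U x" "\<exists>x. W x < U x"
        using perron_bump[OF subW G_tendsto G_periodic VW Vseq \<psi> le eq fail] by blast
      have "- K\<^sub>0 \<le> U x" for x using SW[OF const, of x] U(2)[of x] by linarith
      with U(1) have "U \<in> S" by (simp add: S_def)
      with U(3) SW show False by (metis not_le)
    qed
  qed (use h in \<open>auto simp: V_def\<close>)
  have VB: "\<bar>V x\<bar> \<le> B" for x using h(4) by (simp add: V_def)
  have "W x \<le> V x" for x by (rule comparison[OF lam subW WB superV VB])
  then have WV: "W = V" using VW by (intro ext antisym)
  have cont: "continuous_on UNIV W"
  proof (rule usc_imp_continuous)
    show "usc W" using g(1) \<open>g = W\<close> by simp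
    show "usc (\<lambda>x. - W x)" using h(1) by (simp add: WV V_def)
  qed
  show ?thesis
    unfolding visc_solution_def visc_subsolution_iff_usc visc_supersolution_iff_usc
    using cont subW superV WV by blast
qed

end

section \<open>The uniform Lipschitz bound\<close>

text \<open>For negative s both sides are compared after multiplication by 1 - s: the left becomes
  at most 1 and the right is 1 - s^3. The range without lower limit matters, as the exponents below
  can be very negative.\<close>

lemma exp_le_quadratic: "exp s \<le> 1 + s + s\<^sup>2" if "s \<le> 1" for s :: real
proof (cases "0 \<le> s")
  case True
  then show ?thesis using that by (rule exp_bound)
next
  case False
  have "exp s * (1 - s) \<le> 1"
  proof -
    have "exp s * (1 - s) \<le> exp s * exp (- s)" using exp_ge_add_one_self[of "- s"] by (intro mult_left_mono) auto
    then show ?thesis by (simp add: exp_minus)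
  qed
  moreover have "1 \<le> (1 + s + s\<^sup>2) * (1 - s)"
  proof -
    have "(1 + s + s\<^sup>2) * (1 - s) = 1 - s ^ 3" by (simp add: algebra_simps power2_eq_square power3_eq_cube)
    moreover have "s ^ 3 \<le> 0" using False by (simp add: power_le_zero_eq)
    ultimately show ?thesis by simp
  qed
  ultimately have "exp s * (1 - s) \<le> (1 + s + s\<^sup>2) * (1 - s)" by linarith
  then show ?thesis using False by (simp add: mult_le_cancel_right)
qed

text \<open>Expanding the square of |w + h| - |w|, which is nonnegative, gives the bound by the
  tangent paraboloid.\<close>

lemma norm_add_le_quadratic:
  fixes w h :: "'a::real_inner"
  assumes "w \<noteq> 0"
  shows "norm (w + h) - norm w \<le> (h \<bullet> w) / norm w + (norm h)\<^sup>2 / (2 * norm w)"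
proof -
  have w: "norm w > 0" using assms by simp
  have "0 \<le> (norm (w + h) - norm w)\<^sup>2" by simp
  then have "2 * norm w * norm (w + h) \<le> (norm (w + h))\<^sup>2 + (norm w)\<^sup>2"
    by (simp add: power2_diff mult_ac)
  also have "(norm (w + h))\<^sup>2 = (norm w)\<^sup>2 + 2 * (h \<bullet> w) + (norm h)\<^sup>2"
    by (simp add: power2_norm_eq_inner inner_add_left inner_add_right inner_commute)
  finally have "2 * norm w * (norm (w + h) - norm w) \<le> 2 * (h \<bullet> w) + (norm h)\<^sup>2"
    by (simp add: algebra_simps power2_eq_square)
  then have "norm (w + h) - norm w \<le> (2 * (h \<bullet> w) + (norm h)\<^sup>2) / (2 * norm w)"
    using w by (simp add: pos_le_divide_eq mult_ac)
  also have "\<dots> = (h \<bullet> w) / norm w + (norm h)\<^sup>2 / (2 * norm w)" using w by (simp add: add_divide_distrib)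
  finally show ?thesis .
qed

text \<open>Condition (J2) is taken at radius 1, where the compensator is cut off: the jumps without
  compensation are exactly those it controls.\<close>

locale superlinear_hamiltonian_J2 = superlinear_hamiltonian \<nu> j C\<^sub>\<nu> C\<^sub>j G \<alpha>\<^sub>0 \<alpha>\<^sub>1 \<gamma>
  for \<nu> :: "(real ^ 'd) measure" and j C\<^sub>\<nu> C\<^sub>j G \<alpha>\<^sub>0 \<alpha>\<^sub>1 \<gamma> +
  fixes C\<^sub>J :: real
  assumes J2: "C\<^sub>J > 0" "\<And>x y. (\<integral>\<^sup>+ z\<in>- ball 0 1. ennreal (norm (j x z - j y z)) \<partial>\<nu>) \<le> ennreal (C\<^sub>J * norm (x - y))"
begin

definition far :: "real ^ 'd \<Rightarrow> real ^ 'd \<Rightarrow> real ^ 'd \<Rightarrow> real" where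
  "far x y z = indicator (- ball 0 1) z * norm (j x z - j y z)"

lemma far_integrable: "integrable \<nu> (far x y)" and far_integral: "(\<integral>z. far x y z \<partial>\<nu>) \<le> C\<^sub>J * norm (x - y)"
proof -
  have [measurable]: "j x \<in> borel_measurable \<nu>" "j y \<in> borel_measurable \<nu>" by (rule j_measurable)+
  have [measurable]: "(indicator (- ball 0 1) :: real ^ 'd \<Rightarrow> real) \<in> borel_measurable \<nu>"
    by (intro borel_measurable_nu borel_measurable_indicator) auto
  have m: "far x y \<in> borel_measurable \<nu>" unfolding far_def by measurable
  have nn: "(\<integral>\<^sup>+ z. ennreal (far x y z) \<partial>\<nu>) \<le> ennreal (C\<^sub>J * norm (x - y))"
  proof -
    have "(\<integral>\<^sup>+ z. ennreal (far x y z) \<partial>\<nu>) = (\<integral>\<^sup>+ z\<in>- ball 0 1. ennreal (norm (j x z - j y z)) \<partial>\<nu>)"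
      by (intro nn_integral_cong) (simp add: far_def indicator_def)
    then show ?thesis using J2(2)[of x y] by simp
  qed
  have f0: "0 \<le> far x y z" for z by (simp add: far_def)
  show int: "integrable \<nu> (far x y)"
    by (rule integrableI_nonneg[OF m]) (use f0 nn in \<open>auto simp: le_less_trans\<close>)
  have "ennreal (\<integral>z. far x y z \<partial>\<nu>) \<le> ennreal (C\<^sub>J * norm (x - y))"
    using nn nn_integral_eq_integral[OF int] f0 by simp
  then show "(\<integral>z. far x y z \<partial>\<nu>) \<le> C\<^sub>J * norm (x - y)" using J2(1) by (simp add: ennreal_le_iff)
qed

text \<open>Constants touch \<open>u\<close> at its maximum from above and at its minimum from
  below. The bound is independent of \<open>lam\<close>, and it is the only size information
  available before the oscillation is controlled.\<close>

lemma visc_solution_lam_bound: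
  assumes u: "visc_solution \<nu> j lam G c u" and lam: "lam \<ge> 0"
  shows "\<bar>lam * u x\<bar> \<le> \<bar>c\<bar> + 1 / \<alpha>\<^sub>0 + \<alpha>\<^sub>1"
proof -
  have sub: "visc_usc_subsolution \<nu> j lam G c u" and cont: "continuous_on UNIV u"
    and per: "Zd_periodic u"
    and super: "\<And>\<phi> xh. C2_torus \<phi> \<Longrightarrow> (\<forall>x. u x - \<phi> x \<ge> u xh - \<phi> xh) \<Longrightarrow>
        lam * u xh - nonlocal_op \<nu> j \<phi> xh + G xh (grad \<phi> xh) \<ge> c"
    using u unfolding visc_solution_def visc_subsolution_iff_usc visc_supersolution_def by blast+
  have "usc (\<lambda>x. - u x)" using cont by (intro continuous_usc continuous_intros)
  moreover have "Zd_periodic (\<lambda>x. - u x)" using per by (rule Zd_periodic_comp)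
  ultimately obtain x\<^sub>0 where x\<^sub>0: "\<And>y. - u y \<le> - u x\<^sub>0" using usc_periodic_attains_sup by metis
  have "\<forall>x. u x - (\<lambda>x. 0) x \<ge> u x\<^sub>0 - (\<lambda>x. 0) x\<^sub>0" using x\<^sub>0 by simp
  from super[OF C2_torus_const this] have "lam * u x\<^sub>0 \<ge> c - \<alpha>\<^sub>1"
    using G_at_0(2)[of x\<^sub>0] by (simp add: nonlocal_op_const grad_const)
  moreover have "lam * u x\<^sub>0 \<le> lam * u x" using x\<^sub>0[of x] lam by (intro mult_left_mono) auto
  ultimately have "lam * u x \<ge> c - \<alpha>\<^sub>1" by linarith
  moreover have "lam * u x \<le> c + 1 / \<alpha>\<^sub>0" by (rule usc_subsolution_upper_bound[OF sub lam])
  moreover have "0 \<le> 1 / \<alpha>\<^sub>0" using params by simp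
  ultimately show ?thesis using params abs_ge_self[of c] abs_ge_minus_self[of c] unfolding abs_le_iff by linarith
qed

text \<open>Weak Bernstein argument: the variables are doubled in \<open>ln w x - ln w y - L |x - y|\<close> with
  \<open>w = u + const\<close> of size \<open>M\<close>. At a positive maximum the two gradients differ by the factor
  \<open>t = w x / w y \<ge> exp (L |x - y|)\<close>, so the superlinear gain is at least of order
  \<open>L |x - y| (M L)\<^sup>\<gamma>\<close>; the nonlocal terms contribute only \<open>M L\<^sup>2 |x - y|\<close>. The bound is linear in \<open>M\<close>,
  which the later oscillation estimate needs.\<close>

lemma log_doubling_estimate:
  assumes gain: "c\<^sub>1 > 0" "K \<ge> 0"
    "\<And>x q t. t \<ge> 1 \<Longrightarrow> (t - 1) * (c\<^sub>1 * norm q powr \<gamma> - K) \<le> G x (t *\<^sub>R q) - t * G x q"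
    and L: "L \<ge> 1" and M: "M \<ge> 1"
    and lam: "lam \<ge> 0" and u: "visc_solution \<nu> j lam G c u"
    and w: "w = (\<lambda>x. u x + k\<^sub>0)" "\<And>x. M \<le> w x" "\<And>x. w x \<le> 2 * M" and k\<^sub>0: "lam * k\<^sub>0 \<ge> - K\<^sub>0"
    and ne: "xb \<noteq> yb" and m: "m \<ge> 0"
    and le: "\<And>x y. w x \<le> exp (m + L * norm (x - y)) * w y" and eq: "w xb = exp (m + L * norm (xb - yb)) * w yb"
    and big: "c\<^sub>1 * (M * L) powr \<gamma> / 2 \<ge> K + K\<^sub>0 + \<bar>c\<bar>"
  shows "\<exists>X \<ge> (M * L) powr \<gamma>. L * (c\<^sub>1 * X / 2) \<le> 2 * \<alpha>\<^sub>1 * (X + 1) + M * L\<^sup>2 * (8 * C\<^sub>j\<^sup>2 * C\<^sub>\<nu> + 2 * C\<^sub>J)"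
proof -
  have sub: "visc_usc_subsolution \<nu> j lam G c u"
    and super: "visc_usc_subsolution \<nu> j lam (\<lambda>x p. - G x (- p)) (- c) (\<lambda>x. - u x)"
    and cont: "continuous_on UNIV u" and per: "Zd_periodic u"
    using u unfolding visc_solution_def visc_subsolution_iff_usc visc_supersolution_iff_usc visc_usc_subsolution_def by blast+
  have "bounded (range u)" by (rule Zd_periodic_bounded[OF per cont])
  then obtain B where B: "\<And>x. \<bar>u x\<bar> \<le> B" unfolding bounded_pos by auto
  have wpos: "w x > 0" for x using w(2)[of x] M by linarith
  define v where "v = xb - yb"
  define t where "t = exp (m + L * norm v)"
  define \<xi> where "\<xi> = (1 / norm v) *\<^sub>R v"
  have v: "norm v > 0" using ne by (simp add: v_def)
  have \<xi>: "norm \<xi> = 1" using v by (simp add: \<xi>_def)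
  have L0: "L > 0" using L by simp
  have t: "w xb = t * w yb" using eq by (simp add: t_def v_def)
  have t1: "1 + L * norm v \<le> t" unfolding t_def using exp_ge_add_one_self[of "m + L * norm v"] m by linarith
  have Lv0: "L * norm v > 0" using L0 v by simp
  \<comment> \<open>All values of \<open>w\<close> lie between M and 2 M, so the ratio t is at most
    2; hence L |v| <= 1, which later trades one factor L |v| for a constant.\<close>
  have "t * w yb \<le> 2 * w yb" using t w(3)[of xb] w(2)[of yb] by linarith
  then have t2: "t \<le> 2" using wpos[of yb] by simp
  have Lv: "L * norm v \<le> 1" using t1 t2 by linarith
  \<comment> \<open>The change of the exponent when x - y moves from v to v + h. Its linear bound
    handles long jumps and its tangent paraboloid the compensated ones.\<close>
  define \<sigma> where "\<sigma> h = L * (norm (v + h) - norm v)" for h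
  have \<sigma>abs: "\<bar>\<sigma> h\<bar> \<le> L * norm h" for h
  proof -
    have "\<bar>norm (v + h) - norm v\<bar> \<le> norm h" using norm_triangle_ineq3[of "v + h" v] by simp
    then show ?thesis using L0 by (simp add: \<sigma>_def abs_mult)
  qed
  have \<sigma>quad: "\<sigma> h \<le> L * (h \<bullet> \<xi>) + L / (2 * norm v) * (norm h)\<^sup>2" for h
  proof -
    have "norm (v + h) - norm v \<le> h \<bullet> \<xi> + (norm h)\<^sup>2 / (2 * norm v)"
      using norm_add_le_quadratic[of v h] v by (simp add: \<xi>_def)
    then have "L * (norm (v + h) - norm v) \<le> L * (h \<bullet> \<xi> + (norm h)\<^sup>2 / (2 * norm v))" using L0 by simp
    then show ?thesis by (simp add: \<sigma>_def distrib_left)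
  qed
  have exp\<sigma>: "exp (m + L * norm (v + h)) = t * exp (\<sigma> h)" for h
    by (simp add: t_def \<sigma>_def exp_add[symmetric] algebra_simps)
  have le\<sigma>: "w (xb + h1) \<le> t * exp (\<sigma> (h1 - h2)) * w (yb + h2)" for h1 h2
  proof -
    have eq: "(xb + h1) - (yb + h2) = v + (h1 - h2)" by (simp add: v_def)
    show ?thesis using le[of "xb + h1" "yb + h2"] unfolding eq exp\<sigma> .
  qed
  have upx: "w (xb + h) \<le> w xb * exp (\<sigma> h)" for h
    using le\<sigma>[of h 0] by (simp add: t mult_ac)
  have lowy: "w yb \<le> exp (\<sigma> (- h)) * w (yb + h)" for h
  proof -
    have "t * w yb \<le> t * (exp (\<sigma> (- h)) * w (yb + h))" using le\<sigma>[of 0 h] by (simp add: t mult_ac)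
    then show ?thesis using t1 Lv0 by (simp only: mult_le_cancel_left_pos)
  qed
  \<comment> \<open>The gradient in y of the touching function at \<open>yb\<close>; the one at
    \<open>xb\<close> is w xb L \<xi> = t p, so the slopes are parallel with ratio t.\<close>
  define p where "p = (w yb * L) *\<^sub>R \<xi>"
  have tp: "t *\<^sub>R p = (w xb * L) *\<^sub>R \<xi>" by (simp add: p_def t mult_ac)
  have np: "norm p = w yb * L" using wpos[of yb] L0 by (simp add: p_def \<xi>)
  define A where "A = w xb * (L / (2 * norm v) + L\<^sup>2)"
  have A0: "A \<ge> 0" unfolding A_def using wpos[of xb] v L0 by (intro mult_nonneg_nonneg add_nonneg_nonneg) auto
  define P where "P = norm (t *\<^sub>R p)"
  \<comment> \<open>For L |h| <= 1 the exponential is expanded and \<open>A\<close> suffices. For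
    longer h the crude bound 2 M + |h| P is absorbed by multiplying with powers of L |h| >=
    1.\<close>
  define C where "C = A + (2 * M + P) * L * (L + 1)"
  have C0: "C \<ge> A" using M L0 by (simp add: C_def P_def)
  have ux: "u x \<le> u xb + (x - xb) \<bullet> (t *\<^sub>R p) + C * (norm (x - xb))\<^sup>2" for x
  proof -
    define h where "h = x - xb"
    have wx: "w x = w (xb + h)" by (simp add: h_def)
    have "w (xb + h) - w xb \<le> h \<bullet> (t *\<^sub>R p) + C * (norm h)\<^sup>2"
    proof (cases "L * norm h \<le> 1")
      case True
      then have s1: "\<sigma> h \<le> 1" using \<sigma>abs[of h] by linarith
      have "(\<sigma> h)\<^sup>2 \<le> (L * norm h)\<^sup>2" using \<sigma>abs[of h] L0 by (intro abs_le_square_iff[THEN iffD1]) (simp add: abs_mult)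
      then have "exp (\<sigma> h) \<le> 1 + (L * (h \<bullet> \<xi>) + L / (2 * norm v) * (norm h)\<^sup>2) + L\<^sup>2 * (norm h)\<^sup>2"
        using exp_le_quadratic[OF s1] \<sigma>quad[of h] by (simp add: power_mult_distrib)
      then have "w xb * exp (\<sigma> h) \<le> w xb * (1 + (L * (h \<bullet> \<xi>) + L / (2 * norm v) * (norm h)\<^sup>2) + L\<^sup>2 * (norm h)\<^sup>2)"
        using wpos[of xb] by (intro mult_left_mono) auto
      also have "\<dots> = w xb + h \<bullet> (t *\<^sub>R p) + A * (norm h)\<^sup>2"
        unfolding tp A_def by (simp add: algebra_simps)
      finally have "w (xb + h) - w xb \<le> h \<bullet> (t *\<^sub>R p) + A * (norm h)\<^sup>2" using upx[of h] by linarith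
      moreover have "A * (norm h)\<^sup>2 \<le> C * (norm h)\<^sup>2" using C0 by (intro mult_right_mono) auto
      ultimately show ?thesis by linarith
    next
      case False
      have "- (h \<bullet> (t *\<^sub>R p)) \<le> norm h * P"
        unfolding P_def using norm_cauchy_schwarz[of "- h" "t *\<^sub>R p"] by simp
      moreover have "w (xb + h) - w xb \<le> 2 * M" using w(3)[of "xb + h"] wpos[of xb] by linarith
      moreover have "2 * M + norm h * P \<le> C * (norm h)\<^sup>2"
      proof -
        have Lh: "1 \<le> L * norm h" using False by simp
        have P0: "P \<ge> 0" by (simp add: P_def)
        have "2 * M + norm h * P = 2 * M * 1 * 1 + P * norm h * 1" by simp
        also have "\<dots> \<le> 2 * M * (L * norm h) * (L * norm h) + P * norm h * (L * norm h)"
          using Lh M P0 L0 by (intro add_mono mult_mono) auto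
        also have "\<dots> = (2 * M * L + P) * L * (norm h)\<^sup>2" by (simp add: power2_eq_square algebra_simps)
        also have "\<dots> \<le> C * (norm h)\<^sup>2"
        proof (rule mult_right_mono)
          have "(2 * M * L + P) * L \<le> (2 * M + P) * L * (L + 1)"
            using M P0 L0 by (simp add: algebra_simps)
          then show "(2 * M * L + P) * L \<le> C" using A0 by (simp add: C_def)
        qed simp
        finally show ?thesis .
      qed
      ultimately show ?thesis by linarith
    qed
    then show ?thesis unfolding h_def[symmetric] using wx by (simp add: w(1) h_def)
  qed
  define C' where "C' = w yb * (L / (2 * norm v))"
  have C'0: "C' \<ge> 0" unfolding C'_def using wpos[of yb] v L0 by (intro mult_nonneg_nonneg) auto
  have uy: "- u y \<le> - u yb + (y - yb) \<bullet> (- p) + C' * (norm (y - yb))\<^sup>2" for y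
  proof -
    define h where "h = y - yb"
    have "w yb * (1 - \<sigma> (- h)) \<le> w yb * exp (- \<sigma> (- h))"
      using exp_ge_add_one_self[of "- \<sigma> (- h)"] wpos[of yb] by (intro mult_left_mono) auto
    also have "\<dots> \<le> (exp (\<sigma> (- h)) * w (yb + h)) * exp (- \<sigma> (- h))"
      using lowy[of h] by (intro mult_right_mono) auto
    also have "\<dots> = w (yb + h)" by (simp add: exp_minus)
    finally have 1: "w yb - w yb * \<sigma> (- h) \<le> w (yb + h)" by (simp add: algebra_simps)
    have "w yb * \<sigma> (- h) \<le> w yb * (L * ((- h) \<bullet> \<xi>) + L / (2 * norm v) * (norm (- h))\<^sup>2)"
      by (rule mult_left_mono[OF \<sigma>quad less_imp_le[OF wpos]])
    also have "\<dots> = h \<bullet> (- p) + C' * (norm h)\<^sup>2" unfolding p_def C'_def by (simp add: algebra_simps)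
    finally show ?thesis using 1 by (simp add: w(1) h_def)
  qed
  have PWx: "integrable \<nu> (incr j u xb (t *\<^sub>R p))" "lam * u xb + G xb (t *\<^sub>R p) - c \<le> (\<integral>z. incr j u xb (t *\<^sub>R p) z \<partial>\<nu>)"
    using usc_subsolution_pointwise[OF sub B _ ux] A0 C0 by auto
  have PWy: "integrable \<nu> (incr j (\<lambda>x. - u x) yb (- p))"
     "- (lam * u yb) - G yb p + c \<le> (\<integral>z. incr j (\<lambda>x. - u x) yb (- p) z \<partial>\<nu>)"
    using usc_subsolution_pointwise[OF super _ C'0 uy, of B] B by auto
  \<comment> \<open>The supersolution inequality is weighted with t. This matches the gain, which
    compares G(x, t p) with t G(x, p), and makes the zero order terms of \<open>w\<close> cancel,
    since w xb = t w yb.\<close>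
  define E where "E z = incr j u xb (t *\<^sub>R p) z + t * incr j (\<lambda>x. - u x) yb (- p) z" for z
  have Eint: "integrable \<nu> E" unfolding E_def using PWx(1) PWy(1) by simp
  have Eval: "(\<integral>z. E z \<partial>\<nu>) = (\<integral>z. incr j u xb (t *\<^sub>R p) z \<partial>\<nu>) + t * (\<integral>z. incr j (\<lambda>x. - u x) yb (- p) z \<partial>\<nu>)"
    unfolding E_def using PWx(1) PWy(1) by simp
  have "t * (- (lam * u yb) - G yb p + c) \<le> t * (\<integral>z. incr j (\<lambda>x. - u x) yb (- p) z \<partial>\<nu>)"
    using PWy(2) t1 Lv0 by (intro mult_left_mono) auto
  with PWx(2) have lower: "lam * (u xb - t * u yb) + (G xb (t *\<^sub>R p) - t * G yb p) + (t - 1) * c \<le> (\<integral>z. E z \<partial>\<nu>)"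
    unfolding Eval by (simp add: algebra_simps)
  \<comment> \<open>Both summands carry a factor |v| once integrated, the first directly and the
    second through (J2). That factor is divided out at the end against t - 1 >= L |v|.\<close>
  define D where "D z = 8 * M * L\<^sup>2 * C\<^sub>j\<^sup>2 * norm v * wt z + 2 * M * L * far xb yb z" for z
  have Eup: "E z \<le> D z" for z
  proof -
    define h where "h = j xb z - j yb z"
    define aa where "aa = w (xb + j xb z)"
    define bb where "bb = w (yb + j yb z)"
    have Eeq: "E z = aa - t * bb - indicator (ball 0 1) z * (h \<bullet> (t *\<^sub>R p))"
      using t by (simp add: E_def incr_def aa_def bb_def w(1) h_def algebra_simps inner_diff_left)
    have ab: "aa \<le> t * exp (\<sigma> h) * bb" unfolding aa_def bb_def h_def by (rule le\<sigma>)
    have pos: "aa > 0" "bb > 0" "t > 0" using wpos t1 Lv0 by (auto simp: aa_def bb_def)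
    have hn: "norm h \<le> C\<^sub>j * norm v * norm z" using J1(3) by (simp add: h_def v_def)
    \<comment> \<open>The same inequality \<open>ab\<close>, once divided by exp (\<sigma> h). For
      \<sigma> h > 0 this version is used, as 1 - exp (-s) <= s for all s; for \<sigma> h <= 0 the
      other one, as exp s <= 1 + s + s^2 needs s <= 1.\<close>
    have case_pos: "aa - t * bb \<le> aa * (1 - exp (- \<sigma> h))"
    proof -
      have "aa * exp (- \<sigma> h) \<le> (t * exp (\<sigma> h) * bb) * exp (- \<sigma> h)" using ab by (intro mult_right_mono) auto
      also have "\<dots> = t * bb" by (simp add: exp_minus)
      finally show ?thesis by (simp add: algebra_simps)
    qed
    have case_neg: "aa - t * bb \<le> t * bb * (exp (\<sigma> h) - 1)" using ab by (simp add: algebra_simps)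
    have e1: "1 - exp (- \<sigma> h) \<le> \<sigma> h" using exp_ge_add_one_self[of "- \<sigma> h"] by linarith
    show ?thesis
    proof (cases "norm z < 1")
      case True
      have jx: "norm (j xb z) \<le> C\<^sub>j * norm z" "norm (j yb z) \<le> C\<^sub>j * norm z" using J1(2) by auto
      \<comment> \<open>The relative increment: the first order term, the curvature of the norm, the
        square from the exponential, and the change of \<open>w\<close> along the jump multiplied by
        the size of \<sigma> h.\<close>
      define Y where "Y = L * (h \<bullet> \<xi>) + L / (2 * norm v) * (norm h)\<^sup>2 + L\<^sup>2 * (norm h)\<^sup>2 + 2 * L * (C\<^sub>j * norm z) * (L * norm h)"
      have Cz: "0 \<le> C\<^sub>j * norm z" using J1(1) by simp
      have "aa - t * bb \<le> w xb * Y"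
      proof (cases "\<sigma> h \<le> 0")
        case neg: True
        have "w yb * (1 - L * norm (j yb z)) \<le> bb"
        proof -
          have "w yb \<le> exp (\<sigma> (- j yb z)) * bb" unfolding bb_def by (rule lowy)
          then have "w yb * exp (- \<sigma> (- j yb z)) \<le> (exp (\<sigma> (- j yb z)) * bb) * exp (- \<sigma> (- j yb z))"
            by (intro mult_right_mono) auto
          also have "\<dots> = bb" by (simp add: exp_minus)
          finally have "w yb * exp (- \<sigma> (- j yb z)) \<le> bb" .
          moreover have "w yb * (1 - L * norm (j yb z)) \<le> w yb * exp (- \<sigma> (- j yb z))"
          proof (rule mult_left_mono)
            show "1 - L * norm (j yb z) \<le> exp (- \<sigma> (- j yb z))"
              using exp_ge_add_one_self[of "- \<sigma> (- j yb z)"] \<sigma>abs[of "- j yb z"] by (simp add: abs_le_iff)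
          qed (use wpos[of yb] in simp)
          ultimately show ?thesis by linarith
        qed
        moreover have "t * (exp (\<sigma> h) - 1) \<le> 0" using neg pos by (simp add: mult_le_0_iff)
        ultimately have "t * (exp (\<sigma> h) - 1) * bb \<le> t * (exp (\<sigma> h) - 1) * (w yb * (1 - L * norm (j yb z)))"
          by (rule mult_left_mono_neg)
        also have "\<dots> = w xb * ((exp (\<sigma> h) - 1) + L * norm (j yb z) * (1 - exp (\<sigma> h)))"
          by (simp add: t algebra_simps)
        also have "\<dots> \<le> w xb * Y"
        proof (rule mult_left_mono)
          have "(\<sigma> h)\<^sup>2 \<le> (L * norm h)\<^sup>2" using \<sigma>abs[of h] L0 by (intro abs_le_square_iff[THEN iffD1]) (simp add: abs_mult)
          moreover have "exp (\<sigma> h) \<le> 1 + \<sigma> h + (\<sigma> h)\<^sup>2" using neg by (intro exp_le_quadratic) simp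
          ultimately have 1: "exp (\<sigma> h) - 1 \<le> L * (h \<bullet> \<xi>) + L / (2 * norm v) * (norm h)\<^sup>2 + L\<^sup>2 * (norm h)\<^sup>2"
            using \<sigma>quad[of h] by (simp add: power_mult_distrib)
          have "1 - exp (\<sigma> h) \<le> L * norm h" using exp_ge_add_one_self[of "\<sigma> h"] \<sigma>abs[of h] unfolding abs_le_iff by linarith
          then have "L * norm (j yb z) * (1 - exp (\<sigma> h)) \<le> L * (C\<^sub>j * norm z) * (L * norm h)"
            using jx(2) L0 neg Cz by (intro mult_mono) auto
          moreover have "0 \<le> L * (C\<^sub>j * norm z) * (L * norm h)" using L0 Cz by simp
          ultimately show "(exp (\<sigma> h) - 1) + L * norm (j yb z) * (1 - exp (\<sigma> h)) \<le> Y"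
            using 1 unfolding Y_def by linarith
        qed (use wpos[of xb] in simp)
        finally show ?thesis using case_neg by (simp add: mult_ac)
      next
        case neg: False
        have aa2: "aa \<le> w xb * (1 + 2 * L * norm (j xb z))"
        proof (cases "L * norm (j xb z) \<le> 1")
          case True
          have s: "\<sigma> (j xb z) \<le> L * norm (j xb z)" using \<sigma>abs[of "j xb z"] by simp
          have "exp (\<sigma> (j xb z)) \<le> exp (L * norm (j xb z))" using s by simp
          also have "\<dots> \<le> 1 + L * norm (j xb z) + (L * norm (j xb z))\<^sup>2" using True by (rule exp_le_quadratic)
          also have "(L * norm (j xb z))\<^sup>2 \<le> L * norm (j xb z) * 1"
            unfolding power2_eq_square using True L0 by (intro mult_left_mono) auto
          finally have "exp (\<sigma> (j xb z)) \<le> 1 + 2 * L * norm (j xb z)" by simp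
          then have "w xb * exp (\<sigma> (j xb z)) \<le> w xb * (1 + 2 * L * norm (j xb z))"
            using wpos[of xb] by (intro mult_left_mono) auto
          then show ?thesis using upx[of "j xb z"] unfolding aa_def by linarith
        next
          case False
          have "aa \<le> w xb * 2" using w(3)[of "xb + j xb z"] w(2)[of xb] unfolding aa_def by linarith
          also have "\<dots> \<le> w xb * (1 + 2 * L * norm (j xb z))"
            using False wpos[of xb] by (intro mult_left_mono) auto
          finally show ?thesis .
        qed
        have e0: "0 \<le> 1 - exp (- \<sigma> h)" using neg by simp
        have "aa * (1 - exp (- \<sigma> h)) \<le> (w xb * (1 + 2 * L * norm (j xb z))) * (1 - exp (- \<sigma> h))"
          using aa2 e0 by (rule mult_right_mono)
        also have "\<dots> = w xb * ((1 - exp (- \<sigma> h)) + 2 * L * norm (j xb z) * (1 - exp (- \<sigma> h)))"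
          by (simp add: algebra_simps)
        also have "\<dots> \<le> w xb * Y"
        proof (rule mult_left_mono)
          have "1 - exp (- \<sigma> h) \<le> L * norm h" using e1 \<sigma>abs[of h] by (simp add: abs_le_iff)
          then have "2 * L * norm (j xb z) * (1 - exp (- \<sigma> h)) \<le> 2 * L * (C\<^sub>j * norm z) * (L * norm h)"
            using jx(1) L0 Cz e0 by (intro mult_mono) auto
          moreover have "0 \<le> L\<^sup>2 * (norm h)\<^sup>2" by simp
          ultimately show "(1 - exp (- \<sigma> h)) + 2 * L * norm (j xb z) * (1 - exp (- \<sigma> h)) \<le> Y"
            using e1 \<sigma>quad[of h] unfolding Y_def by linarith
        qed (use wpos[of xb] in simp)
        finally show ?thesis using case_pos by linarith
      qed
      then have "E z \<le> w xb * Y - h \<bullet> (t *\<^sub>R p)" unfolding Eeq using True by simp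
      \<comment> \<open>The compensator equals w xb times the first term of \<open>Y\<close>, so
        only terms of second order in z remain.\<close>
      also have "h \<bullet> (t *\<^sub>R p) = w xb * (L * (h \<bullet> \<xi>))" unfolding tp by simp
      also have "w xb * Y - w xb * (L * (h \<bullet> \<xi>)) = w xb * (L / (2 * norm v) * (norm h)\<^sup>2 + L\<^sup>2 * (norm h)\<^sup>2 + 2 * L * (C\<^sub>j * norm z) * (L * norm h))"
        unfolding Y_def by (simp add: algebra_simps)
      also have "\<dots> \<le> (2 * M) * (4 * L\<^sup>2 * C\<^sub>j\<^sup>2 * norm v * (norm z)\<^sup>2)"
      proof (rule mult_mono)
        define q where "q = C\<^sub>j\<^sup>2 * norm v * (norm z)\<^sup>2"
        have q: "q \<ge> 0" by (simp add: q_def)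
        \<comment> \<open>The difference of the jumps is of order |v| |z|. One factor |v| cancels
          the 1/|v| from the curvature of the norm, or is absorbed by L |v| <= 1; the other is kept
          in \<open>q\<close>.\<close>
        have h2: "(norm h)\<^sup>2 \<le> q * norm v"
          using power_mono[OF hn, of 2] by (simp add: q_def power_mult_distrib power2_eq_square[of "norm v"] mult_ac)
        have "L / (2 * norm v) * (norm h)\<^sup>2 \<le> L / (2 * norm v) * (q * norm v)"
          using h2 L0 v by (intro mult_left_mono) auto
        also have "\<dots> = L / 2 * q" using v by simp
        also have "\<dots> \<le> L\<^sup>2 * q" using L q by (intro mult_right_mono) (auto simp: power2_eq_square)
        finally have 1: "L / (2 * norm v) * (norm h)\<^sup>2 \<le> L\<^sup>2 * q" .
        have "L\<^sup>2 * (norm h)\<^sup>2 \<le> L\<^sup>2 * (q * norm v)" using h2 by (intro mult_left_mono) auto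
        also have "\<dots> = (L * norm v) * (L * q)" by (simp add: power2_eq_square mult_ac)
        also have "\<dots> \<le> 1 * (L * q)" using Lv L0 q by (intro mult_right_mono) auto
        also have "\<dots> \<le> L\<^sup>2 * q" using L q by (simp add: power2_eq_square mult_right_mono)
        finally have 2: "L\<^sup>2 * (norm h)\<^sup>2 \<le> L\<^sup>2 * q" .
        have "2 * L * (C\<^sub>j * norm z) * (L * norm h) \<le> 2 * L * (C\<^sub>j * norm z) * (L * (C\<^sub>j * norm v * norm z))"
          using hn L0 Cz by (intro mult_left_mono) auto
        also have "\<dots> = 2 * (L\<^sup>2 * q)" by (simp add: q_def power2_eq_square mult_ac)
        finally show "L / (2 * norm v) * (norm h)\<^sup>2 + L\<^sup>2 * (norm h)\<^sup>2 + 2 * L * (C\<^sub>j * norm z) * (L * norm h) \<le> 4 * L\<^sup>2 * C\<^sub>j\<^sup>2 * norm v * (norm z)\<^sup>2"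
          using 1 2 by (simp add: q_def mult_ac)
        show "0 \<le> L / (2 * norm v) * (norm h)\<^sup>2 + L\<^sup>2 * (norm h)\<^sup>2 + 2 * L * (C\<^sub>j * norm z) * (L * norm h)"
          using L0 v J1(1) by (intro add_nonneg_nonneg mult_nonneg_nonneg) auto
      qed (use w M in auto)
      also have "\<dots> \<le> D z" using True M L0 unfolding D_def wt_in_ball[OF True] by (simp add: far_def mult_ac)
      finally show ?thesis .
    next
      case False
      have "E z = aa - t * bb" unfolding Eeq using False by simp
      also have "\<dots> \<le> 2 * M * L * norm h"
      proof (cases "\<sigma> h \<le> 0")
        case True
        then have "t * bb * (exp (\<sigma> h) - 1) \<le> 0" using pos by (simp add: mult_le_0_iff)
        moreover have "0 \<le> 2 * M * L * norm h" using M L0 by simp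
        ultimately show ?thesis using case_neg by linarith
      next
        case neg: False
        have "aa * (1 - exp (- \<sigma> h)) \<le> (2 * M) * (L * norm h)"
        proof (rule mult_mono)
          show "aa \<le> 2 * M" unfolding aa_def by (rule w(3))
          show "1 - exp (- \<sigma> h) \<le> L * norm h" using e1 \<sigma>abs[of h] by (simp add: abs_le_iff)
        qed (use neg M in auto)
        then show ?thesis using case_pos by simp
      qed
      also have "\<dots> \<le> D z"
        using False M L0 wt_nonneg[of z] by (simp add: D_def far_def h_def)
      finally show ?thesis .
    qed
  qed
  have Dint: "integrable \<nu> D" unfolding D_def by (intro Bochner_Integration.integrable_add integrable_mult_right integrable_wt far_integrable)
  have "(\<integral>z. E z \<partial>\<nu>) \<le> (\<integral>z. D z \<partial>\<nu>)" by (intro integral_mono Eint Dint Eup)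
  also have "\<dots> = 8 * M * L\<^sup>2 * C\<^sub>j\<^sup>2 * norm v * (\<integral>z. wt z \<partial>\<nu>) + 2 * M * L * (\<integral>z. far xb yb z \<partial>\<nu>)"
    unfolding D_def using integrable_wt far_integrable by simp
  also have "\<dots> \<le> 8 * M * L\<^sup>2 * C\<^sub>j\<^sup>2 * norm v * C\<^sub>\<nu> + 2 * M * L * (C\<^sub>J * norm v)"
    using M L0 integral_wt_le far_integral[of xb yb] unfolding v_def by (intro add_mono mult_left_mono) auto
  also have "\<dots> \<le> norm v * (M * L\<^sup>2 * (8 * C\<^sub>j\<^sup>2 * C\<^sub>\<nu> + 2 * C\<^sub>J))"
  proof -
    have "L * (2 * M * C\<^sub>J * norm v) \<le> L\<^sup>2 * (2 * M * C\<^sub>J * norm v)"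
      using L M J2(1) by (intro mult_right_mono) (auto simp: power2_eq_square)
    then show ?thesis by (simp add: algebra_simps)
  qed
  finally have upper: "(\<integral>z. E z \<partial>\<nu>) \<le> norm v * (M * L\<^sup>2 * (8 * C\<^sub>j\<^sup>2 * C\<^sub>\<nu> + 2 * C\<^sub>J))" .
  define X where "X = norm p powr \<gamma>"
  have X: "(M * L) powr \<gamma> \<le> X"
    unfolding X_def np using w(2)[of yb] M L0 params by (intro powr_mono2 mult_right_mono) auto
  have X0: "X \<ge> 0" by (simp add: X_def)
  have t0: "t \<ge> 1" using t1 Lv0 by linarith
  have g: "(t - 1) * (c\<^sub>1 * X - K) \<le> G xb (t *\<^sub>R p) - t * G xb p" unfolding X_def using t0 by (rule gain(3))
  have g3: "t * G yb p - t * G xb p \<le> 2 * \<alpha>\<^sub>1 * (X + 1) * norm v"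
  proof -
    have "\<bar>G xb p - G yb p\<bar> \<le> \<alpha>\<^sub>1 * (X + 1) * norm v" unfolding X_def v_def by (rule G3)
    then have "t * (G yb p - G xb p) \<le> 2 * (\<alpha>\<^sub>1 * (X + 1) * norm v)"
      using t2 t0 params X0 by (intro order_trans[OF mult_left_mono[of _ "\<alpha>\<^sub>1 * (X + 1) * norm v"] mult_right_mono]) auto
    then show ?thesis by (simp add: algebra_simps)
  qed
  \<comment> \<open>The normalization enters only here: the discount term is (t - 1) lam k0, so a
    lower bound on the product lam k0 suffices, uniformly in \<open>lam\<close>.\<close>
  have l: "lam * (u xb - t * u yb) \<ge> (t - 1) * (- K\<^sub>0)"
  proof -
    have "u xb - t * u yb = (t - 1) * k\<^sub>0" using t by (simp add: w(1) algebra_simps)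
    then have "lam * (u xb - t * u yb) = (t - 1) * (lam * k\<^sub>0)" by simp
    also have "\<dots> \<ge> (t - 1) * (- K\<^sub>0)" using k\<^sub>0 t0 by (intro mult_left_mono) auto
    finally show ?thesis .
  qed
  have cc: "(t - 1) * c \<ge> (t - 1) * (- \<bar>c\<bar>)" using t0 by (intro mult_left_mono) auto
  have sum: "(t - 1) * (c\<^sub>1 * X - K - K\<^sub>0 - \<bar>c\<bar>) =
     (t - 1) * (c\<^sub>1 * X - K) + (t - 1) * (- K\<^sub>0) + (t - 1) * (- \<bar>c\<bar>)" by (simp add: algebra_simps)
  have "(t - 1) * (c\<^sub>1 * X - K - K\<^sub>0 - \<bar>c\<bar>) \<le> 2 * \<alpha>\<^sub>1 * (X + 1) * norm v + norm v * (M * L\<^sup>2 * (8 * C\<^sub>j\<^sup>2 * C\<^sub>\<nu> + 2 * C\<^sub>J))"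
    unfolding sum using g g3 l cc lower upper by linarith
  \<comment> \<open>The condition \<open>big\<close> lets half of the gain absorb all lower order
    terms, and t - 1 >= L |v| produces the common factor |v|.\<close>
  moreover have "L * norm v * (c\<^sub>1 * X / 2) \<le> (t - 1) * (c\<^sub>1 * X - K - K\<^sub>0 - \<bar>c\<bar>)"
  proof (rule mult_mono)
    have "c\<^sub>1 * (M * L) powr \<gamma> / 2 \<le> c\<^sub>1 * X / 2" using X gain(1) by (intro divide_right_mono mult_left_mono) auto
    with big have "K + K\<^sub>0 + \<bar>c\<bar> \<le> c\<^sub>1 * X / 2" by linarith
    then show "c\<^sub>1 * X / 2 \<le> c\<^sub>1 * X - K - K\<^sub>0 - \<bar>c\<bar>" by argo
  qed (use t1 t0 gain(1) X0 in auto)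
  ultimately have "norm v * (L * (c\<^sub>1 * X / 2)) \<le> norm v * (2 * \<alpha>\<^sub>1 * (X + 1) + M * L\<^sup>2 * (8 * C\<^sub>j\<^sup>2 * C\<^sub>\<nu> + 2 * C\<^sub>J))"
    by (simp add: algebra_simps)
  then have "L * (c\<^sub>1 * X / 2) \<le> 2 * \<alpha>\<^sub>1 * (X + 1) + M * L\<^sup>2 * (8 * C\<^sub>j\<^sup>2 * C\<^sub>\<nu> + 2 * C\<^sub>J)"
    using v by (simp only: mult_le_cancel_left_pos)
  with X show ?thesis by blast
qed

end

section \<open>From the doubling estimate to the uniform Lipschitz bound\<close>

context superlinear_hamiltonian_J2
begin

text \<open>\<open>L\<close> is chosen so large that the doubling estimate contradicts itself; then
  ln w is L-Lipschitz, and since w <= 2 M the solution has constant 2 L M, with \<open>L\<close>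
  free of M and \<open>lam\<close>.\<close>

lemma lipschitz_bound_linear_in_osc:
  obtains \<Lambda> where "\<Lambda> \<ge> 1"
    "\<And>lam u M x y. 0 \<le> lam \<Longrightarrow> visc_solution \<nu> j lam G c u \<Longrightarrow> 1 \<le> M \<Longrightarrow> (\<And>x y. u x - u y \<le> M) \<Longrightarrow>
       u x - u y \<le> \<Lambda> * M * norm (x - y)"
proof -
  obtain c\<^sub>1 K where gain: "c\<^sub>1 > 0" "K \<ge> 0"
    "\<And>x q t. t \<ge> 1 \<Longrightarrow> (t - 1) * (c\<^sub>1 * norm q powr \<gamma> - K) \<le> G x (t *\<^sub>R q) - t * G x q"
    using superlinear_gain by metis
  define K\<^sub>0 where "K\<^sub>0 = \<bar>c\<bar> + 1 / \<alpha>\<^sub>0 + \<alpha>\<^sub>1"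
  define C where "C = 8 * C\<^sub>j\<^sup>2 * C\<^sub>\<nu> + 2 * C\<^sub>J"
  have C: "C > 0" using N(1) J2(1) by (simp add: C_def add_nonneg_pos)
  have K\<^sub>0: "K\<^sub>0 > 0" using params by (simp add: K\<^sub>0_def add_nonneg_pos add_pos_pos)
  \<comment> \<open>The summands in turn absorb the (G3) error into a quarter of c1 L X, the
    nonlocal term into another quarter, and ensure the condition \<open>big\<close>. The power
    1/(\<gamma> - 1) inverts L^2 << L^(1 + \<gamma>).\<close>
  define L where "L = 1 + 16 * \<alpha>\<^sub>1 / c\<^sub>1 + (4 * C / c\<^sub>1) powr (1 / (\<gamma> - 1)) + 2 * (K + K\<^sub>0 + \<bar>c\<bar>) / c\<^sub>1"
  have p1: "16 * \<alpha>\<^sub>1 / c\<^sub>1 \<ge> 0" "(4 * C / c\<^sub>1) powr (1 / (\<gamma> - 1)) \<ge> 0" "2 * (K + K\<^sub>0 + \<bar>c\<bar>) / c\<^sub>1 \<ge> 0"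
    using gain params K\<^sub>0 by auto
  then have L: "L \<ge> 1" "L \<ge> 1 + 16 * \<alpha>\<^sub>1 / c\<^sub>1" "L \<ge> (4 * C / c\<^sub>1) powr (1 / (\<gamma> - 1))" "L \<ge> 2 * (K + K\<^sub>0 + \<bar>c\<bar>) / c\<^sub>1"
    unfolding L_def by linarith+
  have L1: "16 * \<alpha>\<^sub>1 + c\<^sub>1 \<le> c\<^sub>1 * L"
  proof -
    have "c\<^sub>1 * (1 + 16 * \<alpha>\<^sub>1 / c\<^sub>1) \<le> c\<^sub>1 * L" using L(2) gain(1) by (intro mult_left_mono) auto
    then show ?thesis using gain(1) by (simp add: distrib_left)
  qed
  have L2: "4 * C \<le> c\<^sub>1 * L powr (\<gamma> - 1)"
  proof -
    have "4 * C / c\<^sub>1 = ((4 * C / c\<^sub>1) powr (1 / (\<gamma> - 1))) powr (\<gamma> - 1)"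
      using params C gain(1) by (simp add: powr_powr)
    also have "\<dots> \<le> L powr (\<gamma> - 1)" using L(3) params by (intro powr_mono2) auto
    finally show ?thesis using gain(1) by (simp add: pos_divide_le_eq mult.commute)
  qed
  have L3: "K + K\<^sub>0 + \<bar>c\<bar> \<le> c\<^sub>1 * L / 2"
    using L(4) gain(1) by (simp add: pos_divide_le_eq mult.commute)
  show thesis
  proof (rule that[of "2 * L"])
    show "2 * L \<ge> 1" using L(1) by simp
    fix lam u M x y
    assume lam: "0 \<le> lam" and u: "visc_solution \<nu> j lam G c u" and M: "1 \<le> M" and osc: "\<And>x y. u x - u y \<le> M"
    have cont: "continuous_on UNIV u" and per: "Zd_periodic u"
      using u unfolding visc_solution_def visc_subsolution_def by blast+
    have "usc (\<lambda>x. - u x)" using cont by (intro continuous_usc continuous_intros)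
    moreover have "Zd_periodic (\<lambda>x. - u x)" using per by (rule Zd_periodic_comp)
    ultimately obtain x\<^sub>0 where x\<^sub>0: "\<And>y. - u y \<le> - u x\<^sub>0" using usc_periodic_attains_sup by metis
    \<comment> \<open>Puts the minimum of \<open>w\<close> at M, so the oscillation bound keeps
      \<open>w\<close> between M and 2 M.\<close>
    define k\<^sub>0 where "k\<^sub>0 = M - u x\<^sub>0"
    define w where "w = (\<lambda>x. u x + k\<^sub>0)"
    have wl: "M \<le> w x" for x using x\<^sub>0[of x] by (simp add: w_def k\<^sub>0_def)
    have wu: "w x \<le> 2 * M" for x using osc[of x x\<^sub>0] by (simp add: w_def k\<^sub>0_def)
    have wpos: "w x > 0" for x using wl[of x] M by linarith
    have lk: "lam * k\<^sub>0 \<ge> - K\<^sub>0"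
    proof -
      have "\<bar>lam * u x\<^sub>0\<bar> \<le> K\<^sub>0" unfolding K\<^sub>0_def by (rule visc_solution_lam_bound[OF u lam])
      moreover have "0 \<le> lam * M" using lam M by simp
      ultimately show ?thesis unfolding k\<^sub>0_def right_diff_distrib abs_le_iff by linarith
    qed
    define v where "v x = ln (w x)" for x
    have contv: "continuous_on UNIV v"
      unfolding v_def w_def using cont wpos by (intro continuous_intros) (auto simp: w_def less_imp_neq[symmetric])
    have perv: "Zd_periodic v" unfolding v_def w_def using per by (rule Zd_periodic_comp)
    have "bounded (range v)" by (rule Zd_periodic_bounded[OF perv contv])
    then obtain B where B: "\<And>x. \<bar>v x\<bar> \<le> B" unfolding bounded_pos by auto
    have B0: "B \<ge> 0" using B[of 0] by linarith
    obtain xb yb where max: "\<And>x' y'. v x' + - v y' - L * norm (x' - y') \<le> v xb + - v yb - L * norm (xb - yb)"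
    proof (rule doubling_attains_sup[of v "\<lambda>y. - v y" "\<lambda>w. L * norm w" B "4 * B"])
      show "usc v" "usc (\<lambda>y. - v y)" using contv by (auto intro!: continuous_usc continuous_intros)
      show "Zd_periodic (\<lambda>y. - v y)" using perv by (rule Zd_periodic_comp)
      show "continuous_on UNIV (\<lambda>w :: real ^ 'd. L * norm w)" by (intro continuous_intros)
      fix w :: "real ^ 'd" assume "4 * B < norm w"
      moreover have "1 * norm w \<le> L * norm w" using L(1) by (intro mult_right_mono) auto
      ultimately show "L * norm (0 :: real ^ 'd) + 4 * B \<le> L * norm w" by simp
    qed (use perv B that in auto)
    define m where "m = v xb - v yb - L * norm (xb - yb)"
    have m0: "m \<le> 0"
    proof (rule ccontr)
      assume "\<not> m \<le> 0"
      then have m: "m > 0" by simp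
      have ne: "xb \<noteq> yb" using m by (auto simp: m_def)
      have wv: "w x = exp (v x)" for x using wpos[of x] by (simp add: v_def)
      have le: "w x \<le> exp (m + L * norm (x - y)) * w y" for x y
        using max[of x y] by (simp add: wv m_def exp_add[symmetric])
      have eq: "w xb = exp (m + L * norm (xb - yb)) * w yb"
        by (simp add: wv m_def exp_add[symmetric])
      have le_mult: "L \<le> M * L" using mult_right_mono[of 1 M L] M L(1) by simp
      have le_powr: "L \<le> (M * L) powr \<gamma>"
      proof -
        have "L powr 1 \<le> L powr \<gamma>" using L(1) params by (intro powr_mono) auto
        also have "\<dots> \<le> (M * L) powr \<gamma>" using le_mult L(1) params by (intro powr_mono2) auto
        finally show ?thesis using L(1) by simp
      qed
      have big: "c\<^sub>1 * (M * L) powr \<gamma> / 2 \<ge> K + K\<^sub>0 + \<bar>c\<bar>"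
      proof -
        have "c\<^sub>1 * L / 2 \<le> c\<^sub>1 * (M * L) powr \<gamma> / 2" using le_powr gain(1) by (intro divide_right_mono mult_left_mono) auto
        then show ?thesis using L3 by linarith
      qed
      obtain X where X: "X \<ge> (M * L) powr \<gamma>" "L * (c\<^sub>1 * X / 2) \<le> 2 * \<alpha>\<^sub>1 * (X + 1) + M * L\<^sup>2 * C"
        using log_doubling_estimate[OF gain L(1) M lam u w_def wl wu lk ne less_imp_le[OF m] le eq big]
        unfolding C_def by blast
      have X1: "X \<ge> 1" using X(1) le_powr L(1) by linarith
      have "M * L\<^sup>2 * (4 * C) \<le> M * L\<^sup>2 * (c\<^sub>1 * L powr (\<gamma> - 1))" using L2 M by (intro mult_left_mono) auto
      also have "\<dots> = c\<^sub>1 * L * (M * (L * L powr (\<gamma> - 1)))" by (simp add: power2_eq_square mult_ac)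
      also have "L * L powr (\<gamma> - 1) = L powr \<gamma>" using L(1) powr_add[of L 1 "\<gamma> - 1"] by simp
      \<comment> \<open>M >= 1 and \<gamma> > 1 give M L^\<gamma> <= (M L)^\<gamma>: the nonlocal
        term is linear in M and the gain is not, so \<open>L\<close> need not depend on M.\<close>
      also have "c\<^sub>1 * L * (M * L powr \<gamma>) \<le> c\<^sub>1 * L * X"
      proof (rule mult_left_mono)
        have "M powr 1 \<le> M powr \<gamma>" using M params by (intro powr_mono) auto
        then have "M * L powr \<gamma> \<le> M powr \<gamma> * L powr \<gamma>" using M by (intro mult_right_mono) auto
        also have "\<dots> = (M * L) powr \<gamma>" using M L(1) by (simp add: powr_mult)
        finally show "M * L powr \<gamma> \<le> X" using X(1) by linarith
      qed (use gain(1) L(1) in simp)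
      finally have a: "4 * (M * L\<^sup>2 * C) \<le> c\<^sub>1 * L * X" by (simp add: mult_ac)
      have "(16 * \<alpha>\<^sub>1 + c\<^sub>1) * X \<le> c\<^sub>1 * L * X" using L1 X1 by (intro mult_right_mono) auto
      then have b: "16 * (\<alpha>\<^sub>1 * X) + c\<^sub>1 * X \<le> c\<^sub>1 * L * X" by (simp add: algebra_simps)
      have d: "\<alpha>\<^sub>1 * 1 \<le> \<alpha>\<^sub>1 * X" using X1 params by (intro mult_left_mono) auto
      have e: "c\<^sub>1 * X > 0" using gain(1) X1 by simp
      have "c\<^sub>1 * L * X / 2 \<le> 2 * (\<alpha>\<^sub>1 * X) + 2 * \<alpha>\<^sub>1 + M * L\<^sup>2 * C"
        using X(2) by (simp add: algebra_simps)
      then show False using a b d e by argo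
    qed
    have le: "w x \<le> exp (L * norm (x - y)) * w y"
    proof -
      have "v x \<le> v y + L * norm (x - y)" using max[of x y] m0 unfolding m_def by linarith
      then have "exp (v x) \<le> exp (v y + L * norm (x - y))" by simp
      then show ?thesis using wpos[of x] wpos[of y] by (simp add: v_def exp_add mult.commute)
    qed
    have "w x * exp (- (L * norm (x - y))) \<le> (exp (L * norm (x - y)) * w y) * exp (- (L * norm (x - y)))"
      using le by (rule mult_right_mono) simp
    also have "\<dots> = w y" by (simp add: exp_minus)
    finally have "w x * exp (- (L * norm (x - y))) \<le> w y" .
    moreover have "w x * (1 - L * norm (x - y)) \<le> w x * exp (- (L * norm (x - y)))"
      using exp_ge_add_one_self[of "- (L * norm (x - y))"] wpos[of x] by (intro mult_left_mono) auto
    ultimately have "w x - w y \<le> w x * (L * norm (x - y))" by (simp add: right_diff_distrib)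
    also have "\<dots> \<le> 2 * M * (L * norm (x - y))" using wu[of x] L(1) by (intro mult_right_mono) auto
    finally show "u x - u y \<le> 2 * L * M * norm (x - y)" by (simp add: w_def mult_ac)
  qed
qed

text \<open>Touching \<open>u\<close> from above by a paraboloid of size \<open>M\<close> = oscillation, centred at a minimum
  point, yields a gradient of order \<open>M\<close> at a point where the nonlocal term is only of order \<open>M\<close>;
  coercivity with \<open>\<gamma> > 1\<close> then bounds \<open>M\<close>.\<close>

lemma osc_bound:
  obtains M\<^sub>0 where "M\<^sub>0 \<ge> 1"
    "\<And>lam u x y. 0 \<le> lam \<Longrightarrow> visc_solution \<nu> j lam G c u \<Longrightarrow> u x - u y \<le> M\<^sub>0"
proof -
  obtain \<Lambda> where \<Lambda>: "\<Lambda> \<ge> 1" and lipM: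
    "\<And>lam u M x y. 0 \<le> lam \<Longrightarrow> visc_solution \<nu> j lam G c u \<Longrightarrow> 1 \<le> M \<Longrightarrow> (\<And>x y. u x - u y \<le> M) \<Longrightarrow>
       u x - u y \<le> \<Lambda> * M * norm (x - y)"
    by (rule lipschitz_bound_linear_in_osc[of c]) blast
  define d where "d = real CARD('d)"
  have d: "d \<ge> 1" by (simp add: d_def Suc_leI)
  \<comment> \<open>The lattice copy of the maximum point lies within sqrt d of the minimum point,
    so the paraboloid b M |x - x0|^2 costs at most M/2 there and \<open>u\<close> at the touching
    point is still M/2 above its minimum.\<close>
  define b where "b = 1 / (2 * d)"
  have b: "b > 0" using d by (simp add: b_def)
  define K\<^sub>0 where "K\<^sub>0 = \<bar>c\<bar> + 1 / \<alpha>\<^sub>0 + \<alpha>\<^sub>1 + \<bar>c\<bar> + 1 / \<alpha>\<^sub>0 + (b * C\<^sub>j\<^sup>2 + 1) * C\<^sub>\<nu>"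
  define C where "C = K\<^sub>0 / (\<alpha>\<^sub>0 * (b / \<Lambda>) powr \<gamma>)"
  define M\<^sub>0 where "M\<^sub>0 = max 1 (C powr (1 / (\<gamma> - 1)))"
  have bL: "(b / \<Lambda>) powr \<gamma> > 0" using b \<Lambda> by simp
  have K\<^sub>0: "K\<^sub>0 \<ge> 0" unfolding K\<^sub>0_def using params b N(1)
    by (intro add_nonneg_nonneg mult_nonneg_nonneg) auto
  show thesis
  proof (rule that[of M\<^sub>0])
    show "M\<^sub>0 \<ge> 1" by (simp add: M\<^sub>0_def)
    fix lam u x y
    assume lam: "0 \<le> lam" and u: "visc_solution \<nu> j lam G c u"
    have sub: "visc_usc_subsolution \<nu> j lam G c u" and cont: "continuous_on UNIV u" and per: "Zd_periodic u"
      using u unfolding visc_solution_def visc_subsolution_iff_usc visc_usc_subsolution_def by blast+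
    have "bounded (range u)" by (rule Zd_periodic_bounded[OF per cont])
    then obtain B where B: "\<And>x. \<bar>u x\<bar> \<le> B" unfolding bounded_pos by auto
    obtain x\<^sub>1 where x\<^sub>1: "\<And>y. u y \<le> u x\<^sub>1" using usc_periodic_attains_sup[OF continuous_usc[OF cont] per] by metis
    have "usc (\<lambda>x. - u x)" using cont by (intro continuous_usc continuous_intros)
    moreover have "Zd_periodic (\<lambda>x. - u x)" using per by (rule Zd_periodic_comp)
    ultimately obtain x\<^sub>0 where x\<^sub>0: "\<And>y. - u y \<le> - u x\<^sub>0" using usc_periodic_attains_sup by metis
    define M where "M = u x\<^sub>1 - u x\<^sub>0"
    have osc: "u x - u y \<le> M" for x y using x\<^sub>0[of y] x\<^sub>1[of x] by (simp add: M_def)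
    show "u x - u y \<le> M\<^sub>0"
    proof (cases "M \<le> 1")
      case True
      then show ?thesis using osc[of x y] by (simp add: M\<^sub>0_def)
    next
      case False
      then have M: "M \<ge> 1" by simp
      have lip: "u x - u y \<le> \<Lambda> * M * norm (x - y)" for x y by (rule lipM[OF lam u M osc])
      obtain k where k: "\<And>i. k $ i \<in> \<int>" "(norm (x\<^sub>1 + k - x\<^sub>0))\<^sup>2 \<le> lattice_dist2 x\<^sub>0 x\<^sub>1"
        by (rule lattice_representative_near[of x\<^sub>1 x\<^sub>0]) blast
      define x\<^sub>2 where "x\<^sub>2 = x\<^sub>1 + k"
      have ux2: "u x\<^sub>2 = u x\<^sub>1" unfolding x\<^sub>2_def by (rule Zd_periodicD[OF per k(1)])
      have x2d: "(norm (x\<^sub>2 - x\<^sub>0))\<^sup>2 \<le> d"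
        using k(2) lattice_dist2_le_dim[of x\<^sub>0 x\<^sub>1] by (simp add: x\<^sub>2_def d_def)
      define \<theta> where "\<theta> x = u x - b * M * (norm (x - x\<^sub>0))\<^sup>2" for x
      have "usc \<theta>" unfolding \<theta>_def by (intro continuous_usc continuous_intros cont)
      moreover have "cball x\<^sub>0 (2 * d) \<noteq> {}" using d by simp
      ultimately obtain xh where xh: "\<And>y. y \<in> cball x\<^sub>0 (2 * d) \<Longrightarrow> \<theta> y \<le> \<theta> xh"
        using usc_attains_sup[OF _ compact_cball] by metis
      \<comment> \<open>Beyond distance 2 d the paraboloid is at least 2 d M, more than the
        oscillation, so the maximum over the compact ball is global.\<close>
      have max: "\<theta> y \<le> \<theta> xh" for y
      proof (cases "y \<in> cball x\<^sub>0 (2 * d)")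
        case False
        then have "2 * d \<le> norm (y - x\<^sub>0)" by (simp add: dist_norm norm_minus_commute)
        then have "(2 * d)\<^sup>2 \<le> (norm (y - x\<^sub>0))\<^sup>2" using d by (intro power_mono) auto
        then have "b * M * (2 * d)\<^sup>2 \<le> b * M * (norm (y - x\<^sub>0))\<^sup>2" using b M by (intro mult_left_mono) auto
        moreover have "b * M * (2 * d)\<^sup>2 = M * (2 * d)" using d by (simp add: b_def power2_eq_square)
        moreover have "M * 1 \<le> M * (2 * d)" using d M by (intro mult_left_mono) auto
        ultimately have "\<theta> y \<le> u x\<^sub>0" using osc[of y x\<^sub>0] unfolding \<theta>_def by linarith
        also have "u x\<^sub>0 = \<theta> x\<^sub>0" by (simp add: \<theta>_def)
        also have "\<theta> x\<^sub>0 \<le> \<theta> xh" using d by (intro xh) simp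
        finally show ?thesis .
      qed (rule xh)
      \<comment> \<open>A rise of M/2 with Lipschitz constant \<Lambda> M takes a distance of at
        least 1/(2 \<Lambda>). M cancels because that constant is linear in M, and the slope at xh
        is therefore at least b M/\<Lambda>.\<close>
      define r where "r = norm (xh - x\<^sub>0)"
      have r: "r \<ge> 1 / (2 * \<Lambda>)"
      proof -
        have "b * M * (norm (x\<^sub>2 - x\<^sub>0))\<^sup>2 \<le> b * M * d" using x2d b M by (intro mult_left_mono) auto
        also have "\<dots> = M / 2" using d by (simp add: b_def)
        finally have "u x\<^sub>1 - M / 2 \<le> \<theta> x\<^sub>2" by (simp add: \<theta>_def ux2)
        also have "\<dots> \<le> \<theta> xh" by (rule max)
        also have "\<dots> \<le> u xh" using b M by (simp add: \<theta>_def)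
        finally have "M / 2 \<le> u xh - u x\<^sub>0" unfolding M_def by argo
        also have "\<dots> \<le> \<Lambda> * M * r" unfolding r_def by (rule lip)
        finally have "M * (1 / 2) \<le> M * (\<Lambda> * r)" by (simp add: mult_ac)
        then have "1 / 2 \<le> \<Lambda> * r" using M by (simp only: mult_le_cancel_left_pos)
        then show ?thesis using \<Lambda> by (simp add: pos_divide_le_eq mult_ac)
      qed
      define p where "p = (2 * b * M) *\<^sub>R (xh - x\<^sub>0)"
      have np: "b / \<Lambda> * M \<le> norm p"
      proof -
        have "b / \<Lambda> * M = 2 * b * M * (1 / (2 * \<Lambda>))" by simp
        also have "\<dots> \<le> 2 * b * M * r" using r b M by (intro mult_left_mono) auto
        also have "\<dots> = norm p" using b M by (simp add: p_def r_def)
        finally show ?thesis .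
      qed
      have touch: "u x' \<le> u xh + (x' - xh) \<bullet> p + b * M * (norm (x' - xh))\<^sup>2" for x'
      proof -
        have eq: "(norm (x' - x\<^sub>0))\<^sup>2 = (norm (xh - x\<^sub>0))\<^sup>2 + 2 * ((x' - xh) \<bullet> (xh - x\<^sub>0)) + (norm (x' - xh))\<^sup>2"
          by (simp add: power2_norm_eq_inner inner_diff_left inner_diff_right inner_commute)
        have "b * M * (norm (x' - x\<^sub>0))\<^sup>2 = b * M * (norm (xh - x\<^sub>0))\<^sup>2 + (x' - xh) \<bullet> p + b * M * (norm (x' - xh))\<^sup>2"
          unfolding eq p_def inner_scaleR_right distrib_left by simp
        then show ?thesis using max[of x'] by (simp add: \<theta>_def)
      qed
      have bM: "b * M \<ge> 0" using b M by simp
      note PW = usc_subsolution_pointwise[OF sub B bM touch]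
      have "(\<integral>z. incr j u xh p z \<partial>\<nu>) \<le> (\<integral>z. (b * M * C\<^sub>j\<^sup>2 + M) * wt z \<partial>\<nu>)"
      proof (intro integral_mono PW(1) integrable_mult_right integrable_wt)
        have ub: "u y \<le> u xh + M" for y using osc[of y xh] by linarith
        have M0: "M \<ge> 0" using M by simp
        show "incr j u xh p z \<le> (b * M * C\<^sub>j\<^sup>2 + M) * wt z" for z
          by (rule incr_le_wt[OF bM M0 touch ub])
      qed
      also have "\<dots> = (b * M * C\<^sub>j\<^sup>2 + M) * (\<integral>z. wt z \<partial>\<nu>)" by simp
      also have "\<dots> \<le> (b * M * C\<^sub>j\<^sup>2 + M) * C\<^sub>\<nu>" using integral_wt_le b M by (intro mult_left_mono) auto
      finally have up: "lam * u xh + G xh p - c \<le> M * ((b * C\<^sub>j\<^sup>2 + 1) * C\<^sub>\<nu>)" using PW(2) by (simp add: algebra_simps)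
      have low: "\<alpha>\<^sub>0 * norm p powr \<gamma> - 1 / \<alpha>\<^sub>0 \<le> G xh p" by (rule G1)
      have lu: "- (\<bar>c\<bar> + 1 / \<alpha>\<^sub>0 + \<alpha>\<^sub>1) \<le> lam * u xh" using visc_solution_lam_bound[OF u lam, of xh] by (simp add: abs_le_iff)
      define Z where "Z = \<bar>c\<bar> + 1 / \<alpha>\<^sub>0 + \<alpha>\<^sub>1 + \<bar>c\<bar> + 1 / \<alpha>\<^sub>0"
      have Z: "Z \<ge> 0" using params by (simp add: Z_def)
      have "\<alpha>\<^sub>0 * norm p powr \<gamma> \<le> 1 * Z + M * ((b * C\<^sub>j\<^sup>2 + 1) * C\<^sub>\<nu>)"
        using up low lu abs_ge_self[of c] unfolding Z_def by argo
      also have "\<dots> \<le> M * Z + M * ((b * C\<^sub>j\<^sup>2 + 1) * C\<^sub>\<nu>)" using M Z by (intro add_right_mono mult_right_mono) auto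
      also have "\<dots> = M * K\<^sub>0" by (simp add: Z_def K\<^sub>0_def algebra_simps)
      finally have 1: "\<alpha>\<^sub>0 * norm p powr \<gamma> \<le> M * K\<^sub>0" .
      have "(b / \<Lambda> * M) powr \<gamma> \<le> norm p powr \<gamma>" using np b \<Lambda> M params by (intro powr_mono2) auto
      moreover have "(b / \<Lambda> * M) powr \<gamma> = (b / \<Lambda>) powr \<gamma> * (M * M powr (\<gamma> - 1))"
        using b \<Lambda> M powr_add[of M 1 "\<gamma> - 1"] by (simp add: powr_mult powr_divide)
      ultimately have "\<alpha>\<^sub>0 * ((b / \<Lambda>) powr \<gamma> * (M * M powr (\<gamma> - 1))) \<le> \<alpha>\<^sub>0 * norm p powr \<gamma>"
        using params by (intro mult_left_mono) auto
      \<comment> \<open>Coercivity gives M^\<gamma> on the left against M on the right; cancelling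
        one M leaves a bound on M^(\<gamma> - 1).\<close>
      with 1 have "M * (M powr (\<gamma> - 1) * (\<alpha>\<^sub>0 * (b / \<Lambda>) powr \<gamma>)) \<le> M * K\<^sub>0" by (simp add: mult_ac)
      then have "M powr (\<gamma> - 1) * (\<alpha>\<^sub>0 * (b / \<Lambda>) powr \<gamma>) \<le> K\<^sub>0" using M by (simp only: mult_le_cancel_left_pos)
      moreover have "0 < \<alpha>\<^sub>0 * (b / \<Lambda>) powr \<gamma>" using params(1) bL by (rule mult_pos_pos)
      ultimately have "M powr (\<gamma> - 1) \<le> C" unfolding C_def by (simp add: pos_le_divide_eq)
      then have "(M powr (\<gamma> - 1)) powr (1 / (\<gamma> - 1)) \<le> C powr (1 / (\<gamma> - 1))" using params by (intro powr_mono2) auto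
      moreover have "(M powr (\<gamma> - 1)) powr (1 / (\<gamma> - 1)) = M" using M params by (simp add: powr_powr)
      ultimately show ?thesis using osc[of x y] by (simp add: M\<^sub>0_def)
    qed
  qed
qed

theorem uniform_lipschitz_bound:
  obtains \<kappa> where "\<kappa> > 0"
    "\<And>lam u. 0 \<le> lam \<Longrightarrow> visc_solution \<nu> j lam G c u \<Longrightarrow> \<kappa>-lipschitz_on UNIV u"
proof -
  obtain \<Lambda> where \<Lambda>: "\<Lambda> \<ge> 1" and lipM:
    "\<And>lam u M x y. 0 \<le> lam \<Longrightarrow> visc_solution \<nu> j lam G c u \<Longrightarrow> 1 \<le> M \<Longrightarrow> (\<And>x y. u x - u y \<le> M) \<Longrightarrow>
       u x - u y \<le> \<Lambda> * M * norm (x - y)"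
    by (rule lipschitz_bound_linear_in_osc[of c]) blast
  obtain M\<^sub>0 where M\<^sub>0: "M\<^sub>0 \<ge> 1" and osc: "\<And>lam u x y. 0 \<le> lam \<Longrightarrow> visc_solution \<nu> j lam G c u \<Longrightarrow> u x - u y \<le> M\<^sub>0"
    by (rule osc_bound[of c]) blast
  show thesis
  proof (rule that[of "\<Lambda> * M\<^sub>0"])
    show "\<Lambda> * M\<^sub>0 > 0" using \<Lambda> M\<^sub>0 by simp
    fix lam u assume u: "0 \<le> lam" "visc_solution \<nu> j lam G c u"
    have le: "u x - u y \<le> \<Lambda> * M\<^sub>0 * norm (x - y)" for x y by (rule lipM[OF u M\<^sub>0 osc[OF u]])
    show "(\<Lambda> * M\<^sub>0)-lipschitz_on UNIV u"
    proof (rule lipschitz_onI)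
      show "dist (u x) (u y) \<le> \<Lambda> * M\<^sub>0 * dist x y" for x y
        using le[of x y] le[of y x] by (simp add: dist_norm abs_le_iff norm_minus_commute[of y x])
    qed (use \<Lambda> M\<^sub>0 in simp)
  qed
qed

end

section \<open>The gradient bound almost everywhere and the conclusion\<close>

text \<open>At a point of differentiability the derivative along the gradient p itself is |p|^2,
  while the Lipschitz bound limits it to \<kappa> |p|.\<close>

lemma lipschitz_imp_grad_bounded_ae:
  fixes u :: "real ^ 'd \<Rightarrow> real"
  assumes lip: "\<kappa>-lipschitz_on UNIV u"
  shows "grad_bounded_ae \<kappa> u"
  unfolding grad_bounded_ae_def
proof (intro conjI)
  show "\<exists>L. L-lipschitz_on UNIV u" using lip by blast
  show "AE x in lebesgue. u differentiable at x \<and> norm (grad u x) \<le> \<kappa>"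
    using rademacher[OF lip]
  proof eventually_elim
    fix x assume diff: "u differentiable at x"
    then obtain D where D: "(u has_derivative D) (at x)" unfolding differentiable_def by blast
    then have bl: "bounded_linear D" by (rule has_derivative_bounded_linear)
    define p where "p = (\<Sum>b\<in>Basis. D b *\<^sub>R b)"
    have Dp: "D h = h \<bullet> p" for h
    proof -
      have "D h = D (\<Sum>b\<in>Basis. (h \<bullet> b) *\<^sub>R b)" by (simp add: euclidean_representation)
      also have "\<dots> = (\<Sum>b\<in>Basis. (h \<bullet> b) * D b)"
        using bl by (simp add: bounded_linear.linear linear_sum linear_scale)
      also have "\<dots> = h \<bullet> p" by (simp add: p_def inner_sum_right mult.commute)
      finally show ?thesis .
    qed
    have "D = (\<lambda>h. h \<bullet> p)" by (rule ext) (rule Dp)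
    with D have gd: "GDERIV u x :> p" by (simp add: gderiv_def)
    have "norm p \<le> \<kappa>"
    proof (cases "p = 0")
      case True
      then show ?thesis using lipschitz_on_nonneg[OF lip] by simp
    next
      case False
      then have np: "norm p > 0" by simp
      have "((\<lambda>t. u (x + t *\<^sub>R p)) has_derivative (\<lambda>s. (s *\<^sub>R p) \<bullet> p)) (at 0)"
      proof (rule has_derivative_compose[of "\<lambda>t. x + t *\<^sub>R p" "\<lambda>s. s *\<^sub>R p" 0 UNIV u "\<lambda>h. h \<bullet> p"])
        show "((\<lambda>t. x + t *\<^sub>R p) has_derivative (\<lambda>s. s *\<^sub>R p)) (at 0)" by (auto intro!: derivative_eq_intros)
        show "(u has_derivative (\<lambda>h. h \<bullet> p)) (at (x + 0 *\<^sub>R p))" using gd by (simp add: gderiv_def)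
      qed
      then have "((\<lambda>t. u (x + t *\<^sub>R p)) has_real_derivative (p \<bullet> p)) (at 0)"
        by (simp add: has_field_derivative_def mult.commute[of _ "p \<bullet> p"])
      then have "((\<lambda>t. (u (x + t *\<^sub>R p) - u (x + 0 *\<^sub>R p)) / (t - 0)) \<longlongrightarrow> p \<bullet> p) (at 0)"
        unfolding has_field_derivative_iff .
      moreover have "\<forall>\<^sub>F t in at 0. (u (x + t *\<^sub>R p) - u (x + 0 *\<^sub>R p)) / (t - 0) \<le> \<kappa> * norm p"
        unfolding eventually_at_filter
      proof (intro always_eventually allI impI)
        fix t :: real assume t: "t \<noteq> 0"
        have "\<bar>u (x + t *\<^sub>R p) - u x\<bar> \<le> \<kappa> * (\<bar>t\<bar> * norm p)"
          using lipschitz_onD[OF lip, of "x + t *\<^sub>R p" x] by (simp add: dist_norm)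
        then have "\<bar>u (x + t *\<^sub>R p) - u x\<bar> / \<bar>t\<bar> \<le> \<kappa> * norm p" using t by (simp add: pos_divide_le_eq mult_ac)
        then have "\<bar>(u (x + t *\<^sub>R p) - u x) / t\<bar> \<le> \<kappa> * norm p" by (simp only: abs_divide)
        then have "(u (x + t *\<^sub>R p) - u x) / t \<le> \<kappa> * norm p" by (rule order_trans[OF abs_ge_self])
        then show "(u (x + t *\<^sub>R p) - u (x + 0 *\<^sub>R p)) / (t - 0) \<le> \<kappa> * norm p" by simp
      qed
      ultimately have "p \<bullet> p \<le> \<kappa> * norm p" by (rule tendsto_upperbound) simp
      then have "norm p * norm p \<le> \<kappa> * norm p" by (simp add: power2_norm_eq_inner[symmetric] power2_eq_square)
      then show ?thesis using np by (simp only: mult_le_cancel_right_pos)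
    qed
    then show "u differentiable at x \<and> norm (grad u x) \<le> \<kappa>" using diff grad_eq[OF gd] by simp
  qed
qed

text \<open>Moving c to the right-hand side keeps the Hamiltonian equal to G, for which the growth
  conditions hold with the given constants.\<close>

lemma visc_solution_shift:
  "visc_solution \<nu> j lam (\<lambda>x p. G x p - c) 0 u \<longleftrightarrow> visc_solution \<nu> j lam G c u"
proof -
  have "(s + (g - c) \<le> 0) = (s + g \<le> c)" "(s + (g - c) \<ge> 0) = (s + g \<ge> c)" for s g :: real by auto
  then show ?thesis
    unfolding visc_solution_def visc_subsolution_def visc_supersolution_def by simp
qed

theorem proposition5p6:
  fixes \<nu> :: "(real ^ 'd) measure"
    and j :: "real ^ 'd \<Rightarrow> real ^ 'd \<Rightarrow> real ^ 'd"
    and G :: "real ^ 'd \<Rightarrow> real ^ 'd \<Rightarrow> real"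
    and C\<^sub>\<nu> C\<^sub>j \<alpha>\<^sub>0 \<alpha>\<^sub>1 \<gamma> c :: real
  assumes nu_borel: "sets \<nu> = sets borel"
    and j_periodic: "Zd_periodic j"
    and j_borel: "(\<lambda>(x, z). j x z) \<in> borel_measurable borel"
    and N: "C\<^sub>\<nu> > 0"
      "(\<integral>\<^sup>+ z. ennreal (min 1 ((norm z)\<^sup>2)) \<partial>\<nu>) \<le> ennreal C\<^sub>\<nu>"
    and J1: "C\<^sub>j > 0"
      "\<And>x z. norm (j x z) \<le> C\<^sub>j * norm z"
      "\<And>x y z. norm (j x z - j y z) \<le> C\<^sub>j * norm (x - y) * norm z"
    and J2: "\<And>R. R > 0 \<Longrightarrow> \<exists>C\<^sub>R>0. \<forall>x y.
      (\<integral>\<^sup>+ z\<in>- ball 0 R. ennreal (norm (j x z - j y z)) \<partial>\<nu>) \<le> ennreal (C\<^sub>R * norm (x - y))"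
    and params: "\<alpha>\<^sub>0 > 0" "\<alpha>\<^sub>1 > 0" "\<gamma> > 1"
    and G_periodic: "Zd_periodic G"
    and G_convex: "\<And>x. convex_on UNIV (G x)"
    and G1: "\<And>x p. \<alpha>\<^sub>0 * norm p powr \<gamma> - 1 / \<alpha>\<^sub>0 \<le> G x p"
      "\<And>x p. G x p \<le> \<alpha>\<^sub>1 * (norm p powr \<gamma> + 1)"
    and G2: "\<And>x p q. \<bar>G x p - G x q\<bar> \<le>
      \<alpha>\<^sub>1 * (norm p + norm q + 1) powr (\<gamma> - 1) * norm (p - q)"
    and G3: "\<And>x y p. \<bar>G x p - G y p\<bar> \<le> \<alpha>\<^sub>1 * (norm p powr \<gamma> + 1) * norm (x - y)"
    and c_critical: "is_critical_constant \<nu> j G c"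
  shows "(\<forall>lam\<in>{0..<1}. \<exists>u. visc_solution \<nu> j lam (\<lambda>x p. G x p - c) 0 u) \<and>
    (\<exists>\<kappa>>0. \<forall>lam\<in>{0..<1}. \<forall>u. visc_solution \<nu> j lam (\<lambda>x p. G x p - c) 0 u \<longrightarrow>
       grad_bounded_ae \<kappa> u)"
proof -
  obtain C\<^sub>J where C\<^sub>J: "C\<^sub>J > 0"
    "\<And>x y. (\<integral>\<^sup>+ z\<in>- ball 0 1. ennreal (norm (j x z - j y z)) \<partial>\<nu>) \<le> ennreal (C\<^sub>J * norm (x - y))"
    using J2[of 1] by auto
  interpret superlinear_hamiltonian_J2 \<nu> j C\<^sub>\<nu> C\<^sub>j G \<alpha>\<^sub>0 \<alpha>\<^sub>1 \<gamma> C\<^sub>J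
    by unfold_locales (fact assms C\<^sub>J)+
  have "\<exists>u. visc_solution \<nu> j lam G c u" if "lam \<in> {0..<1}" for lam
  proof (cases "lam = 0")
    case True
    then show ?thesis using c_critical by (simp add: is_critical_constant_def)
  next
    case False
    with that show ?thesis by (intro perron_existence) auto
  qed
  moreover obtain \<kappa> where "\<kappa> > 0"
    "\<And>lam u. 0 \<le> lam \<Longrightarrow> visc_solution \<nu> j lam G c u \<Longrightarrow> \<kappa>-lipschitz_on UNIV u"
    by (rule uniform_lipschitz_bound[of c]) blast
  then have "\<exists>\<kappa>>0. \<forall>lam\<in>{0..<1}. \<forall>u. visc_solution \<nu> j lam G c u \<longrightarrow> grad_bounded_ae \<kappa> u"
    using lipschitz_imp_grad_bounded_ae by (metis atLeastLessThan_iff)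
  ultimately show ?thesis unfolding visc_solution_shift by blast
qed

end
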